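(* Let $\delta>0$ and suppose Assumptions 1–3 (stated in the context) hold. Let $b,b'\in\mathcal L$ satisfy $$\left|\int_{-\pi}^{\pi}f_b(\mu)\,d\mu\right|>\delta,\qquad\left|\int_{-\pi}^{\pi}f_{b'}(\mu)\,d\mu\right|>\delta,$$ and let $w_n(b),w_n(b')$ be the estimates of $b,b'$ produced by the estimation procedure at level $\delta$ described in the context. Then for all $\eta,\eta'$, $$\operatorname{cov}\left(\hat f_{w_n(b)}(\eta),\hat f_{w_n(b')}(\eta')\right)=O\left(\frac1{nb_n}\right)+O\left(\frac{\log n}{n}\right)$$ as $n\to\infty$, $b_n\downarrow0$, $nb_n\to\infty$.
   Context: Setting. $\{X_k\}_{k\in\mathbb Z}$ is a real-valued, mean-zero process. It is harmonizable: $X_k=\int_{-\pi}^{\pi}e^{ik\lambda}\,dZ(\lambda)$ in mean square, where the spectral covariance measure $dF(\lambda,\mu)=E\,dZ(\lambda)\overline{dZ(\mu)}$ on $[-\pi,\pi]^2$ has finite total variation. Its covariance function is almost periodic, so $F$ is carried by lines $\lambda=\mu+b$ (mod $2\pi$), and on these lines $F$ has densities $f_b(\mu)$. $\mathcal L\subset(-\pi,\pi]$ is the set of $b$ whose line carries nontrivial spectral mass ($f_b\not\equiv0$). Thus $$r_{k,m}=EX_kX_m=\sum_{b\in\mathcal L}\int_{-\pi}^{\pi}e^{ik(\mu+b)}e^{-im\mu}f_b(\mu)\,d\mu=\sum_{b\in\mathcal L}e^{ikb}c_b(k-m),\qquad c_b(j)=\int_{-\pi}^{\pi}e^{ij\lambda}f_b(\lambda)\,d\lambda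 .$$ Assumption 1: $\{X_k\}$ is a Gaussian process (in addition to being real-valued, mean-zero and harmonizable with almost periodic covariance function), $\mathcal L$ is finite, and each $f_b$, $b\in\mathcal L$, is continuously differentiable on the torus, i.e. is a complex-valued $2\pi$-periodic $C^1$ function. Assumption 2: there is a function $c(j)\ge0$ on $\mathbb Z$ with $|c_b(j)|\le c(j)$ for all $b\in\mathcal L$, $j\in\mathbb Z$, and $\sum_{j\in\mathbb Z}c(j)<\infty$. Assumption 3: $\int_{-\pi}^{\pi}f_b(\mu)\,d\mu\neq0$ for every $b\in\mathcal L$. Notation. $n$ is an even positive integer, $F_n(\lambda)=\sum_{t=-n/2}^{n/2}X_te^{-it\lambda}$, $I_n(\lambda,\mu)=\frac{1}{2\pi(n+1)}F_n(\lambda)\overline{F_n(\mu)}$, and $$U_n(w)=\int_{-\pi}^{\pi}I_n(w+\mu,\mu)\,d\mu=\frac1{n+1}\sum_{k=-n/2}^{n/2}X_k^2e^{-iwk}.$$ For complex random variables $\operatorname{cov}(A,B)=E[A\overline B]-E[A]\,\overline{E[B]}$. Kernel estimate. $K$ is a continuous nonnegative symmetric function on $\mathbb R$ with bounded support and $\int K=1$. $K_n(x)=b_n^{-1}K(b_n^{-1}x)$, where the bandwidths satisfy $b_n\downarrow0$, $nb_n\to\infty$ (the bandwidth $b_n$ is unrelated to $b\in\mathcal L$). $\hat f_w(\eta)=\int_{-\pi}^{\pi}I_n(\mu+w,\mu)K_n(\mu-\eta)\,d\mu$. Estimation procedure at level $\delta>0$. Fix a sequence $\ell(n)$ with $\ell(n)\to\infty$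 and $\ell(n)=o(n)$ (e.g. $\ell(n)=\log n$ or $n^{1/2}$). Divide the range $-\pi\le w\le\pi$ into blocks of length $\ell(n)/n$ and find the location of the global maximum of $|U_n(w)|$ in each block. Discard every block whose maximum is less than or equal to $\delta+\left(\frac{\log n}{n}\right)^{1/4}$. Also, whenever two maxima are located within $\ell(n)/n$ of each other, discard the block with the smaller maximum (ties broken arbitrarily). The locations of the remaining maxima are the estimates. For $b\in\mathcal L$ with $|\int_{-\pi}^{\pi}f_b(\mu)\,d\mu|>\delta$, $w_n(b)$ denotes the remaining location associated with $b$, i.e. the one closest to $b$ (set to an arbitrary value if no location remains). Frequencies and their distances are understood modulo $2\pi$. *)

theory Defs
  imports "HOL-Probability.Probability" "HOL-Library.Landau_Symbols"
begin

section \<open>The process\<close>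

text \<open>\<open>\<sigma> = 0\<close> covers the degenerate normal laws, which have no density.\<close>

definition gaussian_process :: "'a measure \<Rightarrow> (int \<Rightarrow> 'a \<Rightarrow> real) \<Rightarrow> bool" where
  "gaussian_process M X \<longleftrightarrow>
     (\<forall>k. X k \<in> borel_measurable M) \<and>
     (\<forall>J (a :: int \<Rightarrow> real). finite J \<longrightarrow>
        (\<exists>m \<sigma>. 0 \<le> \<sigma> \<and>
           (if \<sigma> = 0 then AE \<omega> in M. (\<Sum>k\<in>J. a k * X k \<omega>) = m
            else distributed M lborel (\<lambda>\<omega>. \<Sum>k\<in>J. a k * X k \<omega>) (normal_density m \<sigma>))))"

text \<open>Mean-square Riemann--Stieltjes integral of \<open>g\<close> over \<open>[-\<pi>, \<pi>]\<close> with respect to \<open>dZ\<close>: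
  the limit in mean square of the tagged sums as the mesh tends to 0.\<close>

definition has_ms_integral ::
    "'a measure \<Rightarrow> (real \<Rightarrow> 'a \<Rightarrow> complex) \<Rightarrow> (real \<Rightarrow> complex) \<Rightarrow> ('a \<Rightarrow> complex) \<Rightarrow> bool" where
  "has_ms_integral M Z g Y \<longleftrightarrow>
     (\<forall>\<epsilon>>0. \<exists>d>0. \<forall>N (t :: nat \<Rightarrow> real) (s :: nat \<Rightarrow> real).
        t 0 = - pi \<and> t N = pi \<and>
        (\<forall>i<N. t i \<le> s i \<and> s i \<le> t (Suc i) \<and> t (Suc i) - t i < d) \<longrightarrow>
        (LINT \<omega>|M. (cmod (Y \<omega> - (\<Sum>i<N. g (s i) * (Z (t (Suc i)) \<omega> - Z (t i) \<omega>))))\<^sup>2) < \<epsilon>)"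

text \<open>The complex measure on \<open>[-\<pi>, \<pi>]\<^sup>2\<close> carried by the lines \<open>\<lambda> = \<mu> + b\<close> (mod \<open>2\<pi>\<close>), \<open>b \<in> L\<close>,
  with density \<open>f b \<mu>\<close> on the line \<open>b\<close>.  Here \<open>Arg (cis x)\<close> is the representative of \<open>x\<close>
  modulo \<open>2\<pi>\<close> in \<open>(-\<pi>, \<pi>]\<close>.\<close>

definition line_measure :: "real set \<Rightarrow> (real \<Rightarrow> real \<Rightarrow> complex) \<Rightarrow> (real \<times> real) set \<Rightarrow> complex" where
  "line_measure L f S =
     (\<Sum>\<^sub>\<infinity>b\<in>L. LBINT \<mu>:{-pi..pi}. indicator S (Arg (cis (\<mu> + b)), \<mu>) * f b \<mu>)"

text \<open>Harmonizable process whose spectral covariance measure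
  \<open>dF(\<lambda>, \<mu>) = E dZ(\<lambda>) cnj (dZ(\<mu>))\<close> is the line measure of \<open>(L, f)\<close>.  The summability
  condition says that \<open>F\<close> has finite total variation; the form of \<open>F\<close> makes the covariance
  function almost periodic.\<close>

definition harmonizable_on_lines ::
    "'a measure \<Rightarrow> (int \<Rightarrow> 'a \<Rightarrow> real) \<Rightarrow> real set \<Rightarrow> (real \<Rightarrow> real \<Rightarrow> complex) \<Rightarrow> bool" where
  "harmonizable_on_lines M X L f \<longleftrightarrow>
     (\<forall>k. X k \<in> borel_measurable M \<and> integrable M (\<lambda>\<omega>. (X k \<omega>)\<^sup>2)) \<and>
     L \<subseteq> {-pi<..pi} \<and>
     (\<forall>b\<in>L. set_integrable lborel {-pi..pi} (f b) \<and>
        \<not> (AE \<mu> in lborel. \<mu> \<in> {-pi..pi} \<longrightarrow> f b \<mu> = 0)) \<and>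
     (\<lambda>b. LBINT \<mu>:{-pi..pi}. cmod (f b \<mu>)) summable_on L \<and>
     (\<exists>Z :: real \<Rightarrow> 'a \<Rightarrow> complex.
        (\<forall>x\<in>{-pi..pi}. Z x \<in> borel_measurable M \<and> integrable M (\<lambda>\<omega>. (cmod (Z x \<omega>))\<^sup>2)) \<and>
        (\<forall>x\<^sub>1 x\<^sub>2 y\<^sub>1 y\<^sub>2. - pi \<le> x\<^sub>1 \<and> x\<^sub>1 \<le> x\<^sub>2 \<and> x\<^sub>2 \<le> pi \<and> - pi \<le> y\<^sub>1 \<and> y\<^sub>1 \<le> y\<^sub>2 \<and> y\<^sub>2 \<le> pi \<longrightarrow>
           (LINT \<omega>|M. (Z x\<^sub>2 \<omega> - Z x\<^sub>1 \<omega>) * cnj (Z y\<^sub>2 \<omega> - Z y\<^sub>1 \<omega>)) =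
             line_measure L f ({x\<^sub>1<..x\<^sub>2} \<times> {y\<^sub>1<..y\<^sub>2})) \<and>
        (\<forall>k. has_ms_integral M Z (\<lambda>x. cis (of_int k * x)) (\<lambda>\<omega>. complex_of_real (X k \<omega>))))"

definition line_coeff :: "(real \<Rightarrow> real \<Rightarrow> complex) \<Rightarrow> real \<Rightarrow> int \<Rightarrow> complex" where
  "line_coeff f b j = (LBINT \<mu>:{-pi..pi}. cis (of_int j * \<mu>) * f b \<mu>)"

definition assumption1 ::
    "'a measure \<Rightarrow> (int \<Rightarrow> 'a \<Rightarrow> real) \<Rightarrow> real set \<Rightarrow> (real \<Rightarrow> real \<Rightarrow> complex) \<Rightarrow> bool" where
  "assumption1 M X L f \<longleftrightarrow>
     (\<forall>k. (LINT \<omega>|M. X k \<omega>) = 0) \<and>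
     harmonizable_on_lines M X L f \<and>
     gaussian_process M X \<and>
     finite L \<and>
     (\<forall>b\<in>L. (\<forall>x. f b (x + 2 * pi) = f b x) \<and> f b C1_differentiable_on UNIV)"

definition assumption2 :: "real set \<Rightarrow> (real \<Rightarrow> real \<Rightarrow> complex) \<Rightarrow> bool" where
  "assumption2 L f \<longleftrightarrow>
     (\<exists>c :: int \<Rightarrow> real. (\<forall>j. 0 \<le> c j) \<and>
        (\<forall>b\<in>L. \<forall>j. cmod (line_coeff f b j) \<le> c j) \<and> c summable_on UNIV)"

definition assumption3 :: "real set \<Rightarrow> (real \<Rightarrow> real \<Rightarrow> complex) \<Rightarrow> bool" where
  "assumption3 L f \<longleftrightarrow> (\<forall>b\<in>L. (LBINT \<mu>:{-pi..pi}. f b \<mu>) \<noteq> 0)"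


section \<open>Periodogram and kernel estimate\<close>

definition dft :: "(int \<Rightarrow> 'a \<Rightarrow> real) \<Rightarrow> nat \<Rightarrow> real \<Rightarrow> 'a \<Rightarrow> complex" where
  "dft X n x \<omega> =
     (\<Sum>t = - int (n div 2)..int (n div 2). complex_of_real (X t \<omega>) * cis (- (of_int t * x)))"

definition periodogram :: "(int \<Rightarrow> 'a \<Rightarrow> real) \<Rightarrow> nat \<Rightarrow> real \<Rightarrow> real \<Rightarrow> 'a \<Rightarrow> complex" where
  "periodogram X n x \<mu> \<omega> =
     complex_of_real (1 / (2 * pi * (real n + 1))) * dft X n x \<omega> * cnj (dft X n \<mu> \<omega>)"

definition U_stat :: "(int \<Rightarrow> 'a \<Rightarrow> real) \<Rightarrow> nat \<Rightarrow> real \<Rightarrow> 'a \<Rightarrow> complex" where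
  "U_stat X n w \<omega> = (LBINT \<mu>:{-pi..pi}. periodogram X n (w + \<mu>) \<mu> \<omega>)"

definition kernel :: "(real \<Rightarrow> real) \<Rightarrow> bool" where
  "kernel K \<longleftrightarrow>
     continuous_on UNIV K \<and> (\<forall>x. 0 \<le> K x) \<and> (\<forall>x. K (- x) = K x) \<and>
     bounded {x. K x \<noteq> 0} \<and> (LBINT x. K x) = 1"

definition scaled_kernel :: "(real \<Rightarrow> real) \<Rightarrow> real \<Rightarrow> real \<Rightarrow> real" where
  "scaled_kernel K h x = K (x / h) / h"

definition fhat ::
    "(int \<Rightarrow> 'a \<Rightarrow> real) \<Rightarrow> (real \<Rightarrow> real) \<Rightarrow> (nat \<Rightarrow> real) \<Rightarrow> nat \<Rightarrow> real \<Rightarrow> real \<Rightarrow> 'a \<Rightarrow> complex" where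
  "fhat X K bw n w \<eta> \<omega> =
     (LBINT \<mu>:{-pi..pi}.
        periodogram X n (\<mu> + w) \<mu> \<omega> * complex_of_real (scaled_kernel K (bw n) (\<mu> - \<eta>)))"

definition complex_cov :: "'a measure \<Rightarrow> ('a \<Rightarrow> complex) \<Rightarrow> ('a \<Rightarrow> complex) \<Rightarrow> complex" where
  "complex_cov M A B =
     (LINT \<omega>|M. A \<omega> * cnj (B \<omega>)) - (LINT \<omega>|M. A \<omega>) * cnj (LINT \<omega>|M. B \<omega>)"


section \<open>The estimation procedure\<close>

definition torus_dist :: "real \<Rightarrow> real \<Rightarrow> real" where
  "torus_dist x y = \<bar>Arg (cis (x - y))\<bar>"

text \<open>Division of \<open>[-\<pi>, \<pi>]\<close> into closed blocks of length \<open>h\<close>, starting at \<open>-\<pi>\<close>.  The last block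
  is cut off at \<open>\<pi>\<close>.\<close>

definition block_indices :: "real \<Rightarrow> nat set" where
  "block_indices h = {j. - pi + real j * h < pi}"

definition block :: "real \<Rightarrow> nat \<Rightarrow> real set" where
  "block h j = {- pi + real j * h .. min pi (- pi + (real j + 1) * h)}"

text \<open>\<open>loc j\<close> is a location of the global maximum of \<open>V\<close> in block \<open>j\<close>.\<close>

definition block_maxima :: "(real \<Rightarrow> real) \<Rightarrow> real \<Rightarrow> (nat \<Rightarrow> real) \<Rightarrow> bool" where
  "block_maxima V h loc \<longleftrightarrow>
     (\<forall>j\<in>block_indices h. loc j \<in> block h j \<and> (\<forall>w\<in>block h j. V w \<le> V (loc j)))"

definition above_threshold :: "(real \<Rightarrow> real) \<Rightarrow> real \<Rightarrow> (nat \<Rightarrow> real) \<Rightarrow> real \<Rightarrow> nat set" where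
  "above_threshold V h loc \<theta> = {j \<in> block_indices h. \<theta> < V (loc j)}"

text \<open>Of two maxima within distance \<open>h\<close> the smaller one is discarded; between equal maxima the
  ranking \<open>tie\<close> decides.\<close>

definition remaining_blocks ::
    "(real \<Rightarrow> real) \<Rightarrow> real \<Rightarrow> (nat \<Rightarrow> real) \<Rightarrow> (nat \<Rightarrow> nat) \<Rightarrow> real \<Rightarrow> nat set" where
  "remaining_blocks V h loc tie \<theta> =
     {j \<in> above_threshold V h loc \<theta>.
        \<not> (\<exists>k \<in> above_threshold V h loc \<theta>. k \<noteq> j \<and> torus_dist (loc j) (loc k) \<le> h \<and>
             (V (loc j) < V (loc k) \<or> V (loc j) = V (loc k) \<and> tie k < tie j))}"

text \<open>\<open>w\<close> is a remaining location closest to \<open>b\<close>, and unconstrained if none remains.\<close>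

definition closest_location :: "nat set \<Rightarrow> (nat \<Rightarrow> real) \<Rightarrow> real \<Rightarrow> real \<Rightarrow> bool" where
  "closest_location R loc b w \<longleftrightarrow>
     R \<noteq> {} \<longrightarrow> (\<exists>j\<in>R. w = loc j \<and> (\<forall>k\<in>R. torus_dist (loc j) b \<le> torus_dist (loc k) b))"

text \<open>\<open>w b n\<close>, for the \<open>b \<in> L\<close> whose line has mass exceeding \<open>\<delta>\<close> in modulus, are the estimates
  resulting from one run of the procedure for each even \<open>n\<close>.  The locations and the ranking are
  arbitrary choices that may depend on \<open>n\<close> and \<open>\<omega>\<close>; only the resulting estimates are required
  to be random variables.\<close>

definition procedure_estimates ::
    "'a measure \<Rightarrow> (int \<Rightarrow> 'a \<Rightarrow> real) \<Rightarrow> real set \<Rightarrow> (real \<Rightarrow> real \<Rightarrow> complex) \<Rightarrow> real \<Rightarrow>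
     (nat \<Rightarrow> real) \<Rightarrow> (real \<Rightarrow> nat \<Rightarrow> 'a \<Rightarrow> real) \<Rightarrow> bool" where
  "procedure_estimates M X L f \<delta> ell w \<longleftrightarrow>
     (\<forall>b\<in>L. cmod (LBINT \<mu>:{-pi..pi}. f b \<mu>) > \<delta> \<longrightarrow> (\<forall>n. w b n \<in> borel_measurable M)) \<and>
     (\<forall>n. even n \<and> 0 < n \<longrightarrow> (\<forall>\<omega>\<in>space M.
        (let V = (\<lambda>v. cmod (U_stat X n v \<omega>));
             h = ell n / real n;
             \<theta> = \<delta> + (ln (real n) / real n) powr (1/4)
         in \<exists>loc tie. block_maxima V h loc \<and> inj tie \<and>
              (\<forall>b\<in>L. cmod (LBINT \<mu>:{-pi..pi}. f b \<mu>) > \<delta> \<longrightarrow>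
                 closest_location (remaining_blocks V h loc tie \<theta>) loc b (w b n \<omega>)))))"

text \<open>\<open>n \<rightarrow> \<infinity>\<close> along the even integers.\<close>

definition even_at_top :: "nat filter" where
  "even_at_top = inf at_top (principal {n. even n})"

end

theory Submission
  imports Defs "HOL-Real_Asymp.Real_Asymp"
begin

text \<open>
  The covariance of two random variables is at most twice the geometric mean of their mean square
  distances from arbitrary constants (\<open>complex_cov_le\<close>).  So it suffices to find constants \<open>\<Phi> n\<close>
  from which the estimate \<open>fhat\<close> at the random location \<open>w n\<close> has mean square distance of order
  \<open>1 / (n b_n)\<close> (\<open>estimate_mean_square\<close>).  Write \<open>n = 2 N\<close> and let \<open>x = N (w n - b)\<close>, with the difference
  taken modulo \<open>2 \<pi>\<close>.

  The statistic \<open>U\<close> that the procedure maximises has as its mean a sum of Dirichlet kernels centred at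
  the lines.  If the noise of \<open>U\<close> is uniformly below a fixed small constant, then the procedure
  returns a point with \<open>x\<close> bounded at which \<open>|U|\<close> is at least \<open>|U b|\<close>
  (\<open>procedure_locates_eventually\<close>).  As the Dirichlet kernel falls off quadratically at its peak,
  \<open>x\<^sup>2\<close> is at most a constant times the noise of \<open>U\<close> near \<open>b\<close> plus \<open>O(1 / N)\<close>.  That noise has mean
  square of order \<open>1 / N\<close>, so \<open>x ^ 4\<close> has expectation of order \<open>1 / N\<close>.

  The mean of \<open>fhat\<close> at \<open>w\<close> differs from a constant by \<open>O(x\<^sup>2 + 1 / sqrt N)\<close>
  (\<open>line_stat_mean_near_line\<close>).  There is no term linear in \<open>x\<close> because the observation window is
  symmetric about 0, and the boundary effect \<open>1 / sqrt N\<close> comes from Bessel's inequality for the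
  derivative of the line density.  The noise of \<open>fhat\<close> near \<open>b\<close> has mean square of order
  \<open>1 / (n b_n)\<close>.  The exceptional event, on which the noise of \<open>U\<close> is large somewhere, has
  probability of order \<open>1 / N\<close>, and the supremum of the noise of \<open>fhat\<close> over the whole circle has fourth
  moment of order \<open>N / (n b_n)\<^sup>2\<close>, so by the Cauchy--Schwarz inequality this event also contributes
  \<open>O(1 / (n b_n))\<close>.  These pieces are put together in \<open>mean_square_bound\<close>.

  All noise terms are centred Gaussian quadratic forms.  Their fourth moments are controlled by the
  Hilbert--Schmidt norm of the coefficients (\<open>cquad_fourth_moment_le\<close>), which follows from Stein's
  identity for polynomials; the latter is obtained by polarisation from the moments of
  one-dimensional normal laws.  Suprema over \<open>w\<close> are taken by Taylor expansion of trigonometric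
  polynomials: locally at the scale \<open>1 / N\<close> they cost a constant, globally a factor \<open>N\<close>.
\<close>

section \<open>Moments of Gaussian quadratic forms\<close>

text \<open>Polynomials in the process lie in this class.  Since it is closed under sums and products, every
integrability side condition below reduces to membership in it.\<close>

definition all_moments :: "'a measure \<Rightarrow> ('a \<Rightarrow> real) set" where
  "all_moments M = {P \<in> borel_measurable M. \<forall>m::nat. integrable M (\<lambda>\<omega>. \<bar>P \<omega>\<bar> ^ m)}"

lemma all_moments_measurable[measurable_dest]: "P \<in> all_moments M \<Longrightarrow> P \<in> borel_measurable M"
  by (simp add: all_moments_def)

lemma all_moments_power_integrable: "P \<in> all_moments M \<Longrightarrow> integrable M (\<lambda>\<omega>. P \<omega> ^ m)"
  by (rule Bochner_Integration.integrable_bound[where f = "\<lambda>\<omega>. \<bar>P \<omega>\<bar> ^ m"])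
    (auto simp: all_moments_def power_abs)

lemma all_moments_integrable: "P \<in> all_moments M \<Longrightarrow> integrable M P"
  using all_moments_power_integrable[of P M 1] by simp

lemma all_moments_mult:
  assumes "P \<in> all_moments M" "Q \<in> all_moments M"
  shows "(\<lambda>\<omega>. P \<omega> * Q \<omega>) \<in> all_moments M"
proof -
  have [measurable]: "P \<in> borel_measurable M" "Q \<in> borel_measurable M"
    using assms by (auto simp: all_moments_def)
  have "integrable M (\<lambda>\<omega>. \<bar>P \<omega> * Q \<omega>\<bar> ^ m)" for m :: nat
  proof (rule Bochner_Integration.integrable_bound)
    show "integrable M (\<lambda>\<omega>. \<bar>P \<omega>\<bar> ^ (2 * m) + \<bar>Q \<omega>\<bar> ^ (2 * m))"
      using assms by (intro Bochner_Integration.integrable_add) (auto simp: all_moments_def)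
    show "AE \<omega> in M. norm (\<bar>P \<omega> * Q \<omega>\<bar> ^ m) \<le> norm (\<bar>P \<omega>\<bar> ^ (2 * m) + \<bar>Q \<omega>\<bar> ^ (2 * m))"
    proof (intro always_eventually allI)
      fix \<omega>
      define x y where "x = \<bar>P \<omega>\<bar> ^ m" and "y = \<bar>Q \<omega>\<bar> ^ m"
      have "0 \<le> x" "0 \<le> y" by (simp_all add: x_def y_def)
      then have "x * y \<le> x\<^sup>2 + y\<^sup>2"
        using sum_squares_bound[of x y] by (auto intro: order_trans[rotated])
      then show "norm (\<bar>P \<omega> * Q \<omega>\<bar> ^ m) \<le> norm (\<bar>P \<omega>\<bar> ^ (2 * m) + \<bar>Q \<omega>\<bar> ^ (2 * m))"
        by (simp add: x_def y_def abs_mult power_mult_distrib mult.commute[of 2] power_mult)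
    qed
  qed measurable
  then show ?thesis by (simp add: all_moments_def)
qed

lemma all_moments_add:
  assumes "P \<in> all_moments M" "Q \<in> all_moments M"
  shows "(\<lambda>\<omega>. P \<omega> + Q \<omega>) \<in> all_moments M"
proof -
  have [measurable]: "P \<in> borel_measurable M" "Q \<in> borel_measurable M"
    using assms by (auto simp: all_moments_def)
  have "integrable M (\<lambda>\<omega>. \<bar>P \<omega> + Q \<omega>\<bar> ^ m)" for m :: nat
  proof (rule Bochner_Integration.integrable_bound)
    show "integrable M (\<lambda>\<omega>. 2 ^ m * (\<bar>P \<omega>\<bar> ^ m + \<bar>Q \<omega>\<bar> ^ m))"
      using assms by (intro Bochner_Integration.integrable_add integrable_mult_right) (auto simp: all_moments_def)
    show "AE \<omega> in M. norm (\<bar>P \<omega> + Q \<omega>\<bar> ^ m) \<le> norm (2 ^ m * (\<bar>P \<omega>\<bar> ^ m + \<bar>Q \<omega>\<bar> ^ m))"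
    proof (intro always_eventually allI)
      fix \<omega>
      have "\<bar>P \<omega> + Q \<omega>\<bar> ^ m \<le> (2 * max \<bar>P \<omega>\<bar> \<bar>Q \<omega>\<bar>) ^ m"
        by (intro power_mono) auto
      also have "\<dots> = 2 ^ m * (max \<bar>P \<omega>\<bar> \<bar>Q \<omega>\<bar>) ^ m" by (simp add: power_mult_distrib)
      also have "(max \<bar>P \<omega>\<bar> \<bar>Q \<omega>\<bar>) ^ m \<le> \<bar>P \<omega>\<bar> ^ m + \<bar>Q \<omega>\<bar> ^ m"
        by (cases "\<bar>P \<omega>\<bar> \<le> \<bar>Q \<omega>\<bar>") (auto simp: max_def)
      finally show "norm (\<bar>P \<omega> + Q \<omega>\<bar> ^ m) \<le> norm (2 ^ m * (\<bar>P \<omega>\<bar> ^ m + \<bar>Q \<omega>\<bar> ^ m))"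
        by (simp add: power_abs)
    qed
  qed measurable
  then show ?thesis by (simp add: all_moments_def)
qed

lemma all_moments_power: 
  assumes "P \<in> all_moments M" "(\<lambda>_. 1) \<in> all_moments M"
  shows "(\<lambda>\<omega>. P \<omega> ^ n) \<in> all_moments M"
  by (induction n) (auto intro: all_moments_mult assms)

lemma (in prob_space) all_moments_const: "(\<lambda>_. c) \<in> all_moments M"
  by (simp add: all_moments_def)

lemma (in prob_space) all_moments_cmult: "P \<in> all_moments M \<Longrightarrow> (\<lambda>\<omega>. c * P \<omega>) \<in> all_moments M"
  by (intro all_moments_mult all_moments_const)

lemma (in prob_space) all_moments_sum:
  "finite J \<Longrightarrow> (\<And>k. k \<in> J \<Longrightarrow> P k \<in> all_moments M) \<Longrightarrow> (\<lambda>\<omega>. \<Sum>k\<in>J. P k \<omega>) \<in> all_moments M"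
  by (induction J rule: finite_induct) (auto intro: all_moments_add all_moments_const)

lemmas (in prob_space) all_moments_intros =
  all_moments_const all_moments_mult all_moments_add all_moments_cmult all_moments_sum
  all_moments_power[OF _ all_moments_const]

text \<open>Both sides of an identity between expectations that holds with \<open>(A + t B) ^ Suc m\<close> for every real
\<open>t\<close> may be differentiated at \<open>t = 0\<close>.  This polarises moment identities: one factor \<open>A\<close> is turned
into \<open>B\<close> at each step.\<close>

lemma (in prob_space) has_derivative_expectation_power:
  assumes "G \<in> all_moments M" "A \<in> all_moments M" "B \<in> all_moments M"
  shows "((\<lambda>t. \<integral>\<omega>. G \<omega> * (A \<omega> + t * B \<omega>) ^ Suc m \<partial>M) has_real_derivative
            (1 + real m) * (\<integral>\<omega>. G \<omega> * B \<omega> * A \<omega> ^ m \<partial>M)) (at 0)"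
proof -
  define e where "e k = (\<integral>\<omega>. G \<omega> * (B \<omega> ^ k * A \<omega> ^ (Suc m - k)) \<partial>M)" for k
  have eq: "(\<integral>\<omega>. G \<omega> * (A \<omega> + t * B \<omega>) ^ Suc m \<partial>M) = (\<Sum>k\<le>Suc m. real (Suc m choose k) * t ^ k * e k)" for t
  proof -
    have "(\<integral>\<omega>. G \<omega> * (A \<omega> + t * B \<omega>) ^ Suc m \<partial>M) =
        (\<integral>\<omega>. (\<Sum>k\<le>Suc m. real (Suc m choose k) * t ^ k * (G \<omega> * (B \<omega> ^ k * A \<omega> ^ (Suc m - k)))) \<partial>M)"
      by (intro Bochner_Integration.integral_cong refl, subst add.commute, subst binomial_ring)
         (simp add: sum_distrib_left power_mult_distrib algebra_simps del: power_Suc binomial_Suc_Suc sum.atMost_Suc)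
    also have "\<dots> = (\<Sum>k\<le>Suc m. real (Suc m choose k) * t ^ k * e k)"
      unfolding e_def
      by (subst Bochner_Integration.integral_sum)
        (auto intro!: integrable_mult_right all_moments_integrable all_moments_intros assms
          simp del: power_Suc binomial_Suc_Suc sum.atMost_Suc)
    finally show ?thesis .
  qed
  have d: "((\<lambda>t. \<Sum>k\<le>Suc m. real (Suc m choose k) * t ^ k * e k) has_real_derivative
      (\<Sum>k\<le>Suc m. real (Suc m choose k) * (real k * 0 ^ (k - 1)) * e k)) (at 0)"
    by (intro DERIV_sum) (auto intro!: derivative_eq_intros simp del: power_Suc binomial_Suc_Suc)
  have "(\<Sum>k\<le>Suc m. real (Suc m choose k) * (real k * 0 ^ (k - 1)) * e k)
      = (\<Sum>k\<in>{1}. real (Suc m choose k) * (real k * 0 ^ (k - 1)) * e k)"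
  proof (intro sum.mono_neutral_right ballI)
    fix i assume "i \<in> {..Suc m} - {1}"
    then have "i = 0 \<or> 0 < i - 1" by auto
    then show "real (Suc m choose i) * (real i * 0 ^ (i - 1)) * e i = 0" by auto
  qed auto
  also have "\<dots> = (1 + real m) * (\<integral>\<omega>. G \<omega> * B \<omega> * A \<omega> ^ m \<partial>M)"
    by (simp add: e_def mult.assoc)
  finally show ?thesis using d by (simp add: eq del: power_Suc binomial_Suc_Suc sum.atMost_Suc)
qed

text \<open>Schur's test: a symmetric matrix whose absolute row sums are at most \<open>R\<close> has operator norm at most
\<open>R\<close>.  For a covariance matrix the bound holds uniformly in the size of the matrix as soon as the
covariances are summable.\<close>

lemma schur_bound:
  fixes r :: "int \<Rightarrow> int \<Rightarrow> real"
  assumes "\<And>i j. r i j = r j i" "\<And>i. i \<in> J \<Longrightarrow> (\<Sum>j\<in>J. \<bar>r i j\<bar>) \<le> R"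
  shows "\<bar>\<Sum>i\<in>J. \<Sum>j\<in>J. r i j * u i * v j\<bar> \<le> R / 2 * ((\<Sum>i\<in>J. (u i)\<^sup>2) + (\<Sum>i\<in>J. (v i)\<^sup>2))"
proof -
  have "\<bar>\<Sum>i\<in>J. \<Sum>j\<in>J. r i j * u i * v j\<bar> \<le> (\<Sum>i\<in>J. \<Sum>j\<in>J. \<bar>r i j * u i * v j\<bar>)"
    by (rule order_trans[OF sum_abs sum_mono[OF sum_abs]])
  also have "\<dots> \<le> (\<Sum>i\<in>J. \<Sum>j\<in>J. \<bar>r i j\<bar> * (u i)\<^sup>2 / 2 + \<bar>r i j\<bar> * (v j)\<^sup>2 / 2)"
  proof (intro sum_mono)
    fix i j
    have "\<bar>u i * v j\<bar> \<le> ((u i)\<^sup>2 + (v j)\<^sup>2) / 2"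
      using sum_squares_bound[of "\<bar>u i\<bar>" "\<bar>v j\<bar>"] by (simp add: abs_mult)
    then have "\<bar>r i j\<bar> * \<bar>u i * v j\<bar> \<le> \<bar>r i j\<bar> * (((u i)\<^sup>2 + (v j)\<^sup>2) / 2)"
      by (intro mult_left_mono) auto
    then show "\<bar>r i j * u i * v j\<bar> \<le> \<bar>r i j\<bar> * (u i)\<^sup>2 / 2 + \<bar>r i j\<bar> * (v j)\<^sup>2 / 2"
      by (simp add: abs_mult field_simps)
  qed
  also have "\<dots> = (\<Sum>i\<in>J. (\<Sum>j\<in>J. \<bar>r i j\<bar>) * (u i)\<^sup>2 / 2) + (\<Sum>i\<in>J. \<Sum>j\<in>J. \<bar>r i j\<bar> * (v j)\<^sup>2 / 2)"
    by (simp add: sum.distrib sum_distrib_right sum_divide_distrib)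
  also have "(\<Sum>i\<in>J. \<Sum>j\<in>J. \<bar>r i j\<bar> * (v j)\<^sup>2 / 2) = (\<Sum>j\<in>J. (\<Sum>i\<in>J. \<bar>r j i\<bar>) * (v j)\<^sup>2 / 2)"
    by (subst sum.swap) (simp add: sum_distrib_right sum_divide_distrib assms(1)[of _ "_::int"] cong: sum.cong)
  also have "(\<Sum>i\<in>J. (\<Sum>j\<in>J. \<bar>r i j\<bar>) * (u i)\<^sup>2 / 2) + (\<Sum>j\<in>J. (\<Sum>i\<in>J. \<bar>r j i\<bar>) * (v j)\<^sup>2 / 2)
      \<le> (\<Sum>i\<in>J. R * (u i)\<^sup>2 / 2) + (\<Sum>j\<in>J. R * (v j)\<^sup>2 / 2)"
    by (intro add_mono sum_mono divide_right_mono mult_right_mono assms(2)) auto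
  also have "\<dots> = R / 2 * ((\<Sum>i\<in>J. (u i)\<^sup>2) + (\<Sum>i\<in>J. (v i)\<^sup>2))"
    by (simp add: sum_distrib_left algebra_simps)
  finally show ?thesis .
qed

locale centred_gaussian = prob_space M
  for M :: "'a measure" and X :: "int \<Rightarrow> 'a \<Rightarrow> real" +
  assumes gaussian: "gaussian_process M X"
    and mean_zero: "\<And>k. (LINT \<omega>|M. X k \<omega>) = 0"
begin

lemma X_measurable[measurable]: "X k \<in> borel_measurable M"
  using gaussian by (simp add: gaussian_process_def)

definition covar :: "int \<Rightarrow> int \<Rightarrow> real" where
  "covar k m = expectation (\<lambda>\<omega>. X k \<omega> * X m \<omega>)"

lemma covar_commute: "covar k m = covar m k"
  by (simp add: covar_def mult.commute)

definition lin :: "int set \<Rightarrow> (int \<Rightarrow> real) \<Rightarrow> 'a \<Rightarrow> real" where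
  "lin J a \<omega> = (\<Sum>k\<in>J. a k * X k \<omega>)"

lemma lin_measurable[measurable]: "lin J a \<in> borel_measurable M"
  unfolding lin_def[abs_def] by measurable

lemma normal_all_moments:
  assumes "distributed M lborel Y (normal_density m \<sigma>)" "\<sigma> > 0"
  shows "(\<lambda>\<omega>. Y \<omega> - m) \<in> all_moments M"
proof -
  have [measurable]: "Y \<in> borel_measurable M" using distributed_measurable[OF assms(1)] by simp
  have "integrable M (\<lambda>\<omega>. \<bar>Y \<omega> - m\<bar> ^ k)" for k :: nat
    using distributed_integrable[OF assms(1), of "\<lambda>x. \<bar>x - m\<bar> ^ k"] integrable_normal_moment_abs[OF assms(2), of m k]
    by simp
  then show ?thesis by (simp add: all_moments_def)
qed

lemma lin_law:
  assumes "finite J"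
  obtains m \<sigma> where "\<sigma> > 0" "distributed M lborel (lin J a) (normal_density m \<sigma>)"
  | m where "AE \<omega> in M. lin J a \<omega> = m"
  using gaussian assms unfolding gaussian_process_def lin_def[abs_def]
  by (metis less_eq_real_def)

lemma AE_const_all_moments:
  assumes "AE \<omega> in M. Y \<omega> = c" and [measurable]: "Y \<in> borel_measurable M"
  shows "Y \<in> all_moments M"
proof -
  have "integrable M (\<lambda>\<omega>. \<bar>Y \<omega>\<bar> ^ k)" for k :: nat
    by (subst integrable_cong_AE[where g = "\<lambda>_. \<bar>c\<bar> ^ k"]) (use assms in auto)
  then show ?thesis by (simp add: all_moments_def)
qed

lemma lin_all_moments:
  assumes "finite J"
  shows "lin J a \<in> all_moments M"
proof (cases rule: lin_law[OF assms, of a])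
  case (1 m \<sigma>)
  have "(\<lambda>\<omega>. (lin J a \<omega> - m) + m) \<in> all_moments M"
    by (intro all_moments_intros normal_all_moments[OF 1(2,1)])
  then show ?thesis by simp
next
  case (2 m)
  then show ?thesis by (intro AE_const_all_moments[of _ m]) auto
qed

lemma X_all_moments: "X k \<in> all_moments M"
  using lin_all_moments[of "{k}" "\<lambda>_. 1"] by (simp add: lin_def[abs_def])

lemma lin_mean_zero: "finite J \<Longrightarrow> expectation (lin J a) = 0"
  unfolding lin_def[abs_def]
  by (subst Bochner_Integration.integral_sum)
    (auto intro!: integrable_mult_right all_moments_integrable X_all_moments simp: mean_zero)

lemma lin_moments:
  assumes "finite J"
  shows "expectation (\<lambda>\<omega>. lin J a \<omega> ^ (2 * k)) =
           fact (2 * k) / (2 ^ k * fact k) * expectation (\<lambda>\<omega>. (lin J a \<omega>)\<^sup>2) ^ k"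
    and "expectation (\<lambda>\<omega>. lin J a \<omega> ^ (2 * k + 1)) = 0"
proof -
  have "expectation (\<lambda>\<omega>. lin J a \<omega> ^ (2 * k)) =
           fact (2 * k) / (2 ^ k * fact k) * expectation (\<lambda>\<omega>. (lin J a \<omega>)\<^sup>2) ^ k \<and> 
        expectation (\<lambda>\<omega>. lin J a \<omega> ^ (2 * k + 1)) = 0"
  proof (cases rule: lin_law[OF assms, of a])
    case (1 m \<sigma>)
    have "m = 0"
      using normal_distributed_expectation[OF 1] lin_mean_zero[OF assms, of a] by simp
    have *: "expectation (\<lambda>\<omega>. lin J a \<omega> ^ j) = (LINT x|lborel. normal_density 0 \<sigma> x * (x - 0) ^ j)" for j
      using distributed_integral[OF 1(2), of "\<lambda>x. x ^ j"] \<open>m = 0\<close> by simp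
    have "expectation (\<lambda>\<omega>. (lin J a \<omega>)\<^sup>2) = \<sigma>\<^sup>2"
      unfolding * using integral_normal_moment_even[OF 1(1), of 0 1] by (simp add: fact_numeral)
    then show ?thesis
      unfolding *[of "2 * k"] *[of "2 * k + 1"] integral_normal_moment_even[OF 1(1)] integral_normal_moment_odd[OF 1(1)]
      by (simp add: power_divide field_simps)
  next
    case (2 m)
    have "expectation (lin J a) = expectation (\<lambda>_. m)"
      by (rule integral_cong_AE) (use 2 in auto)
    then have "m = 0" using lin_mean_zero[OF assms, of a] by (simp add: prob_space)
    have *: "expectation (\<lambda>\<omega>. lin J a \<omega> ^ j) = expectation (\<lambda>_. 0 ^ j)" for j
      by (rule integral_cong_AE) (use 2 \<open>m = 0\<close> in auto)
    show ?thesis unfolding * by (simp add: prob_space power_0_left)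
  qed
  then show "expectation (\<lambda>\<omega>. lin J a \<omega> ^ (2 * k)) =
           fact (2 * k) / (2 ^ k * fact k) * expectation (\<lambda>\<omega>. (lin J a \<omega>)\<^sup>2) ^ k"
    and "expectation (\<lambda>\<omega>. lin J a \<omega> ^ (2 * k + 1)) = 0" by blast+
qed

lemma lin_add: "lin J a \<omega> + t * lin J c \<omega> = lin J (\<lambda>k. a k + t * c k) \<omega>"
  by (simp add: lin_def sum_distrib_left sum.distrib algebra_simps)

definition lincov :: "int set \<Rightarrow> (int \<Rightarrow> real) \<Rightarrow> (int \<Rightarrow> real) \<Rightarrow> real" where
  "lincov J a c = expectation (\<lambda>\<omega>. lin J a \<omega> * lin J c \<omega>)"

lemma lincov_add:
  assumes "finite J"
  shows "lincov J a (\<lambda>k. v k + t * u k) = lincov J a v + t * lincov J a u"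
proof -
  have "lincov J a (\<lambda>k. v k + t * u k) = expectation (\<lambda>\<omega>. lin J a \<omega> * lin J v \<omega> + t * (lin J a \<omega> * lin J u \<omega>))"
    unfolding lincov_def lin_add[symmetric] by (simp add: algebra_simps)
  also have "\<dots> = lincov J a v + t * lincov J a u"
    unfolding lincov_def
    by (subst Bochner_Integration.integral_add)
      (auto intro!: integrable_mult_right all_moments_integrable all_moments_intros lin_all_moments assms)
  finally show ?thesis .
qed

text \<open>Stein's identity for a power of one linear form.  The even moments of \<open>lin J v + t lin J a\<close> are
explicit powers of its variance, and the identity is their derivative in \<open>t\<close> at 0.\<close>

lemma lin_power_stein:
  assumes "finite J"
  shows "expectation (\<lambda>\<omega>. lin J a \<omega> * lin J v \<omega> ^ m) =
           real m * lincov J a v * expectation (\<lambda>\<omega>. lin J v \<omega> ^ (m - 1))"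
proof -
  note [intro] = lin_all_moments[OF assms] all_moments_const
  define f where "f t = expectation (\<lambda>\<omega>. (lin J v \<omega> + t * lin J a \<omega>) ^ Suc m)" for t
  have d1: "(f has_real_derivative (1 + real m) * expectation (\<lambda>\<omega>. lin J a \<omega> * lin J v \<omega> ^ m)) (at 0)"
    using has_derivative_expectation_power[of "\<lambda>_. 1" "lin J v" "lin J a" m]
    by (simp add: f_def[abs_def] lin_all_moments[OF assms] all_moments_const)
  have d2: "((\<lambda>t. expectation (\<lambda>\<omega>. (lin J v \<omega> + t * lin J a \<omega>)\<^sup>2)) has_real_derivative 2 * lincov J a v) (at 0)"
    using has_derivative_expectation_power[of "\<lambda>_. 1" "lin J v" "lin J a" 1]
    by (simp add: lin_all_moments[OF assms] all_moments_const lincov_def power2_eq_square)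
  show ?thesis
  proof (cases "even m")
    case True
    then obtain k where k: "m = 2 * k" by (elim evenE)
    have "f t = 0" for t
      using lin_moments(2)[OF assms, of _ k] by (simp add: f_def lin_add k)
    then have f0: "f = (\<lambda>t. 0)" by auto
    have "(1 + real m) * expectation (\<lambda>\<omega>. lin J a \<omega> * lin J v \<omega> ^ m) = 0"
      by (rule DERIV_unique[OF d1]) (simp add: f0)
    then have "expectation (\<lambda>\<omega>. lin J a \<omega> * lin J v \<omega> ^ m) = 0"
      by (simp add: add_nonneg_eq_0_iff)
    moreover have "m = 0 \<or> expectation (\<lambda>\<omega>. lin J v \<omega> ^ (m - 1)) = 0"
    proof (cases k)
      case (Suc j)
      then have "m - 1 = 2 * j + 1" using k by simp
      then show ?thesis using lin_moments(2)[OF assms, of v j] by simp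
    qed (simp add: k)
    ultimately show ?thesis by auto
  next
    case False
    then obtain k where k: "m = 2 * k + 1" by (elim oddE)
    define C :: real where "C = fact (2 * Suc k) / (2 ^ Suc k * fact (Suc k))"
    have ff: "f = (\<lambda>t. C * expectation (\<lambda>\<omega>. (lin J v \<omega> + t * lin J a \<omega>)\<^sup>2) ^ Suc k)"
      using lin_moments(1)[OF assms, of _ "Suc k"] by (auto simp: f_def lin_add k C_def fun_eq_iff)
    have "(f has_real_derivative C * ((1 + real k) * (expectation (\<lambda>\<omega>. (lin J v \<omega>)\<^sup>2) ^ k * (2 * lincov J a v)))) (at 0)"
      unfolding ff using DERIV_power_Suc[OF d2, of k] by (intro DERIV_cmult) (simp add: algebra_simps)
    from DERIV_unique[OF d1 this]
    have "(2 * real k + 2) * expectation (\<lambda>\<omega>. lin J a \<omega> * lin J v \<omega> ^ m) =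
        (2 * real k + 2) * (C * lincov J a v * expectation (\<lambda>\<omega>. (lin J v \<omega>)\<^sup>2) ^ k)"
      by (simp add: k algebra_simps)
    then have *: "expectation (\<lambda>\<omega>. lin J a \<omega> * lin J v \<omega> ^ m) = C * lincov J a v * expectation (\<lambda>\<omega>. (lin J v \<omega>)\<^sup>2) ^ k"
      by (subst (asm) mult_cancel_left) (auto simp: add_nonneg_eq_0_iff)
    have "C = real m * (fact (2 * k) / (2 ^ k * fact k))"
    proof -
      have "fact (2 * Suc k) = (2 * real k + 2) * ((2 * real k + 1) * (fact (2 * k) :: real))"
        by (simp add: algebra_simps)
      then have "C = (2 * (real k + 1)) * ((2 * real k + 1) * fact (2 * k)) / ((2 * (real k + 1)) * (2 ^ k * fact k))"
        by (simp add: C_def algebra_simps)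
      also have "\<dots> = (2 * real k + 1) * fact (2 * k) / (2 ^ k * fact k)"
        by (rule mult_divide_mult_cancel_left) (simp add: add_nonneg_eq_0_iff)
      finally show ?thesis by (simp add: k)
    qed
    then show ?thesis
      using lin_moments(1)[OF assms, of v k] * by (simp add: k)
  qed
qed

text \<open>\<open>D\<close> plays the role of the derivative of the polynomial \<open>P\<close> in the direction of the covariances with
\<open>lin J a\<close>, so that \<open>m = 0\<close> is Stein's identity \<open>E[lin J a * P] = E[D]\<close>.  The extra factor
\<open>lin J v ^ m\<close>, differentiated by the product rule, is what makes the relation stable under
multiplication of \<open>P\<close> by linear forms.  It thus extends from constants to all polynomials with no
knowledge of the joint law beyond the laws of single linear forms.\<close>

definition stein_pair :: "int set \<Rightarrow> (int \<Rightarrow> real) \<Rightarrow> ('a \<Rightarrow> real) \<Rightarrow> ('a \<Rightarrow> real) \<Rightarrow> bool" where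
  "stein_pair J a P D \<longleftrightarrow> P \<in> all_moments M \<and> D \<in> all_moments M \<and>
     (\<forall>v m. expectation (\<lambda>\<omega>. lin J a \<omega> * P \<omega> * lin J v \<omega> ^ m) =
        expectation (\<lambda>\<omega>. D \<omega> * lin J v \<omega> ^ m) +
        real m * lincov J a v * expectation (\<lambda>\<omega>. P \<omega> * lin J v \<omega> ^ (m - 1)))"

lemma stein_pair_const: "finite J \<Longrightarrow> stein_pair J a (\<lambda>_. 1) (\<lambda>_. 0)"
  by (simp add: stein_pair_def lin_power_stein all_moments_const)

lemma stein_pair_expectation:
  "stein_pair J a P D \<Longrightarrow> expectation (\<lambda>\<omega>. lin J a \<omega> * P \<omega>) = expectation D"
  unfolding stein_pair_def by (elim conjE allE[of _ "\<lambda>_. 0"] allE[of _ "0::nat"]) simp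

lemma stein_pair_scale: "stein_pair J a P D \<Longrightarrow> stein_pair J a (\<lambda>\<omega>. s * P \<omega>) (\<lambda>\<omega>. s * D \<omega>)"
  by (simp add: stein_pair_def all_moments_cmult algebra_simps)

lemma stein_pair_add:
  assumes "finite J" "stein_pair J a P D" "stein_pair J a P' D'"
  shows "stein_pair J a (\<lambda>\<omega>. P \<omega> + P' \<omega>) (\<lambda>\<omega>. D \<omega> + D' \<omega>)"
proof -
  have am: "P \<in> all_moments M" "P' \<in> all_moments M" "D \<in> all_moments M" "D' \<in> all_moments M"
    using assms by (auto simp: stein_pair_def)
  note i = all_moments_integrable all_moments_intros am lin_all_moments[OF assms(1)]
  show ?thesis
    unfolding stein_pair_def
  proof (intro conjI allI)
    fix v m
    show "expectation (\<lambda>\<omega>. lin J a \<omega> * (P \<omega> + P' \<omega>) * lin J v \<omega> ^ m) =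
        expectation (\<lambda>\<omega>. (D \<omega> + D' \<omega>) * lin J v \<omega> ^ m) +
        real m * lincov J a v * expectation (\<lambda>\<omega>. (P \<omega> + P' \<omega>) * lin J v \<omega> ^ (m - 1))"
      unfolding distrib_left distrib_right
      apply (subst Bochner_Integration.integral_add; (intro i)?)+
      using assms(2,3) unfolding stein_pair_def by (simp add: algebra_simps)
  qed (intro i)+
qed

lemma stein_pair_sum:
  assumes "finite J" "finite I" "\<And>i. i \<in> I \<Longrightarrow> stein_pair J a (P i) (D i)"
  shows "stein_pair J a (\<lambda>\<omega>. \<Sum>i\<in>I. P i \<omega>) (\<lambda>\<omega>. \<Sum>i\<in>I. D i \<omega>)"
  using assms(2,3)
proof (induction I rule: finite_induct)
  case empty
  then show ?case using stein_pair_scale[OF stein_pair_const[OF assms(1), of a], of 0] by simp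
next
  case (insert i I)
  then show ?case by (simp add: stein_pair_add[OF assms(1)])
qed

text \<open>The identity for the exponent \<open>m + 1\<close> holds along \<open>v + t u\<close> for all \<open>t\<close>.  Comparing the derivatives
of both sides at \<open>t = 0\<close> gives the identity for \<open>lin J u * P\<close> and the exponent \<open>m\<close>.\<close>

lemma stein_pair_lin_mult:
  assumes J: "finite J" and st: "stein_pair J a P D"
  shows "stein_pair J a (\<lambda>\<omega>. lin J u \<omega> * P \<omega>) (\<lambda>\<omega>. lincov J a u * P \<omega> + lin J u \<omega> * D \<omega>)"
proof -
  have am: "P \<in> all_moments M" "D \<in> all_moments M"
    using st by (auto simp: stein_pair_def)
  note i = all_moments_intros am lin_all_moments[OF J]
  have eq: "expectation (\<lambda>\<omega>. lin J a \<omega> * P \<omega> * lin J v \<omega> ^ m) =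
        expectation (\<lambda>\<omega>. D \<omega> * lin J v \<omega> ^ m) +
        real m * lincov J a v * expectation (\<lambda>\<omega>. P \<omega> * lin J v \<omega> ^ (m - 1))" for v m
    using st by (auto simp: stein_pair_def)
  show ?thesis
    unfolding stein_pair_def
  proof (intro conjI allI)
    fix v m
    define E1 where "E1 = expectation (\<lambda>\<omega>. (lin J a \<omega> * P \<omega>) * lin J u \<omega> * lin J v \<omega> ^ m)"
    define E2 where "E2 = expectation (\<lambda>\<omega>. D \<omega> * lin J u \<omega> * lin J v \<omega> ^ m)"
    define E3 where "E3 = expectation (\<lambda>\<omega>. P \<omega> * lin J v \<omega> ^ m)"
    define E4 where "E4 = expectation (\<lambda>\<omega>. P \<omega> * lin J u \<omega> * lin J v \<omega> ^ (m - 1))"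
    have d1: "((\<lambda>t. expectation (\<lambda>\<omega>. (lin J a \<omega> * P \<omega>) * (lin J v \<omega> + t * lin J u \<omega>) ^ Suc m))
        has_real_derivative (1 + real m) * E1) (at 0)"
      unfolding E1_def by (intro has_derivative_expectation_power i)
    have d2: "((\<lambda>t. expectation (\<lambda>\<omega>. D \<omega> * (lin J v \<omega> + t * lin J u \<omega>) ^ Suc m))
        has_real_derivative (1 + real m) * E2) (at 0)"
      unfolding E2_def by (intro has_derivative_expectation_power i)
    have d3: "((\<lambda>t. expectation (\<lambda>\<omega>. P \<omega> * (lin J v \<omega> + t * lin J u \<omega>) ^ m))
        has_real_derivative real m * E4) (at 0)"
    proof (cases m)
      case (Suc j)
      then show ?thesis unfolding E4_def
        using has_derivative_expectation_power[of P "lin J v" "lin J u" j] i by simp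
    qed simp
    have d4: "((\<lambda>t. lincov J a v + t * lincov J a u) has_real_derivative lincov J a u) (at 0)"
      by (auto intro!: derivative_eq_intros)
    have d5: "((\<lambda>t. expectation (\<lambda>\<omega>. D \<omega> * (lin J v \<omega> + t * lin J u \<omega>) ^ Suc m) +
          real (Suc m) * ((lincov J a v + t * lincov J a u) * expectation (\<lambda>\<omega>. P \<omega> * (lin J v \<omega> + t * lin J u \<omega>) ^ m)))
        has_real_derivative (1 + real m) * E2 + real (Suc m) * (lincov J a u * E3 + lincov J a v * (real m * E4))) (at 0)"
      using DERIV_add[OF d2 DERIV_cmult[OF DERIV_mult[OF d4 d3], of "real (Suc m)"]]
      by (simp add: E3_def algebra_simps)
    have "(\<lambda>t. expectation (\<lambda>\<omega>. (lin J a \<omega> * P \<omega>) * (lin J v \<omega> + t * lin J u \<omega>) ^ Suc m)) =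
        (\<lambda>t. expectation (\<lambda>\<omega>. D \<omega> * (lin J v \<omega> + t * lin J u \<omega>) ^ Suc m) +
          real (Suc m) * ((lincov J a v + t * lincov J a u) * expectation (\<lambda>\<omega>. P \<omega> * (lin J v \<omega> + t * lin J u \<omega>) ^ m)))"
      unfolding lin_add lincov_add[OF J, symmetric] eq by (simp add: mult.assoc)
    from DERIV_unique[OF d1 d5[folded this]]
    have "(1 + real m) * E1 = (1 + real m) * (E2 + lincov J a u * E3 + lincov J a v * (real m * E4))"
      by (simp add: algebra_simps)
    then have E1: "E1 = E2 + lincov J a u * E3 + lincov J a v * (real m * E4)"
      by (subst (asm) mult_cancel_left) (auto simp: add_nonneg_eq_0_iff)
    have "expectation (\<lambda>\<omega>. lin J a \<omega> * (lin J u \<omega> * P \<omega>) * lin J v \<omega> ^ m) = E1"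
      by (simp add: E1_def algebra_simps)
    moreover have "expectation (\<lambda>\<omega>. (lincov J a u * P \<omega> + lin J u \<omega> * D \<omega>) * lin J v \<omega> ^ m) = lincov J a u * E3 + E2"
    proof -
      have "expectation (\<lambda>\<omega>. (lincov J a u * P \<omega> + lin J u \<omega> * D \<omega>) * lin J v \<omega> ^ m) =
         expectation (\<lambda>\<omega>. lincov J a u * (P \<omega> * lin J v \<omega> ^ m) + D \<omega> * lin J u \<omega> * lin J v \<omega> ^ m)"
        by (simp add: algebra_simps)
      also have "\<dots> = lincov J a u * E3 + E2"
        unfolding E2_def E3_def
        by (subst Bochner_Integration.integral_add) (auto intro!: integrable_mult_right all_moments_integrable i)
      finally show ?thesis .
    qed
    moreover have "expectation (\<lambda>\<omega>. lin J u \<omega> * P \<omega> * lin J v \<omega> ^ (m - 1)) = E4"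
      by (simp add: E4_def algebra_simps)
    ultimately show "expectation (\<lambda>\<omega>. lin J a \<omega> * (lin J u \<omega> * P \<omega>) * lin J v \<omega> ^ m) =
        expectation (\<lambda>\<omega>. (lincov J a u * P \<omega> + lin J u \<omega> * D \<omega>) * lin J v \<omega> ^ m) +
        real m * lincov J a v * expectation (\<lambda>\<omega>. lin J u \<omega> * P \<omega> * lin J v \<omega> ^ (m - 1))"
      using E1 by simp
  qed (intro i)+
qed


definition coord :: "int \<Rightarrow> int \<Rightarrow> real" where
  "coord i k = (if k = i then 1 else 0)"

lemma lin_coord: "finite J \<Longrightarrow> i \<in> J \<Longrightarrow> lin J (coord i) = X i"
  by (auto simp: lin_def coord_def fun_eq_iff if_distrib[of "\<lambda>x. x * _"] cong: if_cong)

lemma lincov_coord: "finite J \<Longrightarrow> i \<in> J \<Longrightarrow> k \<in> J \<Longrightarrow> lincov J (coord k) (coord i) = covar k i"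
  by (simp add: lincov_def covar_def lin_coord)

definition cquad :: "int set \<Rightarrow> (int \<Rightarrow> int \<Rightarrow> real) \<Rightarrow> 'a \<Rightarrow> real" where
  "cquad J q \<omega> = (\<Sum>i\<in>J. \<Sum>j\<in>J. q i j * (X i \<omega> * X j \<omega> - covar i j))"

text \<open>The directional derivative that \<open>stein_pair\<close> assigns to \<open>cquad J q\<close> for the linear form \<open>X k\<close>.\<close>

definition dquad :: "int set \<Rightarrow> (int \<Rightarrow> int \<Rightarrow> real) \<Rightarrow> int \<Rightarrow> 'a \<Rightarrow> real" where
  "dquad J q k \<omega> = (\<Sum>i\<in>J. \<Sum>j\<in>J. q i j * (covar k i * X j \<omega> + covar k j * X i \<omega>))"

lemma stein_pair_cquad_mult:
  assumes J: "finite J" "k \<in> J" and st: "stein_pair J (coord k) P D"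
  shows "stein_pair J (coord k) (\<lambda>\<omega>. cquad J q \<omega> * P \<omega>) (\<lambda>\<omega>. dquad J q k \<omega> * P \<omega> + cquad J q \<omega> * D \<omega>)"
proof -
  define C where "C = (\<Sum>i\<in>J. \<Sum>j\<in>J. q i j * covar i j)"
  have "stein_pair J (coord k) (\<lambda>\<omega>. X i \<omega> * (X j \<omega> * P \<omega>))
      (\<lambda>\<omega>. covar k i * (X j \<omega> * P \<omega>) + X i \<omega> * (covar k j * P \<omega> + X j \<omega> * D \<omega>))"
    if "i \<in> J" "j \<in> J" for i j
    using stein_pair_lin_mult[OF J(1) stein_pair_lin_mult[OF J(1) st, of "coord j"], of "coord i"] that J
    by (simp add: lin_coord lincov_coord)
  then have "stein_pair J (coord k)
      (\<lambda>\<omega>. (\<Sum>i\<in>J. \<Sum>j\<in>J. q i j * (X i \<omega> * (X j \<omega> * P \<omega>))) + (- C) * P \<omega>)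
      (\<lambda>\<omega>. (\<Sum>i\<in>J. \<Sum>j\<in>J. q i j * (covar k i * (X j \<omega> * P \<omega>) + X i \<omega> * (covar k j * P \<omega> + X j \<omega> * D \<omega>))) + (- C) * D \<omega>)"
    by (intro stein_pair_add stein_pair_sum stein_pair_scale J st)
  moreover have "(\<lambda>\<omega>. (\<Sum>i\<in>J. \<Sum>j\<in>J. q i j * (X i \<omega> * (X j \<omega> * P \<omega>))) + (- C) * P \<omega>) = (\<lambda>\<omega>. cquad J q \<omega> * P \<omega>)"
    by (simp add: fun_eq_iff cquad_def C_def left_diff_distrib right_diff_distrib sum_distrib_right sum_subtractf mult.assoc)
  moreover have "(\<lambda>\<omega>. (\<Sum>i\<in>J. \<Sum>j\<in>J. q i j * (covar k i * (X j \<omega> * P \<omega>) + X i \<omega> * (covar k j * P \<omega> + X j \<omega> * D \<omega>))) + (- C) * D \<omega>)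
      = (\<lambda>\<omega>. dquad J q k \<omega> * P \<omega> + cquad J q \<omega> * D \<omega>)"
    by (simp add: fun_eq_iff cquad_def dquad_def C_def sum_distrib_right left_diff_distrib right_diff_distrib distrib_left distrib_right sum_subtractf sum.distrib mult.assoc mult.left_commute)
  ultimately show ?thesis by simp
qed

lemma cquad_all_moments: "finite J \<Longrightarrow> cquad J q \<in> all_moments M"
  unfolding cquad_def[abs_def] diff_conv_add_uminus
  by (intro all_moments_intros X_all_moments)

lemma lin_second_moment_le:
  assumes "finite J" "\<And>i. i \<in> J \<Longrightarrow> (\<Sum>j\<in>J. \<bar>covar i j\<bar>) \<le> R"
  shows "expectation (\<lambda>\<omega>. (lin J a \<omega>)\<^sup>2) \<le> R * (\<Sum>i\<in>J. (a i)\<^sup>2)"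
proof -
  have "expectation (\<lambda>\<omega>. (lin J a \<omega>)\<^sup>2) = expectation (\<lambda>\<omega>. \<Sum>i\<in>J. \<Sum>j\<in>J. (a i * a j) * (X i \<omega> * X j \<omega>))"
    by (simp add: lin_def power2_eq_square sum_product algebra_simps)
  also have "\<dots> = (\<Sum>i\<in>J. \<Sum>j\<in>J. covar i j * a i * a j)"
    unfolding covar_def
    apply (subst Bochner_Integration.integral_sum)
    subgoal by (intro all_moments_integrable all_moments_intros X_all_moments assms)
    apply (intro sum.cong refl)
    apply (subst Bochner_Integration.integral_sum)
    subgoal by (intro all_moments_integrable all_moments_intros X_all_moments assms)
    by (simp add: algebra_simps)
  also have "\<dots> \<le> R / 2 * ((\<Sum>i\<in>J. (a i)\<^sup>2) + (\<Sum>i\<in>J. (a i)\<^sup>2))"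
    using schur_bound[of covar J R a a] assms(2) covar_commute by fastforce
  finally show ?thesis by simp
qed

text \<open>By Stein's identity the left side is \<open>E[A\<^sup>2] E[C\<^sup>2] + 2 (E[A C])\<^sup>2\<close> for the two linear forms
\<open>A\<close> and \<open>C\<close>, and the Cauchy--Schwarz inequality bounds the second term.\<close>

lemma lin_square_square_le:
  assumes "finite J"
  shows "expectation (\<lambda>\<omega>. (lin J a \<omega>)\<^sup>2 * (lin J c \<omega>)\<^sup>2) \<le>
     3 * expectation (\<lambda>\<omega>. (lin J a \<omega>)\<^sup>2) * expectation (\<lambda>\<omega>. (lin J c \<omega>)\<^sup>2)"
proof -
  have "stein_pair J a (\<lambda>\<omega>. lin J a \<omega> * 1) (\<lambda>\<omega>. lincov J a a * 1 + lin J a \<omega> * 0)"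
    by (intro stein_pair_lin_mult stein_pair_const assms)
  then have "expectation (\<lambda>\<omega>. lin J a \<omega> * lin J a \<omega> * lin J c \<omega> ^ 2) =
      lincov J a a * lincov J c c + 2 * lincov J a c * lincov J a c"
    unfolding stein_pair_def by (elim conjE allE[of _ c] allE[of _ "2::nat"])
      (simp add: lincov_def power2_eq_square)
  moreover have "(lincov J a c)\<^sup>2 \<le> lincov J a a * lincov J c c"
  proof -
    have "0 \<le> lincov J c c" unfolding lincov_def by (intro Bochner_Integration.integral_nonneg) simp
    have nn: "0 \<le> lincov J a a + 2 * t * lincov J a c + t\<^sup>2 * lincov J c c" for t
    proof -
      have "0 \<le> expectation (\<lambda>\<omega>. (lin J a \<omega> + t * lin J c \<omega>)\<^sup>2)" by (intro Bochner_Integration.integral_nonneg) simp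
      also have "\<dots> = expectation (\<lambda>\<omega>. lin J a \<omega> * lin J a \<omega> + (2 * t * (lin J a \<omega> * lin J c \<omega>) + t\<^sup>2 * (lin J c \<omega> * lin J c \<omega>)))"
        by (simp add: power2_eq_square algebra_simps)
      also have "\<dots> = lincov J a a + 2 * t * lincov J a c + t\<^sup>2 * lincov J c c"
        unfolding lincov_def
        by (subst Bochner_Integration.integral_add
            | (intro all_moments_integrable all_moments_intros lin_all_moments assms; fail))+ simp
      finally show ?thesis .
    qed
    show ?thesis
    proof (cases "lincov J c c = 0")
      case True
      have "lincov J a c = 0"
      proof (rule ccontr)
        assume "lincov J a c \<noteq> 0"
        \<comment> \<open>The quadratic in \<open>t\<close> degenerates to a linear function, which takes the value -1 at this point.\<close>
        then have "2 * (- (lincov J a a + 1) / (2 * lincov J a c)) * lincov J a c = - lincov J a a - 1" by simp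
        then show False using nn[of "- (lincov J a a + 1) / (2 * lincov J a c)"] unfolding True by linarith
      qed
      then show ?thesis using True by simp
    next
      case False
      then have "0 < lincov J c c" using \<open>0 \<le> lincov J c c\<close> by simp
      then show ?thesis using nn[of "- lincov J a c / lincov J c c"]
        by (simp add: field_simps power2_eq_square)
    qed
  qed
  ultimately show ?thesis by (simp add: power2_eq_square lincov_def algebra_simps)
qed

lemma sum_lin_squares_second_moment:
  assumes J: "finite J" and I: "finite I"
  shows "expectation (\<lambda>\<omega>. (\<Sum>i\<in>I. (lin J (c i) \<omega>)\<^sup>2)\<^sup>2) \<le> 3 * (\<Sum>i\<in>I. expectation (\<lambda>\<omega>. (lin J (c i) \<omega>)\<^sup>2))\<^sup>2"
proof -
  have "expectation (\<lambda>\<omega>. (\<Sum>i\<in>I. (lin J (c i) \<omega>)\<^sup>2)\<^sup>2) =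
      expectation (\<lambda>\<omega>. \<Sum>i\<in>I. \<Sum>j\<in>I. (lin J (c i) \<omega>)\<^sup>2 * (lin J (c j) \<omega>)\<^sup>2)"
    by (simp add: power2_eq_square[of "sum _ _"] sum_product)
  also have "\<dots> = (\<Sum>i\<in>I. \<Sum>j\<in>I. expectation (\<lambda>\<omega>. (lin J (c i) \<omega>)\<^sup>2 * (lin J (c j) \<omega>)\<^sup>2))"
    apply (subst Bochner_Integration.integral_sum)
    subgoal by (intro all_moments_integrable all_moments_intros lin_all_moments assms)
    apply (intro sum.cong refl)
    apply (subst Bochner_Integration.integral_sum)
    subgoal by (intro all_moments_integrable all_moments_intros lin_all_moments assms)
    by simp
  also have "\<dots> \<le> (\<Sum>i\<in>I. \<Sum>j\<in>I. 3 * expectation (\<lambda>\<omega>. (lin J (c i) \<omega>)\<^sup>2) * expectation (\<lambda>\<omega>. (lin J (c j) \<omega>)\<^sup>2))"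
    by (intro sum_mono lin_square_square_le J)
  also have "\<dots> = 3 * (\<Sum>i\<in>I. expectation (\<lambda>\<omega>. (lin J (c i) \<omega>)\<^sup>2))\<^sup>2"
    by (simp add: power2_eq_square[of "sum _ _"] sum_product sum_distrib_left algebra_simps)
  finally show ?thesis .
qed

text \<open>With \<open>Q = cquad J q\<close>, one factor of \<open>Q ^ 4\<close> is written out as \<open>\<Sum> q k m (X k X m - covar k m)\<close> and
Stein's identity is applied to \<open>X k\<close> against \<open>X m * Q ^ 3\<close>.  Differentiating \<open>X m\<close> cancels the centring
term, and differentiating \<open>Q ^ 3\<close> leaves \<open>3 Q\<^sup>2\<close> times a quadratic form.\<close>

lemma cquad_fourth_moment_eq:
  assumes J: "finite J"
  shows "expectation (\<lambda>\<omega>. cquad J q \<omega> ^ 4) =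
     3 * expectation (\<lambda>\<omega>. (cquad J q \<omega>)\<^sup>2 * (\<Sum>i\<in>J. \<Sum>k\<in>J. covar k i * lin J (q k) \<omega> * lin J (\<lambda>j. q i j + q j i) \<omega>))"
proof -
  note am = all_moments_intros X_all_moments cquad_all_moments[OF J] lin_all_moments[OF J] J
  have dq: "dquad J q k \<omega> = (\<Sum>i\<in>J. covar k i * lin J (\<lambda>j. q i j + q j i) \<omega>)" for k \<omega>
  proof -
    have "dquad J q k \<omega> = (\<Sum>i\<in>J. \<Sum>j\<in>J. q i j * (covar k i * X j \<omega>)) + (\<Sum>i\<in>J. \<Sum>j\<in>J. q i j * (covar k j * X i \<omega>))"
      by (simp add: dquad_def sum.distrib distrib_left)
    also have "(\<Sum>i\<in>J. \<Sum>j\<in>J. q i j * (covar k j * X i \<omega>)) = (\<Sum>i\<in>J. \<Sum>j\<in>J. q j i * (covar k i * X j \<omega>))"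
      by (rule sum.swap)
    finally show ?thesis
      by (simp add: lin_def sum_distrib_left sum.distrib[symmetric] algebra_simps)
  qed
  have amd: "dquad J q k \<in> all_moments M" for k
    unfolding dquad_def[abs_def] by (intro am)
  have stein: "expectation (\<lambda>\<omega>. X k \<omega> * (X m \<omega> * cquad J q \<omega> ^ 3)) =
     covar k m * expectation (\<lambda>\<omega>. cquad J q \<omega> ^ 3) + 3 * expectation (\<lambda>\<omega>. X m \<omega> * ((cquad J q \<omega>)\<^sup>2 * dquad J q k \<omega>))"
    if "k \<in> J" "m \<in> J" for k m
  proof -
    note mult = stein_pair_cquad_mult[OF J that(1)]
    have "expectation (\<lambda>\<omega>. X k \<omega> * (X m \<omega> * cquad J q \<omega> ^ 3)) =
      expectation (\<lambda>\<omega>. covar k m * cquad J q \<omega> ^ 3 + 3 * (X m \<omega> * ((cquad J q \<omega>)\<^sup>2 * dquad J q k \<omega>)))"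
      using stein_pair_expectation[OF stein_pair_lin_mult[OF J mult[OF mult[OF mult[OF stein_pair_const[OF J]]]], of "coord m" q q q]]
      by (simp add: lin_coord lincov_coord J that power3_eq_cube power2_eq_square algebra_simps)
    also have "\<dots> = covar k m * expectation (\<lambda>\<omega>. cquad J q \<omega> ^ 3) + 3 * expectation (\<lambda>\<omega>. X m \<omega> * ((cquad J q \<omega>)\<^sup>2 * dquad J q k \<omega>))"
      by (subst Bochner_Integration.integral_add | (intro all_moments_integrable am amd; fail))+ simp
    finally show ?thesis .
  qed
  have "expectation (\<lambda>\<omega>. cquad J q \<omega> ^ 4) =
     expectation (\<lambda>\<omega>. \<Sum>k\<in>J. \<Sum>m\<in>J. q k m * (X k \<omega> * (X m \<omega> * cquad J q \<omega> ^ 3) + (- covar k m) * cquad J q \<omega> ^ 3))"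
  proof (intro Bochner_Integration.integral_cong refl)
    fix \<omega>
    have "cquad J q \<omega> ^ 4 = cquad J q \<omega> * cquad J q \<omega> ^ 3" by (simp add: eval_nat_numeral)
    also have "\<dots> = (\<Sum>k\<in>J. \<Sum>m\<in>J. q k m * (X k \<omega> * (X m \<omega> * cquad J q \<omega> ^ 3) + (- covar k m) * cquad J q \<omega> ^ 3))"
      by (subst cquad_def) (simp add: sum_distrib_right left_diff_distrib right_diff_distrib mult.assoc)
    finally show "cquad J q \<omega> ^ 4 = \<dots>" .
  qed
  also have "\<dots> = (\<Sum>k\<in>J. \<Sum>m\<in>J. expectation (\<lambda>\<omega>. q k m * (X k \<omega> * (X m \<omega> * cquad J q \<omega> ^ 3) + (- covar k m) * cquad J q \<omega> ^ 3)))"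
    apply (subst Bochner_Integration.integral_sum)
    subgoal by (intro all_moments_integrable am)
    apply (intro sum.cong refl)
    apply (subst Bochner_Integration.integral_sum)
    subgoal by (intro all_moments_integrable am)
    by simp
  also have "\<dots> = (\<Sum>k\<in>J. \<Sum>m\<in>J. expectation (\<lambda>\<omega>. 3 * (q k m * (X m \<omega> * ((cquad J q \<omega>)\<^sup>2 * dquad J q k \<omega>)))))"
  proof (intro sum.cong refl)
    fix k m assume km: "k \<in> J" "m \<in> J"
    have "expectation (\<lambda>\<omega>. q k m * (X k \<omega> * (X m \<omega> * cquad J q \<omega> ^ 3) + (- covar k m) * cquad J q \<omega> ^ 3)) =
      q k m * (expectation (\<lambda>\<omega>. X k \<omega> * (X m \<omega> * cquad J q \<omega> ^ 3)) + (- covar k m) * expectation (\<lambda>\<omega>. cquad J q \<omega> ^ 3))"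
      by (simp only: integral_mult_right_zero, subst Bochner_Integration.integral_add)
         (intro all_moments_integrable am | simp)+
    then show "expectation (\<lambda>\<omega>. q k m * (X k \<omega> * (X m \<omega> * cquad J q \<omega> ^ 3) + (- covar k m) * cquad J q \<omega> ^ 3)) =
       expectation (\<lambda>\<omega>. 3 * (q k m * (X m \<omega> * ((cquad J q \<omega>)\<^sup>2 * dquad J q k \<omega>))))"
      by (simp add: stein[OF km])
  qed
  also have "\<dots> = expectation (\<lambda>\<omega>. \<Sum>k\<in>J. \<Sum>m\<in>J. 3 * (q k m * (X m \<omega> * ((cquad J q \<omega>)\<^sup>2 * dquad J q k \<omega>))))"
    apply (subst Bochner_Integration.integral_sum)
    subgoal by (intro all_moments_integrable am amd)
    apply (intro sum.cong refl)
    apply (subst Bochner_Integration.integral_sum)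
    subgoal by (intro all_moments_integrable am amd)
    by simp
  also have "\<dots> = expectation (\<lambda>\<omega>. 3 * ((cquad J q \<omega>)\<^sup>2 * (\<Sum>i\<in>J. \<Sum>k\<in>J. covar k i * lin J (q k) \<omega> * lin J (\<lambda>j. q i j + q j i) \<omega>)))"
  proof (intro Bochner_Integration.integral_cong refl)
    fix \<omega>
    have "(\<Sum>k\<in>J. \<Sum>m\<in>J. 3 * (q k m * (X m \<omega> * ((cquad J q \<omega>)\<^sup>2 * dquad J q k \<omega>)))) =
       3 * ((cquad J q \<omega>)\<^sup>2 * (\<Sum>k\<in>J. lin J (q k) \<omega> * dquad J q k \<omega>))"
      by (simp add: lin_def sum_distrib_left sum_distrib_right algebra_simps)
    also have "(\<Sum>k\<in>J. lin J (q k) \<omega> * dquad J q k \<omega>) = (\<Sum>k\<in>J. \<Sum>i\<in>J. covar k i * lin J (q k) \<omega> * lin J (\<lambda>j. q i j + q j i) \<omega>)"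
      by (simp add: dq sum_distrib_left algebra_simps)
    also have "\<dots> = (\<Sum>i\<in>J. \<Sum>k\<in>J. covar k i * lin J (q k) \<omega> * lin J (\<lambda>j. q i j + q j i) \<omega>)"
      by (rule sum.swap)
    finally show "(\<Sum>k\<in>J. \<Sum>m\<in>J. 3 * (q k m * (X m \<omega> * ((cquad J q \<omega>)\<^sup>2 * dquad J q k \<omega>)))) = 
       3 * ((cquad J q \<omega>)\<^sup>2 * (\<Sum>i\<in>J. \<Sum>k\<in>J. covar k i * lin J (q k) \<omega> * lin J (\<lambda>j. q i j + q j i) \<omega>))" .
  qed
  finally show ?thesis by simp
qed

text \<open>Hypercontractivity of centred Gaussian quadratic forms.  The quadratic form in
\<open>cquad_fourth_moment_eq\<close> is at most \<open>R/2\<close> times a sum \<open>S\<close> of squares of linear forms, whose second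
moment is at most three times the square of its mean.  After \<open>3 Q\<^sup>2 (R/2) S \<le> Q ^ 4 / 2 + (9/8) R\<^sup>2 S\<^sup>2\<close>
the term \<open>Q ^ 4 / 2\<close> is absorbed on the left.\<close>

lemma cquad_fourth_moment_le:
  assumes J: "finite J" and R: "\<And>i. i \<in> J \<Longrightarrow> (\<Sum>j\<in>J. \<bar>covar i j\<bar>) \<le> R" and R0: "0 \<le> R"
  shows "expectation (\<lambda>\<omega>. cquad J q \<omega> ^ 4) \<le> 169 * R ^ 4 * (\<Sum>i\<in>J. \<Sum>j\<in>J. (q i j)\<^sup>2)\<^sup>2"
proof -
  define B where "B = (\<Sum>i\<in>J. \<Sum>j\<in>J. (q i j)\<^sup>2)"
  define I where "I = J \<times> {False, True}"
  define c where "c p = (case p of (i, s) \<Rightarrow> if s then (\<lambda>j. q i j + q j i) else q i)" for p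
  define S where "S \<omega> = (\<Sum>p\<in>I. (lin J (c p) \<omega>)\<^sup>2)" for \<omega>
  note am = all_moments_intros X_all_moments cquad_all_moments[OF J] lin_all_moments[OF J] J
  have I: "finite I" using J by (simp add: I_def)
  have B0: "0 \<le> B" unfolding B_def by (intro sum_nonneg) auto
  have sumI: "(\<Sum>p\<in>I. g p) = (\<Sum>i\<in>J. g (i, False)) + (\<Sum>i\<in>J. g (i, True))" for g :: "int \<times> bool \<Rightarrow> real"
    unfolding I_def using J by (simp add: sum.cartesian_product' sum.distrib)
  have amS: "S \<in> all_moments M" unfolding S_def[abs_def] by (intro am I)
  have pt: "3 * ((cquad J q \<omega>)\<^sup>2 * (\<Sum>i\<in>J. \<Sum>k\<in>J. covar k i * lin J (q k) \<omega> * lin J (\<lambda>j. q i j + q j i) \<omega>))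
       \<le> cquad J q \<omega> ^ 4 / 2 + 9 / 8 * R\<^sup>2 * (S \<omega>)\<^sup>2" for \<omega>
  proof -
    have "(\<Sum>i\<in>J. \<Sum>k\<in>J. covar k i * lin J (q k) \<omega> * lin J (\<lambda>j. q i j + q j i) \<omega>)
        = (\<Sum>k\<in>J. \<Sum>i\<in>J. covar k i * lin J (q k) \<omega> * lin J (\<lambda>j. q i j + q j i) \<omega>)"
      by (rule sum.swap)
    also have "\<dots> \<le> R / 2 * S \<omega>"
      using schur_bound[of covar J R "\<lambda>k. lin J (q k) \<omega>" "\<lambda>i. lin J (\<lambda>j. q i j + q j i) \<omega>", OF covar_commute R]
      by (simp add: S_def sumI c_def)
    finally have "3 * ((cquad J q \<omega>)\<^sup>2 * (\<Sum>i\<in>J. \<Sum>k\<in>J. covar k i * lin J (q k) \<omega> * lin J (\<lambda>j. q i j + q j i) \<omega>))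
        \<le> 3 * ((cquad J q \<omega>)\<^sup>2 * (R / 2 * S \<omega>))"
      by (intro mult_left_mono) auto
    also have "\<dots> \<le> ((cquad J q \<omega>)\<^sup>2)\<^sup>2 / 2 + (3 * (R / 2 * S \<omega>))\<^sup>2 / 2"
      using sum_squares_bound[of "(cquad J q \<omega>)\<^sup>2" "3 * (R / 2 * S \<omega>)"] by (simp add: algebra_simps)
    also have "\<dots> = cquad J q \<omega> ^ 4 / 2 + 9 / 8 * R\<^sup>2 * (S \<omega>)\<^sup>2"
      by (simp add: power2_eq_square power4_eq_xxxx algebra_simps)
    finally show ?thesis .
  qed
  have "expectation (\<lambda>\<omega>. cquad J q \<omega> ^ 4) =
     expectation (\<lambda>\<omega>. 3 * ((cquad J q \<omega>)\<^sup>2 * (\<Sum>i\<in>J. \<Sum>k\<in>J. covar k i * lin J (q k) \<omega> * lin J (\<lambda>j. q i j + q j i) \<omega>)))"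
    by (simp add: cquad_fourth_moment_eq[OF J])
  also have "\<dots> \<le> expectation (\<lambda>\<omega>. (1/2) * cquad J q \<omega> ^ 4 + 9 / 8 * R\<^sup>2 * (S \<omega>)\<^sup>2)"
    using pt by (intro integral_mono) (intro all_moments_integrable am amS | simp)+
  also have "\<dots> = expectation (\<lambda>\<omega>. cquad J q \<omega> ^ 4) / 2 + 9 / 8 * R\<^sup>2 * expectation (\<lambda>\<omega>. (S \<omega>)\<^sup>2)"
    by (subst Bochner_Integration.integral_add) (intro all_moments_integrable am amS | simp)+
  finally have 1: "expectation (\<lambda>\<omega>. cquad J q \<omega> ^ 4) \<le> 9 / 4 * R\<^sup>2 * expectation (\<lambda>\<omega>. (S \<omega>)\<^sup>2)" by simp
  have "(\<Sum>p\<in>I. expectation (\<lambda>\<omega>. (lin J (c p) \<omega>)\<^sup>2)) \<le> (\<Sum>p\<in>I. R * (\<Sum>j\<in>J. (c p j)\<^sup>2))"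
    by (intro sum_mono lin_second_moment_le J R)
  also have "\<dots> \<le> R * (5 * B)"
  proof -
    have "(\<Sum>i\<in>J. \<Sum>j\<in>J. (q i j + q j i)\<^sup>2) \<le> (\<Sum>i\<in>J. \<Sum>j\<in>J. 2 * (q i j)\<^sup>2 + 2 * (q j i)\<^sup>2)"
      by (intro sum_mono) (use sum_squares_bound[of "q _ _" "q _ _"] in \<open>auto simp: power2_sum add.commute\<close>)
    also have "\<dots> = 2 * B + 2 * (\<Sum>i\<in>J. \<Sum>j\<in>J. (q j i)\<^sup>2)"
      by (simp add: B_def sum.distrib sum_distrib_left)
    also have "(\<Sum>i\<in>J. \<Sum>j\<in>J. (q j i)\<^sup>2) = B" unfolding B_def by (rule sum.swap)
    finally have "(\<Sum>p\<in>I. (\<Sum>j\<in>J. (c p j)\<^sup>2)) \<le> 5 * B"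
      by (simp add: sumI c_def B_def)
    then show ?thesis unfolding sum_distrib_left[symmetric] using R0 by (rule mult_left_mono)
  qed
  finally have 2: "(\<Sum>p\<in>I. expectation (\<lambda>\<omega>. (lin J (c p) \<omega>)\<^sup>2)) \<le> R * (5 * B)" .
  have "expectation (\<lambda>\<omega>. (S \<omega>)\<^sup>2) \<le> 3 * (\<Sum>p\<in>I. expectation (\<lambda>\<omega>. (lin J (c p) \<omega>)\<^sup>2))\<^sup>2"
    unfolding S_def by (rule sum_lin_squares_second_moment[OF J I])
  also have "\<dots> \<le> 3 * (R * (5 * B))\<^sup>2"
    by (intro mult_left_mono power_mono 2) (auto intro!: sum_nonneg Bochner_Integration.integral_nonneg)
  finally have "9 / 4 * R\<^sup>2 * expectation (\<lambda>\<omega>. (S \<omega>)\<^sup>2) \<le> 9 / 4 * R\<^sup>2 * (3 * (R * (5 * B))\<^sup>2)"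
    by (intro mult_left_mono) auto
  also have "\<dots> = 675 / 4 * (R ^ 4 * B\<^sup>2)" by (simp add: power2_eq_square power4_eq_xxxx)
  also have "\<dots> \<le> 169 * (R ^ 4 * B\<^sup>2)" by (intro mult_right_mono) auto
  finally show ?thesis using 1 by (simp add: B_def mult.assoc)
qed

end

section \<open>Fourier coefficients and Dirichlet sums\<close>

lemma continuous_set_integrable:
  fixes g :: "real \<Rightarrow> 'b::euclidean_space"
  shows "continuous_on {-pi..pi} g \<Longrightarrow> set_integrable lborel {-pi..pi} g"
  by (rule borel_integrable_atLeastAtMost')

lemma set_integral_sum:
  fixes g :: "'i \<Rightarrow> real \<Rightarrow> complex"
  assumes "finite J" "\<And>j. j \<in> J \<Longrightarrow> set_integrable lborel A (g j)"
  shows "(LBINT \<mu>:A. (\<Sum>j\<in>J. g j \<mu>)) = (\<Sum>j\<in>J. LBINT \<mu>:A. g j \<mu>)"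
  using assms unfolding set_lebesgue_integral_def set_integrable_def scaleR_sum_right
  by (intro Bochner_Integration.integral_sum) auto

lemma set_integral_FTC:
  fixes F g :: "real \<Rightarrow> complex"
  assumes "\<And>x. (F has_vector_derivative g x) (at x)" "continuous_on {-pi..pi} g"
  shows "(LBINT \<mu>:{-pi..pi}. g \<mu>) = F pi - F (- pi)"
proof -
  have "(LBINT \<mu>:{-pi..pi}. g \<mu>) = integral {-pi..pi} g"
    by (intro set_borel_integral_eq_integral continuous_set_integrable assms)
  also have "(g has_integral (F pi - F (- pi))) {-pi..pi}"
    by (rule fundamental_theorem_of_calculus) (auto intro: has_vector_derivative_at_within assms(1))
  then have "integral {-pi..pi} g = F pi - F (- pi)" by (rule integral_unique)
  finally show ?thesis .
qed

lemma cis_has_vector_derivative: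
  "((\<lambda>x. cis (a * x)) has_vector_derivative (\<i> * of_real a * cis (a * x))) (at x)"
proof -
  have "((\<lambda>x. cis (a * x)) has_derivative (\<lambda>t. (t * a) *\<^sub>R (\<i> * cis (a * x)))) (at x)"
    by (auto intro!: derivative_eq_intros simp: algebra_simps)
  then show ?thesis
    by (simp add: has_vector_derivative_def scaleR_conv_of_real algebra_simps)
qed

lemma cis_int_pi: "cis (of_int j * pi) = cis (of_int j * (- pi))"
proof -
  have "cis (of_int j * (- pi)) = cis (of_int j * pi) * cis (of_int (- j) * (2 * pi))"
    by (simp add: cis_mult algebra_simps)
  also have "cis (of_int (- j) * (2 * pi)) = 1"
    using cis_multiple_2pi[of "of_int (-j)"] by (simp add: algebra_simps)
  finally show ?thesis by simp
qed

lemma circle_integral_cis: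
  "(LBINT \<mu>:{-pi..pi}. cis (of_int j * \<mu>)) = (if j = 0 then complex_of_real (2 * pi) else 0)"
proof (cases "j = 0")
  case True
  then show ?thesis by (simp add: set_lebesgue_integral_def scaleR_conv_of_real)
next
  case False
  have "(LBINT \<mu>:{-pi..pi}. cis (of_int j * \<mu>)) =
      cis (of_int j * pi) / (\<i> * of_int j) - cis (of_int j * (- pi)) / (\<i> * of_int j)"
  proof (rule set_integral_FTC)
    fix x :: real
    show "((\<lambda>x. cis (of_int j * x) / (\<i> * of_int j)) has_vector_derivative cis (of_int j * x)) (at x)"
      using has_vector_derivative_mult_left[OF cis_has_vector_derivative[of "of_int j" x], of "1 / (\<i> * of_int j)"] False
      by (simp add: field_simps)
  qed (intro continuous_intros)
  then show ?thesis using False cis_int_pi[of j] by simp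
qed

text \<open>Expansion of the mean square distance between \<open>g\<close> and its Fourier polynomial with frequencies in \<open>- J\<close>.\<close>

lemma bessel_inequality:
  fixes g :: "real \<Rightarrow> complex"
  assumes g: "continuous_on {-pi..pi} g" and J: "finite J"
  shows "(\<Sum>j\<in>J. (cmod (LBINT \<mu>:{-pi..pi}. cis (of_int j * \<mu>) * g \<mu>))\<^sup>2) \<le> 2 * pi * (LBINT \<mu>:{-pi..pi}. (cmod (g \<mu>))\<^sup>2)"
proof -
  define a where "a j = (LBINT \<mu>:{-pi..pi}. cis (of_int j * \<mu>) * g \<mu>)" for j :: int
  define h where "h \<mu> = (\<Sum>j\<in>J. a j / (2 * pi) * cis (of_int (- j) * \<mu>))" for \<mu>
  define A where "A = (\<Sum>j\<in>J. (cmod (a j))\<^sup>2)"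
  have hc: "continuous_on {-pi..pi} h" unfolding h_def by (intro continuous_intros)
  have gh: "(LBINT \<mu>:{-pi..pi}. g \<mu> * cnj (h \<mu>)) = of_real (A / (2 * pi))"
  proof -
    have "(LBINT \<mu>:{-pi..pi}. g \<mu> * cnj (h \<mu>)) = (LBINT \<mu>:{-pi..pi}. \<Sum>j\<in>J. (cnj (a j) / (2 * pi)) * (cis (of_int j * \<mu>) * g \<mu>))"
      by (simp add: h_def sum_distrib_left cis_cnj algebra_simps)
    also have "\<dots> = (\<Sum>j\<in>J. (cnj (a j) / (2 * pi)) * a j)"
      unfolding a_def by (subst set_integral_sum) (auto intro!: J continuous_set_integrable continuous_intros g)
    also have "\<dots> = of_real (A / (2 * pi))"
      by (simp add: A_def sum_divide_distrib complex_norm_square mult.commute flip: of_real_power)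
    finally show ?thesis .
  qed
  have hh: "(LBINT \<mu>:{-pi..pi}. h \<mu> * cnj (h \<mu>)) = of_real (A / (2 * pi))"
  proof -
    have "(LBINT \<mu>:{-pi..pi}. h \<mu> * cnj (h \<mu>)) = (LBINT \<mu>:{-pi..pi}. \<Sum>j\<in>J. \<Sum>k\<in>J. (a j * cnj (a k) / (2 * pi)\<^sup>2) * cis (of_int (k - j) * \<mu>))"
      by (intro set_lebesgue_integral_cong)
        (auto simp: h_def sum_product cis_cnj cis_mult power2_eq_square algebra_simps intro!: sum.cong)
    also have "\<dots> = (\<Sum>j\<in>J. \<Sum>k\<in>J. (a j * cnj (a k) / (2 * pi)\<^sup>2) * (if k - j = 0 then complex_of_real (2 * pi) else 0))"
      apply (subst set_integral_sum)
      subgoal by (rule J)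
      subgoal by (intro continuous_set_integrable continuous_intros)
      apply (subst set_integral_sum)
      subgoal by (rule J)
      subgoal by (intro continuous_set_integrable continuous_intros)
      by (simp add: circle_integral_cis del: of_int_diff)
    also have "\<dots> = (\<Sum>j\<in>J. a j * cnj (a j) / (2 * pi))"
      using J by (intro sum.cong refl)
        (simp add: if_distrib[of "\<lambda>x. _ * x"] power2_eq_square cong: if_cong)
    also have "\<dots> = of_real (A / (2 * pi))"
      by (simp add: A_def sum_divide_distrib complex_norm_square flip: of_real_power)
    finally show ?thesis .
  qed
  have "0 \<le> (LBINT \<mu>:{-pi..pi}. (cmod (g \<mu> - h \<mu>))\<^sup>2)"
    unfolding set_lebesgue_integral_def by (intro Bochner_Integration.integral_nonneg) simp
  also have "\<dots> = Re (LBINT \<mu>:{-pi..pi}. of_real ((cmod (g \<mu> - h \<mu>))\<^sup>2))"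
    by (subst set_integral_complex_of_real) simp
  also have "(LBINT \<mu>:{-pi..pi}. complex_of_real ((cmod (g \<mu> - h \<mu>))\<^sup>2)) =
     (LBINT \<mu>:{-pi..pi}. of_real ((cmod (g \<mu>))\<^sup>2) - g \<mu> * cnj (h \<mu>) - (cnj (g \<mu> * cnj (h \<mu>)) - h \<mu> * cnj (h \<mu>)))"
    by (intro set_lebesgue_integral_cong allI impI, simp, unfold complex_norm_square) (simp add: algebra_simps)
  also have "\<dots> = (LBINT \<mu>:{-pi..pi}. of_real ((cmod (g \<mu>))\<^sup>2)) - (LBINT \<mu>:{-pi..pi}. g \<mu> * cnj (h \<mu>))
      - ((LBINT \<mu>:{-pi..pi}. cnj (g \<mu> * cnj (h \<mu>))) - (LBINT \<mu>:{-pi..pi}. h \<mu> * cnj (h \<mu>)))"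
    apply (subst set_integral_diff(2))
    subgoal by (intro continuous_set_integrable continuous_intros g hc)
    subgoal by (intro continuous_set_integrable continuous_intros g hc)
    apply (subst set_integral_diff(2))
    subgoal by (intro continuous_set_integrable continuous_intros g hc)
    subgoal by (intro continuous_set_integrable continuous_intros g hc)
    apply (subst set_integral_diff(2))
    subgoal by (intro continuous_set_integrable continuous_intros g hc)
    subgoal by (intro continuous_set_integrable continuous_intros g hc)
    by simp
  also have "(LBINT \<mu>:{-pi..pi}. cnj (g \<mu> * cnj (h \<mu>))) = cnj (LBINT \<mu>:{-pi..pi}. g \<mu> * cnj (h \<mu>))"
  proof -
    have "(LBINT \<mu>:{-pi..pi}. cnj (g \<mu> * cnj (h \<mu>))) = (LBINT \<mu>. cnj (indicator {-pi..pi} \<mu> *\<^sub>R (g \<mu> * cnj (h \<mu>))))"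
      unfolding set_lebesgue_integral_def by (intro Bochner_Integration.integral_cong refl) (simp add: scaleR_conv_of_real)
    also have "\<dots> = cnj (LBINT \<mu>:{-pi..pi}. g \<mu> * cnj (h \<mu>))"
      unfolding set_lebesgue_integral_def by (rule Bochner_Integration.integral_cnj)
    finally show ?thesis .
  qed
  also have "(LBINT \<mu>:{-pi..pi}. complex_of_real ((cmod (g \<mu>))\<^sup>2)) = of_real (LBINT \<mu>:{-pi..pi}. (cmod (g \<mu>))\<^sup>2)"
    by (rule set_integral_complex_of_real)
  finally have "0 \<le> (LBINT \<mu>:{-pi..pi}. (cmod (g \<mu>))\<^sup>2) - A / (2 * pi)"
    by (simp add: gh hh)
  then show ?thesis by (simp add: A_def a_def field_simps)
qed

text \<open>Integration by parts turns \<open>|j|\<close> times a Fourier coefficient of \<open>g\<close> into a coefficient of the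
derivative.  The latter are square summable by Bessel's inequality, and the Cauchy--Schwarz
inequality over \<open>2 n + 1\<close> indices costs a factor of order \<open>sqrt n\<close>.\<close>

lemma weighted_fourier_coefficients_sum:
  fixes g :: "real \<Rightarrow> complex"
  assumes per: "\<And>x. g (x + 2 * pi) = g x" and C1: "g C1_differentiable_on UNIV"
  obtains C where "0 \<le> C"
    "\<And>n::nat. (\<Sum>j=-int n..int n. \<bar>of_int j\<bar> * cmod (LBINT \<mu>:{-pi..pi}. cis (of_int j * \<mu>) * g \<mu>)) \<le> C * sqrt (real n + 1)"
proof -
  obtain D where D: "\<And>x. (g has_vector_derivative D x) (at x)" and Dc: "continuous_on UNIV D"
    using C1 by (auto simp: C1_differentiable_on_def)
  have gc: "continuous_on UNIV g"
    using D by (intro continuous_at_imp_continuous_on) (auto intro: has_vector_derivative_continuous)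
  note c[continuous_intros] = continuous_on_subset[OF gc, of "{-pi..pi}"] continuous_on_subset[OF Dc, of "{-pi..pi}"]
  define B where "B = 2 * pi * (LBINT \<mu>:{-pi..pi}. (cmod (D \<mu>))\<^sup>2)"
  have B0: "0 \<le> B" unfolding B_def set_lebesgue_integral_def by (intro mult_nonneg_nonneg Bochner_Integration.integral_nonneg) auto
  have parts: "\<bar>of_int j\<bar> * cmod (LBINT \<mu>:{-pi..pi}. cis (of_int j * \<mu>) * g \<mu>) = cmod (LBINT \<mu>:{-pi..pi}. cis (of_int j * \<mu>) * D \<mu>)" for j :: int
  proof -
    have "(LBINT \<mu>:{-pi..pi}. cis (of_int j * \<mu>) * D \<mu> + (\<i> * of_real (of_int j) * cis (of_int j * \<mu>)) * g \<mu>)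
       = cis (of_int j * pi) * g pi - cis (of_int j * (- pi)) * g (- pi)"
      by (intro set_integral_FTC has_vector_derivative_mult cis_has_vector_derivative D continuous_intros) auto
    also have "\<dots> = 0" using cis_int_pi[of j] per[of "- pi"] by simp
    finally have "0 = (LBINT \<mu>:{-pi..pi}. cis (of_int j * \<mu>) * D \<mu> + (\<i> * of_int j) * (cis (of_int j * \<mu>) * g \<mu>))"
      by (simp add: algebra_simps)
    also have "\<dots> = (LBINT \<mu>:{-pi..pi}. cis (of_int j * \<mu>) * D \<mu>) + (\<i> * of_int j) * (LBINT \<mu>:{-pi..pi}. cis (of_int j * \<mu>) * g \<mu>)"
      by (subst set_integral_add) (intro continuous_set_integrable continuous_intros | simp)+
    finally have "(LBINT \<mu>:{-pi..pi}. cis (of_int j * \<mu>) * D \<mu>) = - (\<i> * of_int j) * (LBINT \<mu>:{-pi..pi}. cis (of_int j * \<mu>) * g \<mu>)"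
      by (simp add: eq_neg_iff_add_eq_0)
    then show ?thesis by (simp add: norm_mult)
  qed
  have "(\<Sum>j=-int n..int n. \<bar>of_int j\<bar> * cmod (LBINT \<mu>:{-pi..pi}. cis (of_int j * \<mu>) * g \<mu>)) \<le> sqrt (2 * B) * sqrt (real n + 1)" for n
  proof -
    have "(\<Sum>j=-int n..int n. 1 * cmod (LBINT \<mu>:{-pi..pi}. cis (of_int j * \<mu>) * D \<mu>))\<^sup>2
       \<le> (\<Sum>j=-int n..int n. 1\<^sup>2) * (\<Sum>j=-int n..int n. (cmod (LBINT \<mu>:{-pi..pi}. cis (of_int j * \<mu>) * D \<mu>))\<^sup>2)"
      by (rule Cauchy_Schwarz_ineq_sum)
    also have "\<dots> \<le> (2 * real n + 1) * B"
      using bessel_inequality[of D "{-int n..int n}"] c(2) by (intro mult_mono) (auto simp: B_def intro!: sum_nonneg)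
    also have "\<dots> \<le> 2 * B * (real n + 1)" using B0 by (simp add: algebra_simps)
    finally have "(\<Sum>j=-int n..int n. cmod (LBINT \<mu>:{-pi..pi}. cis (of_int j * \<mu>) * D \<mu>))\<^sup>2 \<le> 2 * B * (real n + 1)" by simp
    then show ?thesis by (simp add: parts real_le_rsqrt flip: real_sqrt_mult)
  qed
  with B0 show ?thesis by (intro that[of "sqrt (2 * B)"]) auto
qed

lemma int_telescope:
  fixes g :: "int \<Rightarrow> complex"
  shows "a \<le> b + 1 \<Longrightarrow> (\<Sum>k=a..b. g (k + 1) - g k) = g (b + 1) - g a"
proof (induction "nat (b + 1 - a)" arbitrary: b)
  case 0
  then have "b = a - 1" by simp
  then show ?case by simp
next
  case (Suc m)
  then have "{a..b} = insert b {a..b - 1}" by auto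
  then have "(\<Sum>k=a..b. g (k + 1) - g k) = (g (b + 1) - g b) + (\<Sum>k=a..b - 1. g (k + 1) - g k)" by simp
  also have "(\<Sum>k=a..b - 1. g (k + 1) - g k) = g b - g a" using Suc.hyps(1)[of "b - 1"] Suc.hyps(2) by simp
  finally show ?case by simp
qed

lemma cmod_cis_minus_one: "cmod (cis x - 1) = 2 * \<bar>sin (x / 2)\<bar>"
proof -
  have "(cmod (cis x - 1))\<^sup>2 = (2 * \<bar>sin (x / 2)\<bar>)\<^sup>2"
  proof -
    have "(cmod (cis x - 1))\<^sup>2 = (cos x - 1)\<^sup>2 + (sin x)\<^sup>2" by (simp add: cmod_power2)
    also have "\<dots> = 2 - 2 * cos x" using sin_cos_squared_add[of x] by (simp add: power2_eq_square algebra_simps)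
    also have "\<dots> = 4 * (sin (x / 2))\<^sup>2" using cos_double_sin[of "x / 2"] by simp
    finally show ?thesis by (simp add: power_mult_distrib)
  qed
  then show ?thesis by (subst (asm) power2_eq_iff_nonneg) auto
qed

text \<open>The sum is geometric: multiplied by \<open>cis x - 1\<close>, of modulus \<open>2 |sin (x / 2)|\<close>, it telescopes to a
difference of two points on the unit circle.\<close>

lemma cis_sum_bound: "cmod (\<Sum>k=a..b. cis (of_int k * x)) * \<bar>sin (x / 2)\<bar> \<le> 1"
proof (cases "a \<le> b + 1")
  case True
  have "(cis x - 1) * (\<Sum>k=a..b. cis (of_int k * x)) = (\<Sum>k=a..b. cis (of_int (k + 1) * x) - cis (of_int k * x))"
    by (simp add: sum_distrib_left cis_mult algebra_simps)
  also have "\<dots> = cis (of_int (b + 1) * x) - cis (of_int a * x)"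
    by (rule int_telescope[OF True])
  finally have "cmod (cis x - 1) * cmod (\<Sum>k=a..b. cis (of_int k * x)) \<le> 1 + 1"
    by (metis norm_cis norm_mult norm_triangle_ineq4)
  then show ?thesis by (simp add: cmod_cis_minus_one algebra_simps)
qed auto

lemma sin_lower:
  assumes "0 \<le> t" shows "t * (1 - t\<^sup>2 / 6) \<le> sin (t::real)"
proof -
  have "\<bar>sin t - (\<Sum>m<3. sin_coeff m * t ^ m)\<bar> \<le> inverse (fact 3) * \<bar>t\<bar> ^ 3"
    by (rule Maclaurin_sin_bound)
  then have "\<bar>sin t - t\<bar> \<le> t ^ 3 / 6"
    using assms by (simp add: numeral_3_eq_3 sin_coeff_def fact_numeral field_simps)
  then have "t - t ^ 3 / 6 \<le> sin t" using abs_ge_minus_self[of "sin t - t"] by linarith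
  then show ?thesis by (simp add: power3_eq_cube power2_eq_square algebra_simps)
qed

text \<open>The constant comes from \<open>sin t \<ge> t (1 - t\<^sup>2 / 6)\<close> with \<open>t = |x| / 2 \<le> pi / 2\<close>, where
\<open>1 - t\<^sup>2 / 6 > 29 / 50\<close>.\<close>

lemma abs_sin_half_lower:
  assumes "\<bar>x\<bar> \<le> pi" shows "29 / 100 * \<bar>x\<bar> \<le> \<bar>sin (x / 2)\<bar>"
proof -
  have *: "29 / 100 * y \<le> sin (y / 2)" if "0 \<le> y" "y \<le> pi" for y :: real
  proof -
    have "pi \<le> 3.1416" using pi_approx by simp
    then have "y\<^sup>2 \<le> 3.1416\<^sup>2" using that by (intro power_mono) auto
    then have "29 / 50 \<le> 1 - (y / 2)\<^sup>2 / 6" by (simp add: power2_eq_square field_simps)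
    then have "y / 2 * (29 / 50) \<le> y / 2 * (1 - (y / 2)\<^sup>2 / 6)" using that by (intro mult_left_mono) auto
    also have "\<dots> \<le> sin (y / 2)" using that by (intro sin_lower) auto
    finally show ?thesis by simp
  qed
  show ?thesis
    using *[of "\<bar>x\<bar>"] assms by (cases "0 \<le> x") (auto simp: abs_if)
qed

lemma one_minus_cos_le: "1 - cos y \<le> y\<^sup>2 / (2::real)"
proof -
  have "1 - cos y = 2 * (sin (y / 2))\<^sup>2" using cos_double_sin[of "y / 2"] by simp
  also have "(sin (y / 2))\<^sup>2 \<le> (y / 2)\<^sup>2" using abs_sin_x_le_abs_x[of "y / 2"] by (subst abs_le_square_iff[symmetric])
  finally show ?thesis by (simp add: power2_eq_square)
qed

definition dirichlet :: "nat \<Rightarrow> real \<Rightarrow> real" where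
  "dirichlet N x = (\<Sum>k=-int N..int N. cos (of_int k * x))"

lemma sum_symmetric_odd:
  fixes g :: "int \<Rightarrow> real"
  assumes "\<And>k. g (- k) = - g k"
  shows "(\<Sum>k=-m..m. g k) = 0"
proof -
  have "(\<Sum>k=-m..m. g k) = (\<Sum>k=-m..m. g (- k))"
    by (rule sum.reindex_bij_witness[of _ uminus uminus]) auto
  then show ?thesis by (simp add: assms sum_negf)
qed

lemma cis_sum_eq_dirichlet: "(\<Sum>k=-int N..int N. cis (of_int k * x)) = of_real (dirichlet N x)"
  using sum_symmetric_odd[of "\<lambda>k. sin (of_int k * x)" "int N"]
  by (simp add: complex_eq_iff dirichlet_def)

lemma dirichlet_minus: "dirichlet N (- x) = dirichlet N x"
  by (simp add: dirichlet_def)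

lemma dirichlet_zero: "dirichlet N 0 = 2 * real N + 1"
  by (simp add: dirichlet_def)

lemma dirichlet_decay: "\<bar>dirichlet N x\<bar> * \<bar>sin (x / 2)\<bar> \<le> 1"
  using cis_sum_bound[of x "- int N" "int N"] by (simp add: cis_sum_eq_dirichlet)

lemma sum_int_squares: "(\<Sum>k=-int N..int N. (of_int k)\<^sup>2 :: real) = real N * (real N + 1) * (2 * real N + 1) / 3"
proof (induction N)
  case (Suc N)
  have "{-int (Suc N)..int (Suc N)} = insert (int (Suc N)) (insert (- int (Suc N)) {-int N..int N})" by auto
  then show ?case using Suc by (simp add: power2_eq_square field_simps)
qed simp

text \<open>The Dirichlet kernel falls off quadratically at its peak, on the scale \<open>1 / N\<close>, and stays away from
its maximum elsewhere.  For \<open>|x| \<le> 2 / N\<close> all arguments \<open>k x\<close> lie in \<open>[-2, 2]\<close>, so that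
\<open>y\<^sup>2 / 3 \<le> 1 - cos y \<le> y\<^sup>2 / 2\<close> can be summed over \<open>y = k x\<close>.  The lower bound gives the decay, and the
upper bound shows that the kernel is not too negative.  For larger \<open>|x|\<close> the geometric sum bound
applies.\<close>

lemma dirichlet_peak:
  assumes "\<bar>x\<bar> \<le> pi" "1 \<le> N"
  shows "\<bar>dirichlet N x\<bar> \<le> (2 * real N + 1) * (1 - min (1 / 10) ((real N * x)\<^sup>2 / 9))"
proof (cases "\<bar>x\<bar> \<le> 2 / real N")
  case True
  define Q where "Q = real N * (real N + 1) * (2 * real N + 1) / 3"
  have N: "1 \<le> real N" using assms by simp
  have x2: "(real N * x)\<^sup>2 \<le> 4"
    using power_mono[of "\<bar>real N * x\<bar>" 2 2] True N by (simp add: field_simps abs_mult)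
  have low: "y\<^sup>2 / 3 \<le> 1 - cos y" if "\<bar>y\<bar> \<le> 2" for y :: real
  proof -
    have "5 / 6 * \<bar>y / 2\<bar> \<le> \<bar>y / 2\<bar> * (1 - \<bar>y / 2\<bar>\<^sup>2 / 6)"
      using that abs_square_le_1[of "y / 2"] by (subst mult.commute) (intro mult_left_mono, auto simp: power_divide)
    also have "\<dots> \<le> sin \<bar>y / 2\<bar>" by (intro sin_lower) auto
    finally have "(5 / 6 * \<bar>y / 2\<bar>)\<^sup>2 \<le> (sin \<bar>y / 2\<bar>)\<^sup>2" by (intro power_mono) auto
    also have "(sin \<bar>y / 2\<bar>)\<^sup>2 = (sin (y / 2))\<^sup>2" by (simp add: abs_if)
    also have "2 * (sin (y / 2))\<^sup>2 = 1 - cos y" using cos_double_sin[of "y / 2"] by simp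
    finally have "25 / 72 * y\<^sup>2 \<le> 1 - cos y"
      using \<open>2 * (sin (y / 2))\<^sup>2 = 1 - cos y\<close> by (simp add: power2_eq_square)
    moreover have "y\<^sup>2 / 3 \<le> 25 / 72 * y\<^sup>2" by simp
    ultimately show ?thesis by linarith
  qed
  have diff: "(2 * real N + 1) - dirichlet N x = (\<Sum>k=-int N..int N. 1 - cos (of_int k * x))"
    by (simp add: dirichlet_def sum_subtractf)
  have "(2 * real N + 1) - dirichlet N x \<le> (\<Sum>k=-int N..int N. (of_int k)\<^sup>2 * (x\<^sup>2 / 2))"
    unfolding diff by (intro sum_mono) (use one_minus_cos_le[of "of_int _ * x"] in \<open>simp add: power_mult_distrib\<close>)
  also have "\<dots> = Q * (x\<^sup>2 / 2)" unfolding sum_distrib_right[symmetric] sum_int_squares Q_def ..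
  also have "\<dots> \<le> (2 * real N + 1) * ((real N * x)\<^sup>2 / 3)"
  proof -
    have "(real N + 1) * (real N * x\<^sup>2) \<le> (2 * real N) * (real N * x\<^sup>2)" using N by (intro mult_right_mono) auto
    then have "(2 * real N + 1) / 6 * ((real N + 1) * (real N * x\<^sup>2)) \<le> (2 * real N + 1) / 6 * ((2 * real N) * (real N * x\<^sup>2))"
      by (intro mult_left_mono) auto
    moreover have "Q * (x\<^sup>2 / 2) = (2 * real N + 1) / 6 * ((real N + 1) * (real N * x\<^sup>2))"
      by (simp add: Q_def)
    moreover have "(2 * real N + 1) * ((real N * x)\<^sup>2 / 3) = (2 * real N + 1) / 6 * ((2 * real N) * (real N * x\<^sup>2))"
      by (simp add: power_mult_distrib power2_eq_square)
    ultimately show ?thesis by (simp only:)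
  qed
  also have "\<dots> \<le> (2 * real N + 1) * (4 / 3)" using x2 by (intro mult_left_mono) auto
  finally have l: "- (2 * real N + 1) / 3 \<le> dirichlet N x" by (simp add: field_simps)
  have "(2 * real N + 1) * ((real N * x)\<^sup>2 / 9) \<le> Q * (x\<^sup>2 / 3)"
  proof -
    have "real N * (real N * x\<^sup>2) \<le> (real N + 1) * (real N * x\<^sup>2)" by (intro mult_right_mono) auto
    then have "(2 * real N + 1) / 9 * (real N * (real N * x\<^sup>2)) \<le> (2 * real N + 1) / 9 * ((real N + 1) * (real N * x\<^sup>2))"
      by (intro mult_left_mono) auto
    moreover have "Q * (x\<^sup>2 / 3) = (2 * real N + 1) / 9 * ((real N + 1) * (real N * x\<^sup>2))"
      by (simp add: Q_def)
    moreover have "(2 * real N + 1) * ((real N * x)\<^sup>2 / 9) = (2 * real N + 1) / 9 * (real N * (real N * x\<^sup>2))"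
      by (simp add: power_mult_distrib power2_eq_square)
    ultimately show ?thesis by (simp only:)
  qed
  also have "\<dots> = (\<Sum>k=-int N..int N. (of_int k)\<^sup>2 * (x\<^sup>2 / 3))" unfolding sum_distrib_right[symmetric] sum_int_squares Q_def ..
  also have "\<dots> \<le> (2 * real N + 1) - dirichlet N x"
    unfolding diff
  proof (intro sum_mono)
    fix k assume "k \<in> {-int N..int N}"
    then have "\<bar>of_int k\<bar> \<le> real N" by simp linarith
    then have "\<bar>of_int k * x\<bar> \<le> real N * (2 / real N)"
      unfolding abs_mult using True by (intro mult_mono) auto
    then have "\<bar>of_int k * x\<bar> \<le> 2" using N by simp
    from low[OF this] show "(of_int k)\<^sup>2 * (x\<^sup>2 / 3) \<le> 1 - cos (of_int k * x)" by (simp add: power_mult_distrib)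
  qed
  finally have u: "dirichlet N x \<le> (2 * real N + 1) * (1 - (real N * x)\<^sup>2 / 9)" by (simp add: algebra_simps)
  have "(2 * real N + 1) / 3 \<le> (2 * real N + 1) * (1 - (real N * x)\<^sup>2 / 9)"
    using mult_left_mono[of "1 / 3" "1 - (real N * x)\<^sup>2 / 9" "2 * real N + 1"] x2 by simp
  then have "\<bar>dirichlet N x\<bar> \<le> (2 * real N + 1) * (1 - (real N * x)\<^sup>2 / 9)" using l u unfolding abs_le_iff by linarith
  also have "\<dots> \<le> (2 * real N + 1) * (1 - min (1 / 10) ((real N * x)\<^sup>2 / 9))" by (intro mult_left_mono) auto
  finally show ?thesis .
next
  case False
  have N: "1 \<le> real N" using assms by simp
  have "29 / 100 * (2 / real N) \<le> 29 / 100 * \<bar>x\<bar>" using False by simp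
  also have "\<dots> \<le> \<bar>sin (x / 2)\<bar>" by (rule abs_sin_half_lower[OF assms(1)])
  finally have "\<bar>dirichlet N x\<bar> * (29 / 50 / real N) \<le> \<bar>dirichlet N x\<bar> * \<bar>sin (x / 2)\<bar>" by (intro mult_left_mono) auto
  also have "\<dots> \<le> 1" by (rule dirichlet_decay)
  finally have "\<bar>dirichlet N x\<bar> \<le> 50 / 29 * real N" using N by (simp add: field_simps)
  also have "\<dots> \<le> (2 * real N + 1) * (9 / 10)" using N by simp
  also have "\<dots> \<le> (2 * real N + 1) * (1 - min (1 / 10) ((real N * x)\<^sup>2 / 9))"
    by (intro mult_left_mono) (auto simp: min_def)
  finally show ?thesis .
qed

section \<open>The covariance function of the process\<close>

lemma borel_measurable_cnj[measurable (raw)]: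
  "f \<in> borel_measurable M \<Longrightarrow> (\<lambda>x. cnj (f x)) \<in> borel_measurable M"
  by (rule borel_measurable_continuous_on[where f = cnj]) (intro continuous_intros)+

lemma integral_cauchy_schwarz:
  fixes f g :: "'a \<Rightarrow> complex"
  assumes [measurable]: "f \<in> borel_measurable M" "g \<in> borel_measurable M"
    and f: "integrable M (\<lambda>x. (cmod (f x))\<^sup>2)" and g: "integrable M (\<lambda>x. (cmod (g x))\<^sup>2)"
  shows "integrable M (\<lambda>x. f x * g x)"
    and "cmod (LINT x|M. f x * g x) \<le> sqrt (LINT x|M. (cmod (f x))\<^sup>2) * sqrt (LINT x|M. (cmod (g x))\<^sup>2)"
proof -
  show i: "integrable M (\<lambda>x. f x * g x)"
  proof (rule Bochner_Integration.integrable_bound[OF Bochner_Integration.integrable_add[OF f g]])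
    show "AE x in M. norm (f x * g x) \<le> norm ((cmod (f x))\<^sup>2 + (cmod (g x))\<^sup>2)"
    proof (intro always_eventually allI)
      fix x
      have "cmod (f x) * cmod (g x) \<le> (cmod (f x))\<^sup>2 + (cmod (g x))\<^sup>2"
        using sum_squares_bound[of "cmod (f x)" "cmod (g x)"] mult_nonneg_nonneg[OF norm_ge_zero norm_ge_zero, of "f x" "g x"] by linarith
      then show "norm (f x * g x) \<le> norm ((cmod (f x))\<^sup>2 + (cmod (g x))\<^sup>2)" by (simp add: norm_mult)
    qed
  qed measurable
  define I where "I = (LINT x|M. cmod (f x * g x))"
  have I0: "0 \<le> I" unfolding I_def by (intro Bochner_Integration.integral_nonneg) simp
  have "(\<integral>\<^sup>+x. ennreal (cmod (f x)) * ennreal (cmod (g x)) \<partial>M)\<^sup>2 \<le>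
      (\<integral>\<^sup>+x. (ennreal (cmod (f x)))\<^sup>2 \<partial>M) * (\<integral>\<^sup>+x. (ennreal (cmod (g x)))\<^sup>2 \<partial>M)"
    by (rule Cauchy_Schwarz_nn_integral) measurable
  moreover have "(\<integral>\<^sup>+x. ennreal (cmod (f x)) * ennreal (cmod (g x)) \<partial>M) = ennreal I"
    unfolding I_def using integrable_norm[OF i] by (subst nn_integral_eq_integral[symmetric]) (auto simp: norm_mult ennreal_mult)
  moreover have "(\<integral>\<^sup>+x. (ennreal (cmod (f x)))\<^sup>2 \<partial>M) = ennreal (LINT x|M. (cmod (f x))\<^sup>2)"
    using f by (subst nn_integral_eq_integral[symmetric]) (auto simp: ennreal_power)
  moreover have "(\<integral>\<^sup>+x. (ennreal (cmod (g x)))\<^sup>2 \<partial>M) = ennreal (LINT x|M. (cmod (g x))\<^sup>2)"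
    using g by (subst nn_integral_eq_integral[symmetric]) (auto simp: ennreal_power)
  ultimately have "ennreal (I\<^sup>2) \<le> ennreal ((LINT x|M. (cmod (f x))\<^sup>2) * (LINT x|M. (cmod (g x))\<^sup>2))"
    using I0 by (simp add: ennreal_power ennreal_mult)
  then have "I\<^sup>2 \<le> (LINT x|M. (cmod (f x))\<^sup>2) * (LINT x|M. (cmod (g x))\<^sup>2)"
    by (subst (asm) ennreal_le_iff) (auto intro!: mult_nonneg_nonneg)
  then have "I \<le> sqrt (LINT x|M. (cmod (f x))\<^sup>2) * sqrt (LINT x|M. (cmod (g x))\<^sup>2)"
    by (simp add: real_le_rsqrt flip: real_sqrt_mult)
  moreover have "cmod (LINT x|M. f x * g x) \<le> I" unfolding I_def by (rule integral_norm_bound)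
  ultimately show "cmod (LINT x|M. f x * g x) \<le> sqrt (LINT x|M. (cmod (f x))\<^sup>2) * sqrt (LINT x|M. (cmod (g x))\<^sup>2)"
    by linarith
qed

lemma Arg_cis_exists: "\<exists>z::int. Arg (cis x) = x - 2 * pi * of_int z"
proof -
  define z where "z = \<lceil>(x - pi) / (2 * pi)\<rceil>"
  have "(x - pi) / (2 * pi) \<le> of_int z" "of_int z < (x - pi) / (2 * pi) + 1"
    unfolding z_def by linarith+
  then have "x - 2 * pi * of_int z \<in> {-pi<..pi}"
    by (auto simp: field_simps)
  then have "Arg (cis (x - 2 * pi * of_int z)) = x - 2 * pi * of_int z" by (rule Arg_cis)
  moreover have "cis (x - 2 * pi * of_int z) = cis x * cis (2 * pi * of_int (- z))"
    by (simp add: cis_mult)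
  moreover have "cis (2 * pi * of_int (- z)) = 1" by (rule cis_multiple_2pi) simp
  ultimately show ?thesis by auto
qed

lemma Arg_cis_ceiling: "Arg (cis x) = x - 2 * pi * of_int \<lceil>(x - pi) / (2 * pi)\<rceil>"
proof -
  obtain z :: int where z: "Arg (cis x) = x - 2 * pi * of_int z" using Arg_cis_exists by blast
  have "- pi < Arg (cis x)" "Arg (cis x) \<le> pi" using Arg_bounded by auto
  then have "(x - pi) / (2 * pi) \<le> of_int z" "of_int z < (x - pi) / (2 * pi) + 1"
    by (auto simp: z field_simps)
  then have "\<lceil>(x - pi) / (2 * pi)\<rceil> = z" by linarith
  then show ?thesis by (simp add: z)
qed

lemma Arg_cis_measurable[measurable]: "(\<lambda>x. Arg (cis x)) \<in> borel_measurable borel"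
  unfolding Arg_cis_ceiling by measurable

lemma cis_int_Arg: "cis (of_int k * Arg (cis x)) = cis (of_int k * x)"
proof -
  obtain z :: int where z: "Arg (cis x) = x - 2 * pi * of_int z" using Arg_cis_exists by blast
  have "cis (of_int k * Arg (cis x)) = cis (of_int k * x) * cis (2 * pi * of_int (- (k * z)))"
    by (simp add: z cis_mult algebra_simps)
  moreover have "cis (2 * pi * of_int (- (k * z))) = 1" by (rule cis_multiple_2pi) simp
  ultimately show ?thesis by simp
qed

definition mesh :: "nat \<Rightarrow> nat \<Rightarrow> real" where
  "mesh N i = - pi + 2 * pi * real i / real N"

lemma mesh_simps: "mesh N 0 = - pi" "N > 0 \<Longrightarrow> mesh N N = pi" "mesh N (Suc i) - mesh N i = 2 * pi / real N"
  by (auto simp: mesh_def field_simps add_divide_distrib)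

lemma mesh_mono: "i \<le> j \<Longrightarrow> mesh N i \<le> mesh N j"
  by (auto simp: mesh_def intro!: divide_right_mono)

lemma mesh_mem: "i \<le> N \<Longrightarrow> N > 0 \<Longrightarrow> mesh N i \<in> {-pi..pi}"
  using mesh_mono[of 0 i N] mesh_mono[of i N N] by (simp add: mesh_simps)

text \<open>The tagged sums of \<open>has_ms_integral\<close> over the equidistant mesh with right end points as tags, and the
step function that they integrate.\<close>

definition riemann_sum :: "(real \<Rightarrow> 'a \<Rightarrow> complex) \<Rightarrow> (real \<Rightarrow> complex) \<Rightarrow> nat \<Rightarrow> 'a \<Rightarrow> complex" where
  "riemann_sum Z g N \<omega> = (\<Sum>i<N. g (mesh N (Suc i)) * (Z (mesh N (Suc i)) \<omega> - Z (mesh N i) \<omega>))"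

definition step_fun :: "(real \<Rightarrow> complex) \<Rightarrow> nat \<Rightarrow> real \<Rightarrow> complex" where
  "step_fun g N x = (\<Sum>i<N. g (mesh N (Suc i)) * indicator {mesh N i<..mesh N (Suc i)} x)"

lemma ms_integral_riemann_sums:
  assumes "has_ms_integral M Z g Y"
  shows "(\<lambda>N. LINT \<omega>|M. (cmod (Y \<omega> - riemann_sum Z g N \<omega>))\<^sup>2) \<longlonglongrightarrow> 0"
proof (rule tendstoI)
  fix \<epsilon> :: real assume "\<epsilon> > 0"
  then obtain d where "d > 0" and d: "\<And>N (t :: nat \<Rightarrow> real) (s :: nat \<Rightarrow> real).
        t 0 = - pi \<and> t N = pi \<and>
        (\<forall>i<N. t i \<le> s i \<and> s i \<le> t (Suc i) \<and> t (Suc i) - t i < d) \<Longrightarrow>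
        (LINT \<omega>|M. (cmod (Y \<omega> - (\<Sum>i<N. g (s i) * (Z (t (Suc i)) \<omega> - Z (t i) \<omega>))))\<^sup>2) < \<epsilon>"
    using assms unfolding has_ms_integral_def by blast
  have "(\<lambda>N. 2 * pi / real N) \<longlonglongrightarrow> 0" by real_asymp
  then have "\<forall>\<^sub>F N in sequentially. 2 * pi / real N < d" using \<open>d > 0\<close> by (rule order_tendstoD)
  then show "\<forall>\<^sub>F N in sequentially. dist (LINT \<omega>|M. (cmod (Y \<omega> - riemann_sum Z g N \<omega>))\<^sup>2) 0 < \<epsilon>"
    using eventually_gt_at_top[of 0]
  proof eventually_elim
    case (elim N)
    have "(LINT \<omega>|M. (cmod (Y \<omega> - riemann_sum Z g N \<omega>))\<^sup>2) < \<epsilon>"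
      unfolding riemann_sum_def
      by (rule d[of "mesh N" N "\<lambda>i. mesh N (Suc i)"]) (use elim in \<open>auto simp: mesh_simps mesh_mono\<close>)
    moreover have "0 \<le> (LINT \<omega>|M. (cmod (Y \<omega> - riemann_sum Z g N \<omega>))\<^sup>2)"
      by (intro Bochner_Integration.integral_nonneg) simp
    ultimately show ?case by simp
  qed
qed

lemma step_fun_unique:
  assumes "N > 0" "x \<in> {-pi<..pi}"
  obtains i where "i < N" "mesh N i < x" "x \<le> mesh N (Suc i)" "step_fun g N x = g (mesh N (Suc i))"
proof -
  define i where "i = (LEAST i. x \<le> mesh N (Suc i))"
  have ex: "x \<le> mesh N (Suc (N - 1))" using assms by (simp add: mesh_simps)
  have i1: "x \<le> mesh N (Suc i)" unfolding i_def by (rule LeastI[of _ "N - 1"]) (rule ex)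
  have "i \<le> N - 1" unfolding i_def by (rule Least_le) (rule ex)
  then have iN: "i < N" using assms by simp
  have i2: "mesh N i < x"
  proof (cases i)
    case 0 then show ?thesis using assms by (simp add: mesh_simps)
  next
    case (Suc j)
    then have "\<not> x \<le> mesh N (Suc j)" unfolding i_def by (intro not_less_Least) simp
    then show ?thesis using Suc by simp
  qed
  have "step_fun g N x = (\<Sum>j\<in>{i}. g (mesh N (Suc j)) * indicator {mesh N j<..mesh N (Suc j)} x)"
    unfolding step_fun_def
  proof (intro sum.mono_neutral_right ballI)
    fix j assume "j \<in> {..<N} - {i}"
    then have "j < i \<or> i < j" by auto
    then show "g (mesh N (Suc j)) * indicator {mesh N j<..mesh N (Suc j)} x = 0"
      using mesh_mono[of "Suc j" i N] mesh_mono[of "Suc i" j N] i1 i2 by auto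
  qed (use iN in auto)
  then show ?thesis using i1 i2 iN by (intro that[of i]) auto
qed

lemma cmod_cis_diff_le: "cmod (cis x - cis y) \<le> \<bar>x - y\<bar>"
proof -
  have "cis x - cis y = cis y * (cis (x - y) - 1)" by (simp add: cis_mult algebra_simps)
  then have "cmod (cis x - cis y) = cmod (cis (x - y) - 1)" by (simp add: norm_mult)
  also have "\<dots> \<le> \<bar>x - y\<bar>"
    using abs_sin_x_le_abs_x[of "(x - y) / 2"] by (simp add: cmod_cis_minus_one)
  finally show ?thesis .
qed

lemma step_fun_cis_approx:
  assumes "N > 0" "x \<in> {-pi<..pi}"
  shows "cmod (step_fun (\<lambda>x. cis (of_int k * x)) N x) \<le> 1"
    and "cmod (step_fun (\<lambda>x. cis (of_int k * x)) N x - cis (of_int k * x)) \<le> \<bar>of_int k\<bar> * (2 * pi / real N)"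
proof -
  obtain i where i: "i < N" "mesh N i < x" "x \<le> mesh N (Suc i)"
    "step_fun (\<lambda>x. cis (of_int k * x)) N x = cis (of_int k * mesh N (Suc i))"
    using step_fun_unique[OF assms] by blast
  show "cmod (step_fun (\<lambda>x. cis (of_int k * x)) N x) \<le> 1" by (simp add: i)
  have "cmod (step_fun (\<lambda>x. cis (of_int k * x)) N x - cis (of_int k * x)) \<le> \<bar>of_int k * mesh N (Suc i) - of_int k * x\<bar>"
    unfolding i(4) by (rule cmod_cis_diff_le)
  also have "\<dots> = \<bar>of_int k\<bar> * \<bar>mesh N (Suc i) - x\<bar>" by (simp add: abs_mult flip: right_diff_distrib)
  also have "\<dots> \<le> \<bar>of_int k\<bar> * (2 * pi / real N)"
    using i(2,3) mesh_simps(3)[of N i] by (intro mult_left_mono) auto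
  finally show "cmod (step_fun (\<lambda>x. cis (of_int k * x)) N x - cis (of_int k * x)) \<le> \<bar>of_int k\<bar> * (2 * pi / real N)" .
qed

lemma step_fun_measurable[measurable]: "step_fun g N \<in> borel_measurable borel"
  unfolding step_fun_def[abs_def] by measurable

text \<open>Second moments of Riemann sums of \<open>dZ\<close> are integrals of products of step functions against the line
measure.  The sums converge in mean square and the step functions converge pointwise on
\<open>(-\<pi>, \<pi>]\<close> with modulus at most 1, so both sides pass to the limit.\<close>

lemma harmonizable_covariance:
  fixes X :: "int \<Rightarrow> 'a \<Rightarrow> real"
  assumes H: "harmonizable_on_lines M X L f" and L: "finite L"
  shows "complex_of_real (LINT \<omega>|M. X k \<omega> * X m \<omega>) = (\<Sum>b\<in>L. cis (of_int k * b) * line_coeff f b (k - m))"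
proof -
  from H obtain Z where
    Z: "\<And>x. x \<in> {-pi..pi} \<Longrightarrow> Z x \<in> borel_measurable M \<and> integrable M (\<lambda>\<omega>. (cmod (Z x \<omega>))\<^sup>2)" and
    ZZ: "\<And>x1 x2 y1 y2. - pi \<le> x1 \<and> x1 \<le> x2 \<and> x2 \<le> pi \<and> - pi \<le> y1 \<and> y1 \<le> y2 \<and> y2 \<le> pi \<Longrightarrow>
           (LINT \<omega>|M. (Z x2 \<omega> - Z x1 \<omega>) * cnj (Z y2 \<omega> - Z y1 \<omega>)) =
             line_measure L f ({x1<..x2} \<times> {y1<..y2})" and
    ms: "\<And>k. has_ms_integral M Z (\<lambda>x. cis (of_int k * x)) (\<lambda>\<omega>. complex_of_real (X k \<omega>))"
    unfolding harmonizable_on_lines_def by blast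
  have X[measurable]: "X k \<in> borel_measurable M" and X2: "integrable M (\<lambda>\<omega>. (X k \<omega>)\<^sup>2)" for k
    using H by (auto simp: harmonizable_on_lines_def)
  have fi: "set_integrable lborel {-pi..pi} (f b)" if "b \<in> L" for b
    using H that by (auto simp: harmonizable_on_lines_def)
  define e where "e k = (\<lambda>x. cis (of_int k * x))" for k :: int
  define Y where "Y k = riemann_sum Z (e k)" for k
  define dZ where "dZ N i \<omega> = Z (mesh N (Suc i)) \<omega> - Z (mesh N i) \<omega>" for N i \<omega>
  have diff2: "integrable M (\<lambda>\<omega>. (cmod (u \<omega> - v \<omega>))\<^sup>2)"
    if [measurable]: "u \<in> borel_measurable M" "v \<in> borel_measurable M"
    and u: "integrable M (\<lambda>\<omega>. (cmod (u \<omega>))\<^sup>2)" and v: "integrable M (\<lambda>\<omega>. (cmod (v \<omega>))\<^sup>2)" for u v :: "'a \<Rightarrow> complex"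
  proof (rule Bochner_Integration.integrable_bound)
    show "integrable M (\<lambda>\<omega>. 2 * (cmod (u \<omega>))\<^sup>2 + 2 * (cmod (v \<omega>))\<^sup>2)" using u v by simp
    show "AE \<omega> in M. norm ((cmod (u \<omega> - v \<omega>))\<^sup>2) \<le> norm (2 * (cmod (u \<omega>))\<^sup>2 + 2 * (cmod (v \<omega>))\<^sup>2)"
    proof (intro always_eventually allI)
      fix \<omega>
      have "(cmod (u \<omega> - v \<omega>))\<^sup>2 \<le> (cmod (u \<omega>) + cmod (v \<omega>))\<^sup>2" by (intro power_mono norm_triangle_ineq4) auto
      also have "\<dots> \<le> 2 * (cmod (u \<omega>))\<^sup>2 + 2 * (cmod (v \<omega>))\<^sup>2"
        using sum_squares_bound[of "cmod (u \<omega>)" "cmod (v \<omega>)"] by (simp add: power2_sum)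
      finally show "norm ((cmod (u \<omega> - v \<omega>))\<^sup>2) \<le> norm (2 * (cmod (u \<omega>))\<^sup>2 + 2 * (cmod (v \<omega>))\<^sup>2)" by simp
    qed
  qed measurable
  have dZm: "dZ N i \<in> borel_measurable M" and dZi: "integrable M (\<lambda>\<omega>. (cmod (dZ N i \<omega>))\<^sup>2)" if "i < N" for N i
  proof -
    have "mesh N i \<in> {-pi..pi}" "mesh N (Suc i) \<in> {-pi..pi}" using mesh_mem that by auto
    note z = Z[OF this(1)] Z[OF this(2)]
    show "dZ N i \<in> borel_measurable M" unfolding dZ_def[abs_def] using z by auto
    show "integrable M (\<lambda>\<omega>. (cmod (dZ N i \<omega>))\<^sup>2)" unfolding dZ_def using z by (intro diff2) auto
  qed
  have YdZ: "Y k N \<omega> = (\<Sum>i<N. e k (mesh N (Suc i)) * dZ N i \<omega>)" for k N \<omega>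
    by (simp add: Y_def riemann_sum_def dZ_def)
  have Ym[measurable]: "Y k N \<in> borel_measurable M" for k N
    unfolding YdZ[abs_def] using dZm by (intro borel_measurable_sum borel_measurable_times) auto
  have prod_int: "integrable M (\<lambda>\<omega>. dZ N i \<omega> * cnj (dZ N j \<omega>))" if "i < N" "j < N" for N i j
    using dZm that dZi by (intro integral_cauchy_schwarz(1)) auto
  have YY: "(LINT \<omega>|M. Y k N \<omega> * cnj (Y m N \<omega>)) =
      (\<Sum>i<N. \<Sum>j<N. e k (mesh N (Suc i)) * cnj (e m (mesh N (Suc j))) * (LINT \<omega>|M. dZ N i \<omega> * cnj (dZ N j \<omega>)))"
    and YYi: "integrable M (\<lambda>\<omega>. Y k N \<omega> * cnj (Y m N \<omega>))" for N k m
  proof -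
    have eq: "(\<lambda>\<omega>. Y k N \<omega> * cnj (Y m N \<omega>)) = (\<lambda>\<omega>. \<Sum>i<N. \<Sum>j<N. (e k (mesh N (Suc i)) * cnj (e m (mesh N (Suc j)))) * (dZ N i \<omega> * cnj (dZ N j \<omega>)))"
      by (auto simp: YdZ sum_product fun_eq_iff algebra_simps intro!: sum.cong)
    show "integrable M (\<lambda>\<omega>. Y k N \<omega> * cnj (Y m N \<omega>))"
      unfolding eq by (intro Bochner_Integration.integrable_sum integrable_mult_right prod_int) auto
    show "(LINT \<omega>|M. Y k N \<omega> * cnj (Y m N \<omega>)) =
      (\<Sum>i<N. \<Sum>j<N. e k (mesh N (Suc i)) * cnj (e m (mesh N (Suc j))) * (LINT \<omega>|M. dZ N i \<omega> * cnj (dZ N j \<omega>)))"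
      unfolding eq
      apply (subst Bochner_Integration.integral_sum)
      subgoal by (intro Bochner_Integration.integrable_sum integrable_mult_right prod_int) auto
      apply (intro sum.cong refl)
      apply (subst Bochner_Integration.integral_sum)
      subgoal by (intro integrable_mult_right prod_int) auto
      by simp
  qed
  have Y2: "integrable M (\<lambda>\<omega>. (cmod (Y k N \<omega>))\<^sup>2)" for k N
  proof -
    have "integrable M (\<lambda>\<omega>. Re (Y k N \<omega> * cnj (Y k N \<omega>)))" by (intro integrable_Re YYi)
    moreover have "Re (z * cnj z) = (cmod z)\<^sup>2" for z
      unfolding cmod_power2 by (simp add: power2_eq_square)
    ultimately show ?thesis by simp
  qed
  define G where "G k N b \<mu> = step_fun (e k) N (Arg (cis (\<mu> + b)))" for k N b \<mu>
  have "(\<lambda>N. LINT \<omega>|M. Y k N \<omega> * cnj (Y m N \<omega>)) \<longlonglongrightarrow> (LINT \<omega>|M. complex_of_real (X k \<omega>) * cnj (complex_of_real (X m \<omega>)))"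
  proof (rule LIM_zero_cancel, rule Lim_null_comparison)
    define A where "A k N = sqrt (LINT \<omega>|M. (cmod (complex_of_real (X k \<omega>) - Y k N \<omega>))\<^sup>2)" for k N
    define B where "B = sqrt (LINT \<omega>|M. (cmod (complex_of_real (X k \<omega>)))\<^sup>2)"
    define B' where "B' = sqrt (LINT \<omega>|M. (cmod (complex_of_real (X m \<omega>)))\<^sup>2)"
    have A: "A k \<longlonglongrightarrow> 0" for k
      unfolding A_def Y_def e_def using tendsto_real_sqrt[OF ms_integral_riemann_sums[OF ms[of k]]] by simp
    show "(\<lambda>N. A k N * B' + (A k N * A m N + B * A m N)) \<longlonglongrightarrow> 0"
      by (auto intro!: tendsto_eq_intros A)
    have Xc: "(\<lambda>\<omega>. complex_of_real (X k \<omega>)) \<in> borel_measurable M" "integrable M (\<lambda>\<omega>. (cmod (complex_of_real (X k \<omega>)))\<^sup>2)" for k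
      using X2 by auto
    have D: "(\<lambda>\<omega>. complex_of_real (X k \<omega>) - Y k N \<omega>) \<in> borel_measurable M"
      "integrable M (\<lambda>\<omega>. (cmod (complex_of_real (X k \<omega>) - Y k N \<omega>))\<^sup>2)" for k N
      using Y2 Xc by (auto intro!: diff2)
    show "\<forall>\<^sub>F N in sequentially. norm ((LINT \<omega>|M. Y k N \<omega> * cnj (Y m N \<omega>)) - (LINT \<omega>|M. complex_of_real (X k \<omega>) * cnj (complex_of_real (X m \<omega>)))) \<le> A k N * B' + (A k N * A m N + B * A m N)"
    proof (intro always_eventually allI)
      fix N
      have tri: "cmod z \<le> p' + (q' + r')"
        if "cmod p \<le> p'" "cmod q \<le> q'" "cmod r \<le> r'" "z = q - p - r" for z q p r :: complex and p' q' r'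
        using norm_triangle_ineq4[of "q - p" r] norm_triangle_ineq4[of q p] that by simp
      let ?P = "\<lambda>\<omega>. (complex_of_real (X k \<omega>) - Y k N \<omega>) * cnj (complex_of_real (X m \<omega>))"
      let ?Q = "\<lambda>\<omega>. (complex_of_real (X k \<omega>) - Y k N \<omega>) * cnj (complex_of_real (X m \<omega>) - Y m N \<omega>)"
      let ?R = "\<lambda>\<omega>. complex_of_real (X k \<omega>) * cnj (complex_of_real (X m \<omega>) - Y m N \<omega>)"
      have i: "integrable M ?P" "integrable M ?Q" "integrable M ?R" 
        "integrable M (\<lambda>\<omega>. complex_of_real (X k \<omega>) * cnj (complex_of_real (X m \<omega>)))"
        using D Xc by (auto intro!: integral_cauchy_schwarz(1) simp del: complex_cnj_diff)
      have "cmod (LINT \<omega>|M. ?P \<omega>) \<le> A k N * B'"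
        using integral_cauchy_schwarz(2)[of _ M "\<lambda>\<omega>. cnj (complex_of_real (X m \<omega>))", OF D(1) _ D(2)] Xc
        by (simp add: A_def B'_def)
      moreover have "cmod (LINT \<omega>|M. ?Q \<omega>) \<le> A k N * A m N"
        using integral_cauchy_schwarz(2)[of _ M "\<lambda>\<omega>. cnj (complex_of_real (X m \<omega>) - Y m N \<omega>)", OF D(1) _ D(2)] D
        by (simp add: A_def del: complex_cnj_diff)
      moreover have "cmod (LINT \<omega>|M. ?R \<omega>) \<le> B * A m N"
        using integral_cauchy_schwarz(2)[of _ M "\<lambda>\<omega>. cnj (complex_of_real (X m \<omega>) - Y m N \<omega>)", OF Xc(1) _ Xc(2)] D
        by (simp add: A_def B_def del: complex_cnj_diff)
      moreover have "(LINT \<omega>|M. Y k N \<omega> * cnj (Y m N \<omega>)) - (LINT \<omega>|M. complex_of_real (X k \<omega>) * cnj (complex_of_real (X m \<omega>)))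
         = (LINT \<omega>|M. ?Q \<omega>) - (LINT \<omega>|M. ?P \<omega>) - (LINT \<omega>|M. ?R \<omega>)"
      proof -
        have "(LINT \<omega>|M. Y k N \<omega> * cnj (Y m N \<omega>)) - (LINT \<omega>|M. complex_of_real (X k \<omega>) * cnj (complex_of_real (X m \<omega>)))
           = (LINT \<omega>|M. Y k N \<omega> * cnj (Y m N \<omega>) - complex_of_real (X k \<omega>) * cnj (complex_of_real (X m \<omega>)))"
          by (rule Bochner_Integration.integral_diff[symmetric]) (rule i YYi)+
        also have "\<dots> = (LINT \<omega>|M. ?Q \<omega> - ?P \<omega> - ?R \<omega>)"
          by (intro Bochner_Integration.integral_cong refl) (simp add: algebra_simps)
        also have "\<dots> = (LINT \<omega>|M. ?Q \<omega>) - (LINT \<omega>|M. ?P \<omega>) - (LINT \<omega>|M. ?R \<omega>)"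
          by (subst Bochner_Integration.integral_diff, (intro Bochner_Integration.integrable_diff i)+)+ simp
        finally show ?thesis .
      qed
      ultimately show "norm ((LINT \<omega>|M. Y k N \<omega> * cnj (Y m N \<omega>)) - (LINT \<omega>|M. complex_of_real (X k \<omega>) * cnj (complex_of_real (X m \<omega>)))) \<le> A k N * B' + (A k N * A m N + B * A m N)"
        using tri by fastforce
    qed
  qed
  moreover have "(\<lambda>N. LINT \<omega>|M. Y k N \<omega> * cnj (Y m N \<omega>)) \<longlonglongrightarrow> (\<Sum>b\<in>L. cis (of_int k * b) * line_coeff f b (k - m))"
  proof -
    have main: "(LINT \<omega>|M. Y k N \<omega> * cnj (Y m N \<omega>)) =
       (\<Sum>b\<in>L. LBINT \<mu>:{-pi..pi}. G k N b \<mu> * cnj (step_fun (e m) N \<mu>) * f b \<mu>)" if "N > 0" for N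
    proof -
      have ind: "set_integrable lborel {-pi..pi} (\<lambda>\<mu>. indicator S (Arg (cis (\<mu> + b)), \<mu>) * f b \<mu>)"
        if "b \<in> L" "S \<in> sets borel" for b and S :: "(real \<times> real) set"
      proof (rule set_integrable_bound[OF fi[OF that(1)]])
        have [measurable]: "S \<in> sets (borel \<Otimes>\<^sub>M borel)" using that(2) unfolding borel_prod[where 'a = real and 'b = real, symmetric] .
        have [measurable]: "(\<lambda>x. indicator {-pi..pi} x *\<^sub>R f b x) \<in> borel_measurable borel"
          using fi[OF that(1)] unfolding set_integrable_def by (auto dest: borel_measurable_integrable)
        have "(\<lambda>\<mu>. indicator S (Arg (cis (\<mu> + b)), \<mu>) * (indicator {-pi..pi} \<mu> *\<^sub>R f b \<mu>)) \<in> borel_measurable borel"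
          by measurable
        then show "set_borel_measurable lborel {-pi..pi} (\<lambda>\<mu>. indicator S (Arg (cis (\<mu> + b)), \<mu>) * f b \<mu>)"
          unfolding set_borel_measurable_def by (simp add: scaleR_conv_of_real algebra_simps)
      qed (auto split: split_indicator)
      have "(LINT \<omega>|M. Y k N \<omega> * cnj (Y m N \<omega>)) =
        (\<Sum>i<N. \<Sum>j<N. \<Sum>b\<in>L. e k (mesh N (Suc i)) * cnj (e m (mesh N (Suc j))) *
          (LBINT \<mu>:{-pi..pi}. indicator ({mesh N i<..mesh N (Suc i)} \<times> {mesh N j<..mesh N (Suc j)}) (Arg (cis (\<mu> + b)), \<mu>) * f b \<mu>))"
        unfolding YY
      proof (intro sum.cong refl)
        fix i j assume ij: "i \<in> {..<N}" "j \<in> {..<N}"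
        then have "mesh N i \<in> {-pi..pi}" "mesh N (Suc i) \<in> {-pi..pi}" "mesh N j \<in> {-pi..pi}" "mesh N (Suc j) \<in> {-pi..pi}"
          using mesh_mem by auto
        then have "(LINT \<omega>|M. dZ N i \<omega> * cnj (dZ N j \<omega>)) =
          line_measure L f ({mesh N i<..mesh N (Suc i)} \<times> {mesh N j<..mesh N (Suc j)})"
          unfolding dZ_def by (intro ZZ) (auto simp: mesh_mono)
        then show "e k (mesh N (Suc i)) * cnj (e m (mesh N (Suc j))) * (LINT \<omega>|M. dZ N i \<omega> * cnj (dZ N j \<omega>)) =
          (\<Sum>b\<in>L. e k (mesh N (Suc i)) * cnj (e m (mesh N (Suc j))) *
          (LBINT \<mu>:{-pi..pi}. indicator ({mesh N i<..mesh N (Suc i)} \<times> {mesh N j<..mesh N (Suc j)}) (Arg (cis (\<mu> + b)), \<mu>) * f b \<mu>))"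
          by (simp add: line_measure_def L sum_distrib_left)
      qed
      also have "\<dots> = (\<Sum>b\<in>L. \<Sum>i<N. \<Sum>j<N. e k (mesh N (Suc i)) * cnj (e m (mesh N (Suc j))) *
          (LBINT \<mu>:{-pi..pi}. indicator ({mesh N i<..mesh N (Suc i)} \<times> {mesh N j<..mesh N (Suc j)}) (Arg (cis (\<mu> + b)), \<mu>) * f b \<mu>))"
        by (subst sum.swap, subst (2) sum.swap, subst sum.swap) (rule sum.cong[OF refl sum.swap])
      also have "\<dots> = (\<Sum>b\<in>L. LBINT \<mu>:{-pi..pi}. G k N b \<mu> * cnj (step_fun (e m) N \<mu>) * f b \<mu>)"
      proof (intro sum.cong refl)
        fix b assume b: "b \<in> L"
        let ?h = "\<lambda>i j \<mu>. (e k (mesh N (Suc i)) * cnj (e m (mesh N (Suc j)))) * (indicator ({mesh N i<..mesh N (Suc i)} \<times> {mesh N j<..mesh N (Suc j)}) (Arg (cis (\<mu> + b)), \<mu>) * f b \<mu>)"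
        have hi: "set_integrable lborel {-pi..pi} (?h i j)" for i j
          by (intro set_integrable_mult_right ind b) (auto intro!: borel_Times)
        have "(LBINT \<mu>:{-pi..pi}. G k N b \<mu> * cnj (step_fun (e m) N \<mu>) * f b \<mu>) = (LBINT \<mu>:{-pi..pi}. \<Sum>i<N. \<Sum>j<N. ?h i j \<mu>)"
        proof (intro set_lebesgue_integral_cong allI impI)
          fix \<mu>
          have c: "cnj (step_fun (e m) N \<mu>) = (\<Sum>j<N. cnj (e m (mesh N (Suc j))) * indicator {mesh N j<..mesh N (Suc j)} \<mu>)"
            unfolding step_fun_def cnj_sum by (intro sum.cong refl) (auto simp: indicator_def)
          show "G k N b \<mu> * cnj (step_fun (e m) N \<mu>) * f b \<mu> = (\<Sum>i<N. \<Sum>j<N. ?h i j \<mu>)"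
            unfolding c unfolding G_def step_fun_def
            unfolding sum_product unfolding sum_distrib_right
            by (intro sum.cong refl) (auto simp: indicator_def)
        qed simp
        also have "\<dots> = (\<Sum>i<N. \<Sum>j<N. LBINT \<mu>:{-pi..pi}. ?h i j \<mu>)"
          using hi unfolding set_lebesgue_integral_def set_integrable_def scaleR_sum_right
          by (subst Bochner_Integration.integral_sum, fastforce intro: Bochner_Integration.integrable_sum)
            (intro sum.cong refl Bochner_Integration.integral_sum, auto)
        finally show "(\<Sum>i<N. \<Sum>j<N. e k (mesh N (Suc i)) * cnj (e m (mesh N (Suc j))) *
          (LBINT \<mu>:{-pi..pi}. indicator ({mesh N i<..mesh N (Suc i)} \<times> {mesh N j<..mesh N (Suc j)}) (Arg (cis (\<mu> + b)), \<mu>) * f b \<mu>)) =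
           (LBINT \<mu>:{-pi..pi}. G k N b \<mu> * cnj (step_fun (e m) N \<mu>) * f b \<mu>)"
          by simp
      qed
      finally show ?thesis .
    qed
    have "(\<lambda>N. \<Sum>b\<in>L. LBINT \<mu>:{-pi..pi}. G k N b \<mu> * cnj (step_fun (e m) N \<mu>) * f b \<mu>)
       \<longlonglongrightarrow> (\<Sum>b\<in>L. LBINT \<mu>:{-pi..pi}. cis (of_int k * b) * (cis (of_int (k - m) * \<mu>) * f b \<mu>))"
    proof (rule tendsto_sum)
      fix b assume b: "b \<in> L"
      have [measurable]: "(\<lambda>x. indicator {-pi..pi} x *\<^sub>R f b x) \<in> borel_measurable borel"
        using fi[OF b] unfolding set_integrable_def by (auto dest: borel_measurable_integrable)
      have pt: "(\<lambda>N. G k N b \<mu> * cnj (step_fun (e m) N \<mu>) * f b \<mu>) \<longlonglongrightarrow> cis (of_int k * b) * (cis (of_int (k - m) * \<mu>) * f b \<mu>)"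
        and bd: "N > 0 \<Longrightarrow> cmod (G k N b \<mu> * cnj (step_fun (e m) N \<mu>) * f b \<mu>) \<le> cmod (f b \<mu>)"
        if mu: "\<mu> \<in> {-pi<..pi}" for \<mu> N
      proof -
        have lim: "(\<lambda>N. step_fun (e k) N x) \<longlonglongrightarrow> cis (of_int k * x)" if "x \<in> {-pi<..pi}" for k x
        proof (rule LIM_zero_cancel, rule Lim_null_comparison)
          show "\<forall>\<^sub>F N in sequentially. norm (step_fun (e k) N x - cis (of_int k * x)) \<le> \<bar>of_int k\<bar> * (2 * pi / real N)"
            using eventually_gt_at_top[of 0] by eventually_elim (use step_fun_cis_approx(2) that in \<open>auto simp: e_def\<close>)
          show "(\<lambda>N. \<bar>of_int k\<bar> * (2 * pi / real N)) \<longlonglongrightarrow> 0" by real_asymp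
        qed
        have A: "Arg (cis (\<mu> + b)) \<in> {-pi<..pi}" using Arg_bounded by auto
        have "(\<lambda>N. G k N b \<mu> * cnj (step_fun (e m) N \<mu>) * f b \<mu>) \<longlonglongrightarrow> cis (of_int k * Arg (cis (\<mu> + b))) * cnj (cis (of_int m * \<mu>)) * f b \<mu>"
          unfolding G_def by (intro tendsto_intros lim A mu)
        also have "cis (of_int k * Arg (cis (\<mu> + b))) * cnj (cis (of_int m * \<mu>)) * f b \<mu> = cis (of_int k * b) * (cis (of_int (k - m) * \<mu>) * f b \<mu>)"
          by (simp add: cis_int_Arg cis_cnj cis_mult algebra_simps)
        finally show "(\<lambda>N. G k N b \<mu> * cnj (step_fun (e m) N \<mu>) * f b \<mu>) \<longlonglongrightarrow> cis (of_int k * b) * (cis (of_int (k - m) * \<mu>) * f b \<mu>)" .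
        show "cmod (G k N b \<mu> * cnj (step_fun (e m) N \<mu>) * f b \<mu>) \<le> cmod (f b \<mu>)" if "N > 0"
        proof -
          have "cmod (G k N b \<mu>) * cmod (step_fun (e m) N \<mu>) \<le> 1 * 1"
            using step_fun_cis_approx(1)[OF that A, of k] step_fun_cis_approx(1)[OF that mu, of m]
            unfolding G_def e_def by (intro mult_mono) auto
          then have "cmod (G k N b \<mu>) * cmod (step_fun (e m) N \<mu>) * cmod (f b \<mu>) \<le> 1 * cmod (f b \<mu>)"
            by (intro mult_right_mono) auto
          then show ?thesis by (simp add: norm_mult)
        qed
      qed
      \<comment> \<open>The half-open cells of the mesh miss the point \<open>-\<pi>\<close>, where the step functions vanish.\<close>
      have ae: "AE \<mu> in lborel. \<mu> \<noteq> (-pi :: real)" by (rule AE_lborel_singleton)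
      have "(\<lambda>N. LBINT \<mu>:{-pi..pi}. G k (Suc N) b \<mu> * cnj (step_fun (e m) (Suc N) \<mu>) * f b \<mu>)
         \<longlonglongrightarrow> (LBINT \<mu>:{-pi..pi}. cis (of_int k * b) * (cis (of_int (k - m) * \<mu>) * f b \<mu>))"
        unfolding set_lebesgue_integral_def
      proof (rule integral_dominated_convergence[where w = "\<lambda>\<mu>. cmod (indicator {-pi..pi} \<mu> *\<^sub>R f b \<mu>)"])
        have "(\<lambda>\<mu>. cis (of_int k * b) * (cis (of_int (k - m) * \<mu>) * (indicator {-pi..pi} \<mu> *\<^sub>R f b \<mu>))) \<in> borel_measurable borel"
          unfolding cis_conv_exp by measurable
        then show "(\<lambda>\<mu>. indicator {-pi..pi} \<mu> *\<^sub>R (cis (of_int k * b) * (cis (of_int (k - m) * \<mu>) * f b \<mu>))) \<in> borel_measurable lborel"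
          by (simp add: scaleR_conv_of_real algebra_simps)
        have "(\<lambda>\<mu>. G k (Suc N) b \<mu> * cnj (step_fun (e m) (Suc N) \<mu>) * (indicator {-pi..pi} \<mu> *\<^sub>R f b \<mu>)) \<in> borel_measurable borel" for N
          unfolding G_def by measurable
        then show "(\<lambda>\<mu>. indicator {-pi..pi} \<mu> *\<^sub>R (G k (Suc N) b \<mu> * cnj (step_fun (e m) (Suc N) \<mu>) * f b \<mu>)) \<in> borel_measurable lborel" for N
          by (simp add: scaleR_conv_of_real algebra_simps)
        show "integrable lborel (\<lambda>\<mu>. cmod (indicator {-pi..pi} \<mu> *\<^sub>R f b \<mu>))"
          using fi[OF b] unfolding set_integrable_def by (rule integrable_norm)
        show "AE \<mu> in lborel. (\<lambda>N. indicator {-pi..pi} \<mu> *\<^sub>R (G k (Suc N) b \<mu> * cnj (step_fun (e m) (Suc N) \<mu>) * f b \<mu>))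
           \<longlonglongrightarrow> indicator {-pi..pi} \<mu> *\<^sub>R (cis (of_int k * b) * (cis (of_int (k - m) * \<mu>) * f b \<mu>))"
          using ae
        proof eventually_elim
          case (elim \<mu>)
          show ?case
          proof (cases "\<mu> \<in> {-pi..pi}")
            case True
            then have "\<mu> \<in> {-pi<..pi}" using elim by auto
            from LIMSEQ_Suc[OF pt[OF this]] True show ?thesis by simp
          qed simp
        qed
        show "AE \<mu> in lborel. norm (indicator {-pi..pi} \<mu> *\<^sub>R (G k (Suc N) b \<mu> * cnj (step_fun (e m) (Suc N) \<mu>) * f b \<mu>)) \<le> cmod (indicator {-pi..pi} \<mu> *\<^sub>R f b \<mu>)" for N
          using ae
        proof eventually_elim
          case (elim \<mu>)
          show ?case
          proof (cases "\<mu> \<in> {-pi..pi}")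
            case True
            then have "\<mu> \<in> {-pi<..pi}" using elim by auto
            from bd[OF this, of "Suc N"] True show ?thesis by simp
          qed simp
        qed
      qed
      then show "(\<lambda>N. LBINT \<mu>:{-pi..pi}. G k N b \<mu> * cnj (step_fun (e m) N \<mu>) * f b \<mu>)
         \<longlonglongrightarrow> (LBINT \<mu>:{-pi..pi}. cis (of_int k * b) * (cis (of_int (k - m) * \<mu>) * f b \<mu>))"
        by (rule LIMSEQ_imp_Suc)
    qed
    also have "(\<Sum>b\<in>L. LBINT \<mu>:{-pi..pi}. cis (of_int k * b) * (cis (of_int (k - m) * \<mu>) * f b \<mu>)) = (\<Sum>b\<in>L. cis (of_int k * b) * line_coeff f b (k - m))"
      by (simp add: line_coeff_def)
    finally show ?thesis
      by (rule Lim_transform_eventually) (use eventually_gt_at_top[of 0] in \<open>eventually_elim, simp add: main\<close>)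
  qed
  ultimately have "(LINT \<omega>|M. complex_of_real (X k \<omega>) * cnj (complex_of_real (X m \<omega>))) = (\<Sum>b\<in>L. cis (of_int k * b) * line_coeff f b (k - m))"
    by (rule LIMSEQ_unique)
  then show ?thesis by (simp flip: of_real_mult)
qed

section \<open>Suprema of random trigonometric polynomials\<close>

lemma weighted_power_mean_4:
  fixes a x :: "nat \<Rightarrow> real"
  assumes a: "\<And>p. 0 \<le> a p"
  shows "(\<Sum>p<n. a p * x p) ^ 4 \<le> (\<Sum>p<n. a p) ^ 3 * (\<Sum>p<n. a p * x p ^ 4)"
proof -
  have cs: "(\<Sum>p<n. a p * y p)\<^sup>2 \<le> (\<Sum>p<n. a p) * (\<Sum>p<n. a p * (y p)\<^sup>2)" for y
    using Cauchy_Schwarz_ineq_sum[of "\<lambda>p. sqrt (a p)" "\<lambda>p. sqrt (a p) * y p" "{..<n}"] a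
    by (simp add: power_mult_distrib flip: mult.assoc)
  have A: "0 \<le> (\<Sum>p<n. a p)" by (intro sum_nonneg a)
  have "(\<Sum>p<n. a p * x p) ^ 4 = ((\<Sum>p<n. a p * x p)\<^sup>2)\<^sup>2" by simp
  also have "\<dots> \<le> ((\<Sum>p<n. a p) * (\<Sum>p<n. a p * (x p)\<^sup>2))\<^sup>2" by (intro power_mono cs) simp
  also have "\<dots> = (\<Sum>p<n. a p)\<^sup>2 * (\<Sum>p<n. a p * (x p)\<^sup>2)\<^sup>2" by (simp add: power_mult_distrib)
  also have "\<dots> \<le> (\<Sum>p<n. a p)\<^sup>2 * ((\<Sum>p<n. a p) * (\<Sum>p<n. a p * ((x p)\<^sup>2)\<^sup>2))"
    by (intro mult_left_mono cs) simp
  also have "\<dots> = (\<Sum>p<n. a p) ^ 3 * (\<Sum>p<n. a p * x p ^ 4)" by (simp add: power2_eq_square power3_eq_cube power4_eq_xxxx mult.assoc)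
  finally show ?thesis .
qed

text \<open>On an interval of length comparable to \<open>1 / N\<close> the supremum of a random trigonometric polynomial of
degree \<open>N\<close> costs only a constant.  Its Taylor series at \<open>v\<close> has terms
\<open>(N (w - v)) ^ p / p!\<close> times \<open>g p\<close>, where \<open>g p\<close> is a combination of the same random coefficients with
weights of modulus at most 1.  Jensen's inequality with the weights \<open>\<rho> ^ p / p!\<close> bounds the fourth
power of the sum by a series \<open>H\<close> that does not depend on \<open>w\<close>.\<close>

lemma random_trig_poly_local_sup:
  fixes A :: "int \<Rightarrow> 'a \<Rightarrow> complex"
  assumes "prob_space M" and A[measurable]: "\<And>k. A k \<in> borel_measurable M" and N: "1 \<le> N" and \<rho>: "0 \<le> \<rho>"
    and int: "\<And>u. (\<And>k. cmod (u k) \<le> 1) \<Longrightarrow> integrable M (\<lambda>\<omega>. cmod (\<Sum>k=-int N..int N. u k * A k \<omega>) ^ 4)"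
    and B: "\<And>u. (\<And>k. cmod (u k) \<le> 1) \<Longrightarrow> (LINT \<omega>|M. cmod (\<Sum>k=-int N..int N. u k * A k \<omega>) ^ 4) \<le> B"
  obtains H where "H \<in> borel_measurable M" "\<And>\<omega>. 0 \<le> H \<omega>" "integrable M H" "(LINT \<omega>|M. H \<omega>) \<le> exp (4 * \<rho>) * B"
    "\<And>\<omega> w. \<bar>w - v\<bar> \<le> \<rho> / real N \<Longrightarrow> cmod (\<Sum>k=-int N..int N. A k \<omega> * cis (- (of_int k * w))) ^ 4 \<le> H \<omega>"
proof -
  define J where "J = {-int N..int N}"
  define u where "u p k = (if k \<in> J then (- \<i> * of_int k / of_nat N) ^ p * cis (- (of_int k * v)) else 0)" for p k
  define g where "g p \<omega> = (\<Sum>k\<in>J. u p k * A k \<omega>)" for p \<omega>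
  define a where "a p = \<rho> ^ p / fact p" for p
  define T where "T \<omega> = (\<Sum>k\<in>J. cmod (A k \<omega>))" for \<omega>
  define H where "H \<omega> = exp \<rho> ^ 3 * (\<Sum>p. a p * cmod (g p \<omega>) ^ 4)" for \<omega>
  have N0: "real N > 0" using N by simp
  have a0: "0 \<le> a p" for p using \<rho> by (simp add: a_def)
  have asum: "a sums exp \<rho>"
    using exp_converges[of \<rho>] by (simp add: a_def[abs_def] divide_inverse mult.commute scaleR_conv_of_real)
  have u1: "cmod (u p k) \<le> 1" for p k
  proof (cases "k \<in> J")
    case True
    then have "\<bar>of_int k\<bar> \<le> real N" unfolding J_def by simp linarith
    then have "\<bar>of_int k\<bar> / real N \<le> 1" using N0 by simp
    then have "(\<bar>of_int k\<bar> / real N) ^ p \<le> 1" by (intro power_le_one) auto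
    then show ?thesis using True by (simp add: u_def norm_mult norm_power norm_divide)
  qed (simp add: u_def)
  have gm[measurable]: "g p \<in> borel_measurable M" for p unfolding g_def[abs_def] by measurable
  have gi: "integrable M (\<lambda>\<omega>. cmod (g p \<omega>) ^ 4)" for p
    unfolding g_def J_def by (rule int) (rule u1)
  have gB: "(LINT \<omega>|M. cmod (g p \<omega>) ^ 4) \<le> B" for p
    unfolding g_def J_def by (rule B) (rule u1)
  have gT: "cmod (g p \<omega>) \<le> T \<omega>" for p \<omega>
    unfolding g_def T_def
  proof (rule sum_norm_le)
    fix k show "cmod (u p k * A k \<omega>) \<le> cmod (A k \<omega>)"
      using mult_right_mono[OF u1[of p k], of "cmod (A k \<omega>)"] by (simp add: norm_mult)
  qed
  have sm: "summable (\<lambda>p. a p * cmod (g p \<omega>) ^ 4)" for \<omega>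
  proof (rule summable_comparison_test'[of "\<lambda>p. a p * T \<omega> ^ 4"])
    show "summable (\<lambda>p. a p * T \<omega> ^ 4)" using asum by (intro summable_mult2) (auto dest: sums_summable)
    fix p show "norm (a p * cmod (g p \<omega>) ^ 4) \<le> a p * T \<omega> ^ 4"
      using a0[of p] gT[of p \<omega>] by (auto simp: abs_mult intro!: mult_left_mono power_mono)
  qed
  have Hm: "H \<in> borel_measurable M" unfolding H_def[abs_def] by measurable
  have H0: "0 \<le> H \<omega>" for \<omega>
    unfolding H_def by (intro mult_nonneg_nonneg suminf_nonneg sm) (auto intro!: mult_nonneg_nonneg a0)
  have sm2: "summable (\<lambda>p. LINT \<omega>|M. norm (a p * cmod (g p \<omega>) ^ 4))"
  proof (rule summable_comparison_test'[of "\<lambda>p. a p * B"])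
    show "summable (\<lambda>p. a p * B)" using asum by (intro summable_mult2) (auto dest: sums_summable)
    fix p
    have "(LINT \<omega>|M. norm (a p * cmod (g p \<omega>) ^ 4)) = a p * (LINT \<omega>|M. cmod (g p \<omega>) ^ 4)"
      using a0 by (simp add: abs_mult)
    also have "\<dots> \<le> a p * B" by (intro mult_left_mono gB a0)
    finally show "norm (LINT \<omega>|M. norm (a p * cmod (g p \<omega>) ^ 4)) \<le> a p * B"
      by (subst real_norm_def, subst abs_of_nonneg) (auto intro!: Bochner_Integration.integral_nonneg)
  qed
  have i1: "integrable M (\<lambda>\<omega>. a p * cmod (g p \<omega>) ^ 4)" for p using gi by simp
  have ae: "AE \<omega> in M. summable (\<lambda>p. norm (a p * cmod (g p \<omega>) ^ 4))"
    using sm a0 by (simp add: abs_mult)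
  have Hi: "integrable M H"
    unfolding H_def[abs_def] by (intro integrable_mult_right integrable_suminf i1 ae sm2)
  have "(LINT \<omega>|M. H \<omega>) = exp \<rho> ^ 3 * (\<Sum>p. LINT \<omega>|M. a p * cmod (g p \<omega>) ^ 4)"
    unfolding H_def by (simp add: integral_suminf[OF i1 ae sm2])
  also have "(\<Sum>p. LINT \<omega>|M. a p * cmod (g p \<omega>) ^ 4) \<le> (\<Sum>p. a p * B)"
  proof (rule suminf_le)
    show "(LINT \<omega>|M. a p * cmod (g p \<omega>) ^ 4) \<le> a p * B" for p
      using mult_left_mono[OF gB a0] by simp
    show "summable (\<lambda>p. LINT \<omega>|M. a p * cmod (g p \<omega>) ^ 4)" using sm2 a0 by (simp add: abs_mult)
    show "summable (\<lambda>p. a p * B)" using asum by (intro summable_mult2) (auto dest: sums_summable)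
  qed
  also have "(\<Sum>p. a p * B) = exp \<rho> * B" using asum by (simp add: sums_iff suminf_mult2[symmetric])
  also have "exp \<rho> ^ 3 * (exp \<rho> * B) = exp (4 * \<rho>) * B"
    by (simp add: power3_eq_cube flip: exp_add mult.assoc)
  finally have EH: "(LINT \<omega>|M. H \<omega>) \<le> exp (4 * \<rho>) * B" by simp
  have bound: "cmod (\<Sum>k\<in>J. A k \<omega> * cis (- (of_int k * w))) ^ 4 \<le> H \<omega>" if w: "\<bar>w - v\<bar> \<le> \<rho> / real N" for \<omega> w
  proof -
    define z where "z = real N * (w - v)"
    have z: "\<bar>z\<bar> \<le> \<rho>" using w N0 by (simp add: z_def abs_mult pos_le_divide_eq mult.commute)
    have s1: "(\<lambda>p. (of_real z ^ p / fact p) * (u p k * A k \<omega>)) sums (A k \<omega> * cis (- (of_int k * w)))" if "k \<in> J" for k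
    proof -
      have "(\<lambda>p. (\<i> * of_real (- (of_int k * (w - v)))) ^ p /\<^sub>R fact p) sums exp (\<i> * of_real (- (of_int k * (w - v))))"
        by (rule exp_converges)
      then have "(\<lambda>p. (cis (- (of_int k * v)) * A k \<omega>) * ((\<i> * of_real (- (of_int k * (w - v)))) ^ p /\<^sub>R fact p)) sums
          ((cis (- (of_int k * v)) * A k \<omega>) * exp (\<i> * of_real (- (of_int k * (w - v)))))"
        by (rule sums_mult)
      also have "(cis (- (of_int k * v)) * A k \<omega>) * exp (\<i> * of_real (- (of_int k * (w - v)))) = A k \<omega> * (cis (- (of_int k * v)) * cis (- (of_int k * (w - v))))"
        unfolding cis_conv_exp by (simp add: algebra_simps)
      also have "cis (- (of_int k * v)) * cis (- (of_int k * (w - v))) = cis (- (of_int k * w))"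
        by (simp add: cis_mult algebra_simps)
      also have "(\<lambda>p. (cis (- (of_int k * v)) * A k \<omega>) * ((\<i> * of_real (- (of_int k * (w - v)))) ^ p /\<^sub>R fact p)) =
         (\<lambda>p. (of_real z ^ p / fact p) * (u p k * A k \<omega>))"
      proof
        fix p
        have "(\<i> * of_real (- (of_int k * (w - v)))) = of_real z * (- \<i> * of_int k / of_nat N)"
          using N0 by (simp add: z_def field_simps)
        then have "(\<i> * of_real (- (of_int k * (w - v)))) ^ p = of_real z ^ p * (- \<i> * of_int k / of_nat N) ^ p"
          by (simp only: power_mult_distrib)
        then show "(cis (- (of_int k * v)) * A k \<omega>) * ((\<i> * of_real (- (of_int k * (w - v)))) ^ p /\<^sub>R fact p) =
            (of_real z ^ p / fact p) * (u p k * A k \<omega>)"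
          using that by (simp add: u_def scaleR_conv_of_real divide_inverse algebra_simps)
      qed
      finally show ?thesis .
    qed
    have s2: "(\<lambda>p. (of_real z ^ p / fact p) * g p \<omega>) sums (\<Sum>k\<in>J. A k \<omega> * cis (- (of_int k * w)))"
      using sums_sum[of J "\<lambda>k p. (of_real z ^ p / fact p) * (u p k * A k \<omega>)", OF s1] by (simp add: g_def sum_distrib_left)
    have part: "cmod (\<Sum>p<n. (of_real z ^ p / fact p) * g p \<omega>) ^ 4 \<le> H \<omega>" for n
    proof -
      have "cmod (\<Sum>p<n. (of_real z ^ p / fact p) * g p \<omega>) \<le> (\<Sum>p<n. a p * cmod (g p \<omega>))"
      proof (rule sum_norm_le)
        fix p
        have "cmod (of_real z ^ p / fact p) \<le> a p"
          unfolding a_def using z by (auto simp: norm_divide norm_power intro!: divide_right_mono power_mono)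
        then show "cmod ((of_real z ^ p / fact p) * g p \<omega>) \<le> a p * cmod (g p \<omega>)"
          by (simp only: norm_mult mult_right_mono norm_ge_zero)
      qed
      then have "cmod (\<Sum>p<n. (of_real z ^ p / fact p) * g p \<omega>) ^ 4 \<le> (\<Sum>p<n. a p * cmod (g p \<omega>)) ^ 4"
        by (rule power_mono) simp
      also have "\<dots> \<le> (\<Sum>p<n. a p) ^ 3 * (\<Sum>p<n. a p * cmod (g p \<omega>) ^ 4)"
        by (rule weighted_power_mean_4[OF a0])
      also have "\<dots> \<le> exp \<rho> ^ 3 * (\<Sum>p. a p * cmod (g p \<omega>) ^ 4)"
      proof (intro mult_mono power_mono)
        show "(\<Sum>p<n. a p) \<le> exp \<rho>" using asum a0 sum_le_suminf[of a "{..<n}"] by (auto simp: sums_iff)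
        show "(\<Sum>p<n. a p * cmod (g p \<omega>) ^ 4) \<le> (\<Sum>p. a p * cmod (g p \<omega>) ^ 4)"
          by (rule sum_le_suminf[OF sm]) (auto intro!: mult_nonneg_nonneg a0)
      qed (auto intro!: sum_nonneg mult_nonneg_nonneg a0)
      finally show ?thesis by (simp add: H_def)
    qed
    have "(\<lambda>n. cmod (\<Sum>p<n. (of_real z ^ p / fact p) * g p \<omega>) ^ 4) \<longlonglongrightarrow> cmod (\<Sum>k\<in>J. A k \<omega> * cis (- (of_int k * w))) ^ 4"
      using s2 unfolding sums_def by (intro tendsto_intros)
    then show ?thesis by (rule LIMSEQ_le_const2) (use part in blast)
  qed
  show ?thesis
    using that[OF Hm H0 Hi EH] bound by (simp add: J_def)
qed

lemma cis_int_periodic: "cis (- (of_int k * (x - 2 * pi * of_int z))) = cis (- (of_int k * x))"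
proof -
  have "cis (- (of_int k * (x - 2 * pi * of_int z))) = cis (- (of_int k * x)) * cis (2 * pi * of_int (k * z))"
    by (simp add: cis_mult algebra_simps)
  moreover have "cis (2 * pi * of_int (k * z)) = 1" by (rule cis_multiple_2pi) simp
  ultimately show ?thesis by simp
qed

text \<open>The circle is covered by \<open>N\<close> intervals of half-length \<open>2 pi / N\<close>, and the sum of the local dominating
functions dominates on the whole circle.\<close>

lemma random_trig_poly_global_sup:
  fixes A :: "int \<Rightarrow> 'a \<Rightarrow> complex"
  assumes M: "prob_space M" and A[measurable]: "\<And>k. A k \<in> borel_measurable M" and N: "1 \<le> N"
    and int: "\<And>u. (\<And>k. cmod (u k) \<le> 1) \<Longrightarrow> integrable M (\<lambda>\<omega>. cmod (\<Sum>k=-int N..int N. u k * A k \<omega>) ^ 4)"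
    and B: "\<And>u. (\<And>k. cmod (u k) \<le> 1) \<Longrightarrow> (LINT \<omega>|M. cmod (\<Sum>k=-int N..int N. u k * A k \<omega>) ^ 4) \<le> B"
  obtains H where "H \<in> borel_measurable M" "\<And>\<omega>. 0 \<le> H \<omega>" "integrable M H" "(LINT \<omega>|M. H \<omega>) \<le> real N * (exp (8 * pi) * B)"
    "\<And>\<omega> w. cmod (\<Sum>k=-int N..int N. A k \<omega> * cis (- (of_int k * w))) ^ 4 \<le> H \<omega>"
proof -
  define v where "v i = - pi + 2 * pi * real i / real N" for i
  have "\<forall>i. \<exists>H. H \<in> borel_measurable M \<and> (\<forall>\<omega>. 0 \<le> H \<omega>) \<and> integrable M H \<and> (LINT \<omega>|M. H \<omega>) \<le> exp (4 * (2 * pi)) * B \<and>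
    (\<forall>\<omega> w. \<bar>w - v i\<bar> \<le> (2 * pi) / real N \<longrightarrow> cmod (\<Sum>k=-int N..int N. A k \<omega> * cis (- (of_int k * w))) ^ 4 \<le> H \<omega>)"
  proof
    fix i
    obtain H where "H \<in> borel_measurable M" "\<And>\<omega>. 0 \<le> H \<omega>" "integrable M H" "(LINT \<omega>|M. H \<omega>) \<le> exp (4 * (2 * pi)) * B"
      "\<And>\<omega> w. \<bar>w - v i\<bar> \<le> (2 * pi) / real N \<Longrightarrow> cmod (\<Sum>k=-int N..int N. A k \<omega> * cis (- (of_int k * w))) ^ 4 \<le> H \<omega>"
      using random_trig_poly_local_sup[OF M A N _ int B, of "2 * pi" "v i"] by auto
    then show "\<exists>H. H \<in> borel_measurable M \<and> (\<forall>\<omega>. 0 \<le> H \<omega>) \<and> integrable M H \<and> (LINT \<omega>|M. H \<omega>) \<le> exp (4 * (2 * pi)) * B \<and>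
      (\<forall>\<omega> w. \<bar>w - v i\<bar> \<le> (2 * pi) / real N \<longrightarrow> cmod (\<Sum>k=-int N..int N. A k \<omega> * cis (- (of_int k * w))) ^ 4 \<le> H \<omega>)"
      by blast
  qed
  from choice[OF this] obtain H where "\<forall>i. H i \<in> borel_measurable M \<and> (\<forall>\<omega>. 0 \<le> H i \<omega>) \<and> integrable M (H i) \<and>
      (LINT \<omega>|M. H i \<omega>) \<le> exp (4 * (2 * pi)) * B \<and>
      (\<forall>\<omega> w. \<bar>w - v i\<bar> \<le> (2 * pi) / real N \<longrightarrow> cmod (\<Sum>k=-int N..int N. A k \<omega> * cis (- (of_int k * w))) ^ 4 \<le> H i \<omega>)"
    by blast
  then have H: "\<And>i. H i \<in> borel_measurable M" "\<And>i \<omega>. 0 \<le> H i \<omega>" "\<And>i. integrable M (H i)"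
    "\<And>i. (LINT \<omega>|M. H i \<omega>) \<le> exp (4 * (2 * pi)) * B"
    "\<And>i \<omega> w. \<bar>w - v i\<bar> \<le> (2 * pi) / real N \<Longrightarrow> cmod (\<Sum>k=-int N..int N. A k \<omega> * cis (- (of_int k * w))) ^ 4 \<le> H i \<omega>"
    by simp_all
  define G where "G \<omega> = (\<Sum>i<N. H i \<omega>)" for \<omega>
  have N0: "real N > 0" using N by simp
  have cover: "cmod (\<Sum>k=-int N..int N. A k \<omega> * cis (- (of_int k * w))) ^ 4 \<le> G \<omega>" if w: "w \<in> {-pi..pi}" for \<omega> w
  proof -
    define y where "y = (w + pi) * real N / (2 * pi)"
    define i where "i = min (nat \<lfloor>y\<rfloor>) (N - 1)"
    have y0: "0 \<le> y" "y \<le> real N"     proof -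
      have "0 \<le> (w + pi) * real N" "(w + pi) * real N \<le> (2 * pi) * real N"
        using w N0 by (auto intro!: mult_nonneg_nonneg mult_right_mono)
      then show "0 \<le> y" "y \<le> real N" by (auto simp: y_def field_simps)
    qed
    have "i < N" using N by (simp add: i_def)
    have "real i \<le> y" "y \<le> real i + 1"
    proof -
      have "real (nat \<lfloor>y\<rfloor>) \<le> y" "y \<le> real (nat \<lfloor>y\<rfloor>) + 1" using y0 by linarith+
      moreover have "y \<le> real (N - 1) + 1" using y0 N by (simp add: of_nat_diff)
      ultimately show "real i \<le> y" "y \<le> real i + 1" by (auto simp: i_def min_def)
    qed
    moreover have "w - v i = (y - real i) * (2 * pi / real N)"
      using N0 by (simp add: v_def y_def field_simps)
    ultimately have "\<bar>w - v i\<bar> \<le> 1 * (2 * pi / real N)"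
      unfolding \<open>w - v i = _\<close> abs_mult using N0 by (intro mult_mono) auto
    then have "cmod (\<Sum>k=-int N..int N. A k \<omega> * cis (- (of_int k * w))) ^ 4 \<le> H i \<omega>" by (intro H) simp
    also have "\<dots> \<le> G \<omega>" unfolding G_def using \<open>i < N\<close> H(2) by (intro member_le_sum) auto
    finally show ?thesis .
  qed
  show ?thesis
  proof (rule that[of G])
    show "G \<in> borel_measurable M" unfolding G_def[abs_def] using H(1) by measurable
    show "0 \<le> G \<omega>" for \<omega> unfolding G_def by (intro sum_nonneg H)
    show "integrable M G" unfolding G_def[abs_def] by (intro Bochner_Integration.integrable_sum H)
    have "(LINT \<omega>|M. G \<omega>) = (\<Sum>i<N. LINT \<omega>|M. H i \<omega>)"
      unfolding G_def by (intro Bochner_Integration.integral_sum H)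
    also have "\<dots> \<le> (\<Sum>i<N. exp (4 * (2 * pi)) * B)" by (intro sum_mono H)
    finally show "(LINT \<omega>|M. G \<omega>) \<le> real N * (exp (8 * pi) * B)" by simp
    show "cmod (\<Sum>k=-int N..int N. A k \<omega> * cis (- (of_int k * w))) ^ 4 \<le> G \<omega>" for \<omega> w
    proof -
      obtain z :: int where "Arg (cis w) = w - 2 * pi * of_int z" using Arg_cis_exists by blast
      then have "w - 2 * pi * of_int z \<in> {-pi..pi}" using Arg_bounded[of "cis w"] by auto
      from cover[OF this, of \<omega>] show ?thesis by (simp only: cis_int_periodic)
    qed
  qed
qed

section \<open>Periodogram statistics along a line\<close>

text \<open>Weak dependence enters the moment bounds through the summability of the covariances.\<close>

locale summable_gaussian = centred_gaussian M X
  for M :: "'a measure" and X :: "int \<Rightarrow> 'a \<Rightarrow> real" +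
  fixes R :: real
  assumes row_sums: "finite J \<Longrightarrow> (\<Sum>j\<in>J. \<bar>covar i j\<bar>) \<le> R"
begin

lemma R_nonneg: "0 \<le> R"
  using row_sums[of "{}"] by simp

text \<open>The real and the imaginary part of the coefficients give real quadratic forms; the factor 2 in
\<open>(a\<^sup>2 + b\<^sup>2)\<^sup>2 \<le> 2 a ^ 4 + 2 b ^ 4\<close> doubles the constant 169.\<close>

lemma complex_quadratic_fourth_moment:
  fixes q :: "int \<Rightarrow> int \<Rightarrow> complex"
  assumes J: "finite J"
  defines "Q \<equiv> (\<lambda>\<omega>. \<Sum>i\<in>J. \<Sum>j\<in>J. q i j * of_real (X i \<omega> * X j \<omega> - covar i j))"
  shows "integrable M (\<lambda>\<omega>. cmod (Q \<omega>) ^ 4)"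
    and "expectation (\<lambda>\<omega>. cmod (Q \<omega>) ^ 4) \<le> 338 * R ^ 4 * (\<Sum>i\<in>J. \<Sum>j\<in>J. (cmod (q i j))\<^sup>2)\<^sup>2"
proof -
  define qr qi where "qr i j = Re (q i j)" and "qi i j = Im (q i j)" for i j
  have Re: "Re (Q \<omega>) = cquad J qr \<omega>" and Im: "Im (Q \<omega>) = cquad J qi \<omega>" for \<omega>
    by (simp_all add: Q_def cquad_def qr_def qi_def)
  note am = all_moments_integrable all_moments_intros cquad_all_moments[OF J]
  have Qm[measurable]: "Q \<in> borel_measurable M" unfolding Q_def by measurable
  have le: "cmod (Q \<omega>) ^ 4 \<le> 2 * cquad J qr \<omega> ^ 4 + 2 * cquad J qi \<omega> ^ 4" for \<omega>
  proof -
    have "cmod (Q \<omega>) ^ 4 = ((cmod (Q \<omega>))\<^sup>2)\<^sup>2" by simp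
    also have "\<dots> = ((cquad J qr \<omega>)\<^sup>2 + (cquad J qi \<omega>)\<^sup>2)\<^sup>2" by (simp only: cmod_power2 Re Im)
    also have "\<dots> \<le> 2 * ((cquad J qr \<omega>)\<^sup>2)\<^sup>2 + 2 * ((cquad J qi \<omega>)\<^sup>2)\<^sup>2"
      using sum_squares_bound[of "(cquad J qr \<omega>)\<^sup>2" "(cquad J qi \<omega>)\<^sup>2"] by (simp add: power2_sum)
    finally show ?thesis by simp
  qed
  have i: "integrable M (\<lambda>\<omega>. 2 * cquad J qr \<omega> ^ 4 + 2 * cquad J qi \<omega> ^ 4)" by (intro am)
  show I: "integrable M (\<lambda>\<omega>. cmod (Q \<omega>) ^ 4)"
  proof (rule Bochner_Integration.integrable_bound[OF i])
    show "AE \<omega> in M. norm (cmod (Q \<omega>) ^ 4) \<le> norm (2 * cquad J qr \<omega> ^ 4 + 2 * cquad J qi \<omega> ^ 4)"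
      using le by (intro always_eventually allI) (simp add: order_trans[OF le abs_ge_self])
  qed measurable
  have S: "(\<Sum>i\<in>J. \<Sum>j\<in>J. (p i j)\<^sup>2)\<^sup>2 \<le> (\<Sum>i\<in>J. \<Sum>j\<in>J. (cmod (q i j))\<^sup>2)\<^sup>2" if "\<And>i j. (p i j)\<^sup>2 \<le> (cmod (q i j))\<^sup>2" for p :: "int \<Rightarrow> int \<Rightarrow> real"
    by (rule power_mono) (intro sum_mono that, intro sum_nonneg, simp)
  have "expectation (\<lambda>\<omega>. cmod (Q \<omega>) ^ 4) \<le> expectation (\<lambda>\<omega>. 2 * cquad J qr \<omega> ^ 4 + 2 * cquad J qi \<omega> ^ 4)"
    by (intro integral_mono I i le)
  also have "\<dots> = 2 * expectation (\<lambda>\<omega>. cquad J qr \<omega> ^ 4) + 2 * expectation (\<lambda>\<omega>. cquad J qi \<omega> ^ 4)"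
    by (subst Bochner_Integration.integral_add) (intro am | simp)+
  also have "\<dots> \<le> 2 * (169 * R ^ 4 * (\<Sum>i\<in>J. \<Sum>j\<in>J. (qr i j)\<^sup>2)\<^sup>2) + 2 * (169 * R ^ 4 * (\<Sum>i\<in>J. \<Sum>j\<in>J. (qi i j)\<^sup>2)\<^sup>2)"
    by (intro add_mono mult_left_mono cquad_fourth_moment_le J row_sums R_nonneg) auto
  also have "\<dots> = 338 * R ^ 4 * ((\<Sum>i\<in>J. \<Sum>j\<in>J. (qr i j)\<^sup>2)\<^sup>2 + (\<Sum>i\<in>J. \<Sum>j\<in>J. (qi i j)\<^sup>2)\<^sup>2)"
    by (simp add: algebra_simps)
  also have "\<dots> \<le> 338 * R ^ 4 * (\<Sum>i\<in>J. \<Sum>j\<in>J. (cmod (q i j))\<^sup>2)\<^sup>2"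
  proof (intro mult_left_mono)
    define a b where "a = (\<Sum>i\<in>J. \<Sum>j\<in>J. (qr i j)\<^sup>2)" and "b = (\<Sum>i\<in>J. \<Sum>j\<in>J. (qi i j)\<^sup>2)"
    have "0 \<le> a" "0 \<le> b" by (auto simp: a_def b_def intro!: sum_nonneg)
    then have "a\<^sup>2 + b\<^sup>2 \<le> (a + b)\<^sup>2" by (simp add: power2_sum)
    also have "a + b = (\<Sum>i\<in>J. \<Sum>j\<in>J. (cmod (q i j))\<^sup>2)"
      unfolding cmod_power2 a_def b_def qr_def qi_def by (simp add: sum.distrib)
    finally show "(\<Sum>i\<in>J. \<Sum>j\<in>J. (qr i j)\<^sup>2)\<^sup>2 + (\<Sum>i\<in>J. \<Sum>j\<in>J. (qi i j)\<^sup>2)\<^sup>2 \<le> (\<Sum>i\<in>J. \<Sum>j\<in>J. (cmod (q i j))\<^sup>2)\<^sup>2"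
      by (simp add: a_def b_def)
  qed simp
  finally show "expectation (\<lambda>\<omega>. cmod (Q \<omega>) ^ 4) \<le> 338 * R ^ 4 * (\<Sum>i\<in>J. \<Sum>j\<in>J. (cmod (q i j))\<^sup>2)\<^sup>2" .
qed

text \<open>The periodogram \<open>I (\<mu> + w, \<mu>)\<close> integrated over \<open>\<mu>\<close> against a function with Fourier coefficients \<open>\<kappa>\<close>,
where \<open>n = 2 N\<close>; see \<open>smoothed_periodogram\<close>.  Both \<open>U_stat\<close> and \<open>fhat\<close> have this form, so that
one set of moment bounds covers the two.  As a function of \<open>w\<close> it is a trigonometric polynomial of
degree \<open>N\<close>.\<close>

definition line_stat :: "(int \<Rightarrow> complex) \<Rightarrow> nat \<Rightarrow> real \<Rightarrow> 'a \<Rightarrow> complex" where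
  "line_stat \<kappa> N w \<omega> = (\<Sum>k=-int N..int N. \<Sum>m=-int N..int N.
     \<kappa> (k - m) * of_real (X k \<omega> * X m \<omega>) * cis (- (of_int k * w))) / (2 * pi * (2 * N + 1))"

definition line_stat_mean :: "(int \<Rightarrow> complex) \<Rightarrow> nat \<Rightarrow> real \<Rightarrow> complex" where
  "line_stat_mean \<kappa> N w = (\<Sum>k=-int N..int N. \<Sum>m=-int N..int N.
     \<kappa> (k - m) * of_real (covar k m) * cis (- (of_int k * w))) / (2 * pi * (2 * N + 1))"

definition line_stat_coeff :: "(int \<Rightarrow> complex) \<Rightarrow> nat \<Rightarrow> int \<Rightarrow> 'a \<Rightarrow> complex" where
  "line_stat_coeff \<kappa> N k \<omega> = (\<Sum>m=-int N..int N. \<kappa> (k - m) / (2 * pi * (2 * N + 1)) * of_real (X k \<omega> * X m \<omega> - covar k m))"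

lemma line_stat_coeff_measurable[measurable]: "line_stat_coeff \<kappa> N k \<in> borel_measurable M"
  unfolding line_stat_coeff_def[abs_def] by measurable

lemma line_stat_minus_mean:
  "line_stat \<kappa> N w \<omega> - line_stat_mean \<kappa> N w = (\<Sum>k=-int N..int N. line_stat_coeff \<kappa> N k \<omega> * cis (- (of_int k * w)))"
proof -
  define d :: complex where "d = 2 * pi * (2 * N + 1)"
  have "line_stat \<kappa> N w \<omega> - line_stat_mean \<kappa> N w = (\<Sum>k=-int N..int N. \<Sum>m=-int N..int N.
     (\<kappa> (k - m) * of_real (X k \<omega> * X m \<omega>) * cis (- (of_int k * w)) - \<kappa> (k - m) * of_real (covar k m) * cis (- (of_int k * w))) / d)"
    unfolding line_stat_def line_stat_mean_def d_def[symmetric]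
    by (simp only: sum_subtractf diff_divide_distrib sum_divide_distrib)
  also have "\<dots> = (\<Sum>k=-int N..int N. \<Sum>m=-int N..int N.
      \<kappa> (k - m) / d * of_real (X k \<omega> * X m \<omega> - covar k m) * cis (- (of_int k * w)))"
  proof (intro sum.cong refl)
    fix k m
    have "(a * x * c - a * y * c) / d = a / d * (x - y) * c" for a x y c :: complex
      by (simp add: left_diff_distrib right_diff_distrib diff_divide_distrib)
    then show "(\<kappa> (k - m) * of_real (X k \<omega> * X m \<omega>) * cis (- (of_int k * w)) - \<kappa> (k - m) * of_real (covar k m) * cis (- (of_int k * w))) / d =
       \<kappa> (k - m) / d * of_real (X k \<omega> * X m \<omega> - covar k m) * cis (- (of_int k * w))"
      by (simp only: of_real_diff)
  qed
  also have "\<dots> = (\<Sum>k=-int N..int N. line_stat_coeff \<kappa> N k \<omega> * cis (- (of_int k * w)))"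
    unfolding line_stat_coeff_def d_def[symmetric] sum_distrib_right ..
  finally show ?thesis .
qed

text \<open>Multiplying the random coefficients by weights of modulus at most 1 does not increase the
Hilbert--Schmidt norm of the quadratic form, which is of order \<open>S / N\<close>.\<close>

lemma line_stat_coeff_fourth_moment:
  assumes \<kappa>: "\<And>k. (\<Sum>m=-int N..int N. (cmod (\<kappa> (k - m)))\<^sup>2) \<le> S" and u: "\<And>k. cmod (u k) \<le> 1"
  shows "integrable M (\<lambda>\<omega>. cmod (\<Sum>k=-int N..int N. u k * line_stat_coeff \<kappa> N k \<omega>) ^ 4)"
    and "expectation (\<lambda>\<omega>. cmod (\<Sum>k=-int N..int N. u k * line_stat_coeff \<kappa> N k \<omega>) ^ 4) \<le> 338 * R ^ 4 * (S / (2 * real N + 1))\<^sup>2"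
proof -
  define J where "J = {-int N..int N}"
  define c where "c = 2 * pi * (2 * real N + 1)"
  define q where "q k m = u k * \<kappa> (k - m) / of_real c" for k m
  have c1: "1 \<le> 2 * pi" using pi_ge_two by simp
  have c: "2 * real N + 1 \<le> c" using mult_right_mono[OF c1, of "2 * real N + 1"] by (simp add: c_def)
  have eq: "(\<Sum>k=-int N..int N. u k * line_stat_coeff \<kappa> N k \<omega>) = (\<Sum>k\<in>J. \<Sum>m\<in>J. q k m * of_real (X k \<omega> * X m \<omega> - covar k m))" for \<omega>
  proof -
    have c': "complex_of_real c = 2 * pi * (2 * N + 1)" by (simp add: c_def)
    show ?thesis
      unfolding line_stat_coeff_def q_def J_def c' sum_distrib_left
      by (intro sum.cong refl) (simp only: times_divide_eq_right times_divide_eq_left mult.assoc)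
  qed
  have J: "finite J" by (simp add: J_def)
  show "integrable M (\<lambda>\<omega>. cmod (\<Sum>k=-int N..int N. u k * line_stat_coeff \<kappa> N k \<omega>) ^ 4)"
    unfolding eq by (rule complex_quadratic_fourth_moment[OF J])
  have "expectation (\<lambda>\<omega>. cmod (\<Sum>k=-int N..int N. u k * line_stat_coeff \<kappa> N k \<omega>) ^ 4) \<le> 338 * R ^ 4 * (\<Sum>k\<in>J. \<Sum>m\<in>J. (cmod (q k m))\<^sup>2)\<^sup>2"
    unfolding eq by (rule complex_quadratic_fourth_moment[OF J])
  also have "\<dots> \<le> 338 * R ^ 4 * (S / (2 * real N + 1))\<^sup>2"
  proof (intro mult_left_mono power_mono)
    have S0: "0 \<le> S" using \<kappa>[of 0] by (rule order_trans[rotated]) (auto intro!: sum_nonneg)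
    have "(\<Sum>k\<in>J. \<Sum>m\<in>J. (cmod (q k m))\<^sup>2) \<le> (\<Sum>k\<in>J. \<Sum>m\<in>J. (cmod (\<kappa> (k - m)))\<^sup>2 / (2 * real N + 1)\<^sup>2)"
    proof (intro sum_mono)
      fix k m
      have "cmod (q k m) \<le> cmod (\<kappa> (k - m)) / (2 * real N + 1)"
        unfolding q_def norm_divide norm_mult using u[of k] c
        by (intro frac_le mult_left_le_one_le) auto
      then have "(cmod (q k m))\<^sup>2 \<le> (cmod (\<kappa> (k - m)) / (2 * real N + 1))\<^sup>2" by (intro power_mono) auto
      then show "(cmod (q k m))\<^sup>2 \<le> (cmod (\<kappa> (k - m)))\<^sup>2 / (2 * real N + 1)\<^sup>2" by (simp add: power_divide)
    qed
    also have "\<dots> = (\<Sum>k\<in>J. (\<Sum>m\<in>J. (cmod (\<kappa> (k - m)))\<^sup>2)) / (2 * real N + 1)\<^sup>2" by (simp add: sum_divide_distrib)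
    also have "\<dots> \<le> (\<Sum>k\<in>J. S) / (2 * real N + 1)\<^sup>2"
      unfolding J_def by (intro divide_right_mono sum_mono \<kappa>) auto
    also have "\<dots> = S / (2 * real N + 1)" by (simp add: J_def power2_eq_square)
    finally show "(\<Sum>k\<in>J. \<Sum>m\<in>J. (cmod (q k m))\<^sup>2) \<le> S / (2 * real N + 1)" .
  qed (auto intro!: sum_nonneg)
  finally show "expectation (\<lambda>\<omega>. cmod (\<Sum>k=-int N..int N. u k * line_stat_coeff \<kappa> N k \<omega>) ^ 4) \<le> 338 * R ^ 4 * (S / (2 * real N + 1))\<^sup>2" .
qed

lemma line_stat_local_sup:
  assumes "\<And>k. (\<Sum>m=-int N..int N. (cmod (\<kappa> (k - m)))\<^sup>2) \<le> S" "1 \<le> N" "0 \<le> \<rho>"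
  obtains H where "H \<in> borel_measurable M" "\<And>\<omega>. 0 \<le> H \<omega>" "integrable M H"
    "expectation H \<le> exp (4 * \<rho>) * (338 * R ^ 4 * (S / (2 * real N + 1))\<^sup>2)"
    "\<And>\<omega> w. \<bar>w - v\<bar> \<le> \<rho> / real N \<Longrightarrow> cmod (line_stat \<kappa> N w \<omega> - line_stat_mean \<kappa> N w) ^ 4 \<le> H \<omega>"
  using random_trig_poly_local_sup[OF prob_space_axioms line_stat_coeff_measurable assms(2,3)
      line_stat_coeff_fourth_moment(1)[OF assms(1)] line_stat_coeff_fourth_moment(2)[OF assms(1)], of v]
  unfolding line_stat_minus_mean by auto

lemma line_stat_global_sup:
  assumes "\<And>k. (\<Sum>m=-int N..int N. (cmod (\<kappa> (k - m)))\<^sup>2) \<le> S" "1 \<le> N"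
  obtains H where "H \<in> borel_measurable M" "\<And>\<omega>. 0 \<le> H \<omega>" "integrable M H"
    "expectation H \<le> real N * (exp (8 * pi) * (338 * R ^ 4 * (S / (2 * real N + 1))\<^sup>2))"
    "\<And>\<omega> w. cmod (line_stat \<kappa> N w \<omega> - line_stat_mean \<kappa> N w) ^ 4 \<le> H \<omega>"
  using random_trig_poly_global_sup[OF prob_space_axioms line_stat_coeff_measurable assms(2)
      line_stat_coeff_fourth_moment(1)[OF assms(1)] line_stat_coeff_fourth_moment(2)[OF assms(1)]]
  unfolding line_stat_minus_mean by auto

lemma line_stat_measurable:
  assumes [measurable]: "w \<in> borel_measurable M"
  shows "(\<lambda>\<omega>. line_stat \<kappa> N (w \<omega>) \<omega>) \<in> borel_measurable M"
proof -
  have [measurable]: "(\<lambda>\<omega>. cis (- (of_int k * w \<omega>))) \<in> borel_measurable M" for k :: int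
    unfolding cis_conv_exp by measurable
  show ?thesis unfolding line_stat_def by measurable
qed

lemma line_stat_mean_bounded:
  assumes "\<And>j. cmod (\<kappa> j) \<le> 1"
  shows "cmod (line_stat_mean \<kappa> N w) \<le> R"
proof -
  have c1: "1 \<le> 2 * pi" using pi_ge_two by simp
  have "cmod (\<Sum>k=-int N..int N. \<Sum>m=-int N..int N. \<kappa> (k - m) * of_real (covar k m) * cis (- (of_int k * w)))
     \<le> (\<Sum>k=-int N..int N. \<Sum>m=-int N..int N. \<bar>covar k m\<bar>)"
  proof (intro sum_norm_le)
    fix k m
    have "cmod (\<kappa> (k - m)) * \<bar>covar k m\<bar> \<le> 1 * \<bar>covar k m\<bar>" by (intro mult_right_mono assms) simp
    then show "cmod (\<kappa> (k - m) * of_real (covar k m) * cis (- (of_int k * w))) \<le> \<bar>covar k m\<bar>"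
      by (simp add: norm_mult)
  qed
  also have "\<dots> \<le> (\<Sum>k=-int N..int N. R)" by (intro sum_mono row_sums) auto
  also have "\<dots> = 1 * ((2 * real N + 1) * R)" by simp
  also have "\<dots> \<le> 2 * pi * ((2 * real N + 1) * R)" using c1 R_nonneg by (intro mult_right_mono) auto
  finally have *: "cmod (\<Sum>k=-int N..int N. \<Sum>m=-int N..int N. \<kappa> (k - m) * of_real (covar k m) * cis (- (of_int k * w)))
     \<le> R * (2 * pi * (2 * real N + 1))" by (simp add: algebra_simps)
  have "cmod (line_stat_mean \<kappa> N w) = cmod (\<Sum>k=-int N..int N. \<Sum>m=-int N..int N. \<kappa> (k - m) * of_real (covar k m) * cis (- (of_int k * w))) / (2 * pi * (2 * real N + 1))"
  proof -
    have "cmod (of_nat (2 * N + 1)) = 2 * real N + 1" unfolding norm_of_nat by simp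
    then show ?thesis by (simp add: line_stat_mean_def norm_divide norm_mult)
  qed
  also have "\<dots> \<le> R" by (rule mult_imp_div_pos_le[OF _ *]) simp
  finally show ?thesis .
qed

end

section \<open>Exponential sums over differences of times\<close>

text \<open>The expectation of \<open>line_stat\<close> is a superposition of such sums: a line \<open>b\<close> contributes the sum at
\<open>x = b - w\<close>, with \<open>d\<close> the product of the covariance coefficients of the line and \<open>\<kappa>\<close>.\<close>

definition diff_sum :: "(int \<Rightarrow> complex) \<Rightarrow> nat \<Rightarrow> real \<Rightarrow> complex" where
  "diff_sum d N x = (\<Sum>k=-int N..int N. \<Sum>m=-int N..int N. cis (of_int k * x) * d (k - m))"

text \<open>Summation along the diagonals \<open>k - m = j\<close>.\<close>

lemma double_sum_diff:
  fixes g :: "int \<Rightarrow> int \<Rightarrow> complex"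
  shows "(\<Sum>k=-n..n. \<Sum>m=-n..n. g k (k - m)) = (\<Sum>j=-(2*n)..2*n. \<Sum>k=max (-n) (j-n)..min n (n+j). g k j)"
proof -
  have "(\<Sum>k=-n..n. \<Sum>m=-n..n. g k (k - m)) = (\<Sum>(k, m)\<in>{-n..n} \<times> {-n..n}. g k (k - m))"
    by (simp add: sum.cartesian_product)
  also have "\<dots> = (\<Sum>(j, k)\<in>(SIGMA j:{-(2*n)..2*n}. {max (-n) (j-n)..min n (n+j)}). g k j)"
    by (rule sum.reindex_bij_witness[of _ "\<lambda>(j, k). (k, k - j)" "\<lambda>(k, m). (k - m, k)"]) auto
  also have "\<dots> = (\<Sum>j=-(2*n)..2*n. \<Sum>k=max (-n) (j-n)..min n (n+j). g k j)"
    by (simp add: sum.Sigma)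
  finally show ?thesis .
qed

lemma diff_sum_off_peak:
  assumes C: "\<And>J. finite J \<Longrightarrow> (\<Sum>j\<in>J. cmod (d j)) \<le> C"
  shows "cmod (diff_sum d N x) * \<bar>sin (x / 2)\<bar> \<le> C"
proof -
  have "diff_sum d N x = (\<Sum>j=-(2*int N)..2*int N. d j * (\<Sum>k=max (-int N) (j-int N)..min (int N) (int N+j). cis (of_int k * x)))"
    unfolding diff_sum_def by (subst double_sum_diff) (simp add: sum_distrib_left mult.commute)
  then have "cmod (diff_sum d N x) * \<bar>sin (x / 2)\<bar> \<le>
    (\<Sum>j=-(2*int N)..2*int N. cmod (d j) * cmod (\<Sum>k=max (-int N) (j-int N)..min (int N) (int N+j). cis (of_int k * x))) * \<bar>sin (x / 2)\<bar>"
    by (simp only:) (intro mult_right_mono sum_norm_le, simp_all add: norm_mult)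
  also have "\<dots> = (\<Sum>j=-(2*int N)..2*int N. cmod (d j) * (cmod (\<Sum>k=max (-int N) (j-int N)..min (int N) (int N+j). cis (of_int k * x)) * \<bar>sin (x / 2)\<bar>))"
    by (simp add: sum_distrib_right mult.assoc)
  also have "\<dots> \<le> (\<Sum>j=-(2*int N)..2*int N. cmod (d j) * 1)"
    by (intro sum_mono mult_left_mono cis_sum_bound) simp
  also have "\<dots> \<le> C" using C by simp
  finally show ?thesis .
qed

text \<open>The sine is odd, so the sum over the symmetric window vanishes, and the diagonal \<open>k - m = j\<close> misses
at most \<open>|j|\<close> indices of the window.\<close>

lemma truncated_sine_sum:
  fixes x :: real
  assumes "\<bar>j\<bar> \<le> 2 * int N"
  shows "\<bar>\<Sum>k=max (-int N) (j-int N)..min (int N) (int N+j). sin (of_int k * x)\<bar> \<le> of_int \<bar>j\<bar>"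
proof -
  define I where "I = {max (-int N) (j-int N)..min (int N) (int N+j)}"
  define K where "K = {-int N..int N} - I"
  have sub: "I \<subseteq> {-int N..int N}" by (auto simp: I_def)
  have "K = (if 0 \<le> j then {-int N..j - int N - 1} else {int N + j + 1..int N})"
    using assms by (auto simp: K_def I_def)
  then have card: "card K \<le> nat \<bar>j\<bar>" by simp
  have "(\<Sum>k\<in>I. sin (of_int k * x)) + (\<Sum>k\<in>K. sin (of_int k * x)) = (\<Sum>k=-int N..int N. sin (of_int k * x))"
    unfolding K_def using sub sum.subset_diff[of I "{-int N..int N}" "\<lambda>k. sin (of_int k * x)"] by simp
  also have "\<dots> = 0" by (rule sum_symmetric_odd) simp
  finally have "\<bar>\<Sum>k\<in>I. sin (of_int k * x)\<bar> = \<bar>\<Sum>k\<in>K. sin (of_int k * x)\<bar>" by linarith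
  also have "\<dots> \<le> (\<Sum>k\<in>K. 1)" by (rule order_trans[OF sum_abs sum_mono]) auto
  also have "\<dots> = real (card K)" by simp
  also have "\<dots> \<le> real (nat \<bar>j\<bar>)" using card by simp
  also have "\<dots> = of_int \<bar>j\<bar>" by simp
  finally show ?thesis by (simp add: I_def)
qed

text \<open>The cosine part of \<open>cis (k x) - 1\<close> is of second order in \<open>N x\<close>.  The sine part, which is of first
order, cancels up to the boundary effect of \<open>truncated_sine_sum\<close>.\<close>

lemma diff_sum_near_peak:
  assumes C: "\<And>J. finite J \<Longrightarrow> (\<Sum>j\<in>J. cmod (d j)) \<le> C"
  shows "cmod (diff_sum d N x - diff_sum d N 0) \<le>
    (2 * real N + 1) * (C * (real N * x)\<^sup>2 / 2) + (\<Sum>j=-(2*int N)..2*int N. \<bar>of_int j\<bar> * cmod (d j))"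
proof -
  define P where "P = (\<Sum>k=-int N..int N. \<Sum>m=-int N..int N. of_real (cos (of_int k * x) - 1) * d (k - m))"
  define Q where "Q = (\<Sum>k=-int N..int N. \<Sum>m=-int N..int N. of_real (sin (of_int k * x)) * d (k - m))"
  have "cis (of_int k * x) * z - cis (of_int k * 0) * z = of_real (cos (of_int k * x) - 1) * z + \<i> * (of_real (sin (of_int k * x)) * z)" for k z
    by (simp add: cis.ctr complex_eq_iff algebra_simps)
  then have eq: "diff_sum d N x - diff_sum d N 0 = P + \<i> * Q"
    unfolding diff_sum_def P_def Q_def sum_subtractf[symmetric] sum_distrib_left sum.distrib[symmetric] by (intro sum.cong refl) blast
  have "cmod P \<le> (\<Sum>k=-int N..int N. \<Sum>m=-int N..int N. (real N * x)\<^sup>2 / 2 * cmod (d (k - m)))"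
    unfolding P_def
  proof (intro sum_norm_le)
    fix k m assume "k \<in> {-int N..int N}"
    then have "\<bar>of_int k\<bar> \<le> real N" by simp linarith
    then have "\<bar>of_int k * x\<bar> \<le> \<bar>real N * x\<bar>" unfolding abs_mult by (intro mult_right_mono) auto
    then have "(of_int k * x)\<^sup>2 \<le> (real N * x)\<^sup>2" by (simp only: abs_le_square_iff)
    then have "\<bar>cos (of_int k * x) - 1\<bar> \<le> (real N * x)\<^sup>2 / 2"
      using one_minus_cos_le[of "of_int k * x"] cos_le_one[of "of_int k * x"] by linarith
    then show "cmod (of_real (cos (of_int k * x) - 1) * d (k - m)) \<le> (real N * x)\<^sup>2 / 2 * cmod (d (k - m))"
      unfolding norm_mult norm_of_real by (rule mult_right_mono) simp
  qed
  also have "\<dots> = (\<Sum>k=-int N..int N. (real N * x)\<^sup>2 / 2 * (\<Sum>m=-int N..int N. cmod (d (k - m))))"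
    by (simp only: sum_distrib_left)
  also have "\<dots> \<le> (\<Sum>k=-int N..int N. (real N * x)\<^sup>2 / 2 * C)"
  proof (intro sum_mono mult_left_mono)
    fix k
    have "(\<Sum>m=-int N..int N. cmod (d (k - m))) = (\<Sum>j\<in>(\<lambda>m. k - m) ` {-int N..int N}. cmod (d j))"
      by (subst sum.reindex) (auto simp: inj_on_def)
    also have "\<dots> \<le> C" by (rule C) simp
    finally show "(\<Sum>m=-int N..int N. cmod (d (k - m))) \<le> C" .
  qed simp
  finally have P: "cmod P \<le> (2 * real N + 1) * (C * (real N * x)\<^sup>2 / 2)" by (simp add: algebra_simps)
  have "Q = (\<Sum>j=-(2*int N)..2*int N. of_real (\<Sum>k=max (-int N) (j-int N)..min (int N) (int N+j). sin (of_int k * x)) * d j)"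
    unfolding Q_def by (subst double_sum_diff) (simp add: sum_distrib_right)
  also have "cmod \<dots> \<le> (\<Sum>j=-(2*int N)..2*int N. \<bar>of_int j\<bar> * cmod (d j))"
  proof (intro sum_norm_le)
    fix j assume "j \<in> {-(2*int N)..2*int N}"
    then have "\<bar>\<Sum>k=max (-int N) (j-int N)..min (int N) (int N+j). sin (of_int k * x)\<bar> \<le> \<bar>of_int j\<bar>"
      using truncated_sine_sum[of j N x] by auto
    then show "cmod (of_real (\<Sum>k=max (-int N) (j-int N)..min (int N) (int N+j). sin (of_int k * x)) * d j) \<le> \<bar>of_int j\<bar> * cmod (d j)"
      unfolding norm_mult norm_of_real by (rule mult_right_mono) simp
  qed
  finally have Q: "cmod Q \<le> (\<Sum>j=-(2*int N)..2*int N. \<bar>of_int j\<bar> * cmod (d j))" .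
  have "cmod (diff_sum d N x - diff_sum d N 0) \<le> cmod P + cmod Q"
    unfolding eq using norm_triangle_ineq[of P "\<i> * Q"] by (simp add: norm_mult)
  then show ?thesis using P Q by linarith
qed

section \<open>Localisation of a line by the procedure\<close>

lemma torus_dist_representative: "\<exists>z::int. torus_dist x y = \<bar>x - y - 2 * pi * of_int z\<bar>"
  unfolding torus_dist_def using Arg_cis_exists[of "x - y"] by fastforce

lemma torus_dist_le: "torus_dist x y \<le> \<bar>x - y - 2 * pi * of_int z\<bar>"
proof -
  obtain k :: int where k: "Arg (cis (x - y)) = x - y - 2 * pi * of_int k" using Arg_cis_exists by blast
  have b: "\<bar>Arg (cis (x - y))\<bar> \<le> pi" using Arg_bounded[of "cis (x - y)"] by auto
  show ?thesis
  proof (cases "z = k")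
    case False
    define u where "u = Arg (cis (x - y))"
    have e: "x - y - 2 * pi * of_int z = u + 2 * pi * of_int (k - z)"
      using k by (simp add: u_def algebra_simps)
    have "1 \<le> \<bar>real_of_int (k - z)\<bar>" using False by (cases "k < z") auto
    then have "2 * pi * 1 \<le> 2 * pi * \<bar>real_of_int (k - z)\<bar>" by (intro mult_left_mono) auto
    then have "2 * pi \<le> \<bar>2 * pi * of_int (k - z)\<bar>" by (simp add: abs_mult)
    then have "\<bar>u\<bar> \<le> \<bar>u + 2 * pi * of_int (k - z)\<bar>" using b unfolding u_def[symmetric] by linarith
    then show ?thesis unfolding e by (simp add: torus_dist_def u_def)
  qed (simp add: torus_dist_def k)
qed

lemma torus_dist_le_abs: "torus_dist x y \<le> \<bar>x - y\<bar>"
  using torus_dist_le[of x y 0] by simp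

lemma torus_dist_commute: "torus_dist x y = torus_dist y x"
proof -
  have "torus_dist x y \<le> torus_dist y x" for x y
  proof -
    obtain z :: int where "torus_dist y x = \<bar>y - x - 2 * pi * of_int z\<bar>" using torus_dist_representative by blast
    then show ?thesis using torus_dist_le[of x y "- z"] by (simp add: abs_if split: if_splits)
  qed
  then show ?thesis by (intro antisym)
qed

lemma torus_dist_triangle: "torus_dist x y \<le> torus_dist x u + torus_dist u y"
proof -
  obtain k :: int where "torus_dist x u = \<bar>x - u - 2 * pi * of_int k\<bar>" using torus_dist_representative by blast
  moreover obtain l :: int where "torus_dist u y = \<bar>u - y - 2 * pi * of_int l\<bar>" using torus_dist_representative by blast
  moreover have "torus_dist x y \<le> \<bar>x - y - 2 * pi * of_int (k + l)\<bar>" by (rule torus_dist_le)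
  moreover have "x - y - 2 * pi * of_int (k + l) = (x - u - 2 * pi * of_int k) + (u - y - 2 * pi * of_int l)"
    by (simp add: algebra_simps)
  ultimately show ?thesis by (smt (verit))
qed

lemma torus_dist_pos:
  assumes "x \<in> {-pi<..pi}" "y \<in> {-pi<..pi}" "x \<noteq> y"
  shows "0 < torus_dist x y"
proof (rule ccontr)
  assume "\<not> 0 < torus_dist x y"
  then have "torus_dist x y = 0" by (simp add: torus_dist_def)
  then obtain z :: int where z: "x - y = 2 * pi * of_int z" using torus_dist_representative[of x y] by auto
  have "\<bar>x - y\<bar> < 2 * pi" using assms by auto
  then have "2 * pi * \<bar>real_of_int z\<bar> < 2 * pi * 1" by (simp add: z abs_mult)
  then have "\<bar>real_of_int z\<bar> < 1" by (subst (asm) mult_less_cancel_left_pos) auto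
  then have "z = 0" by linarith
  then show False using z assms by simp
qed

lemma sin_half_ge_torus_dist: "29 / 100 * torus_dist x y \<le> \<bar>sin ((x - y) / 2)\<bar>"
proof -
  define u where "u = Arg (cis (x - y))"
  have "cis u = cis (x - y)" using cis_Arg[of "cis (x - y)"] by (simp add: u_def)
  then have "2 * \<bar>sin (u / 2)\<bar> = 2 * \<bar>sin ((x - y) / 2)\<bar>" using cmod_cis_minus_one by metis
  moreover have "29 / 100 * \<bar>u\<bar> \<le> \<bar>sin (u / 2)\<bar>"
    using Arg_bounded[of "cis (x - y)"] by (intro abs_sin_half_lower) (auto simp: u_def)
  ultimately show ?thesis by (simp add: torus_dist_def u_def)
qed

lemma sin_half_ge_torus_dist': "29 / 100 * torus_dist x y \<le> \<bar>sin ((y - x) / 2)\<bar>"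
  using sin_half_ge_torus_dist[of y x] by (simp add: torus_dist_commute)

lemma finite_block_indices: "0 < h \<Longrightarrow> finite (block_indices h)"
proof -
  assume h: "0 < h"
  have "block_indices h \<subseteq> {..nat \<lceil>2 * pi / h\<rceil>}"
  proof
    fix j assume "j \<in> block_indices h"
    then have "real j < 2 * pi / h" using h by (simp add: block_indices_def field_simps)
    then show "j \<in> {..nat \<lceil>2 * pi / h\<rceil>}" by simp linarith
  qed
  then show ?thesis by (rule finite_subset) simp
qed

lemma block_covers:
  assumes "0 < h" "x \<in> {-pi<..pi}"
  obtains j where "j \<in> block_indices h" "x \<in> block h j"
proof -
  define j where "j = nat (\<lceil>(x + pi) / h\<rceil> - 1)"
  have "0 < (x + pi) / h" using assms by simp
  then have "1 \<le> \<lceil>(x + pi) / h\<rceil>" by linarith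
  then have rj: "real j = of_int \<lceil>(x + pi) / h\<rceil> - 1" by (simp add: j_def)
  then have "real j < (x + pi) / h" "(x + pi) / h \<le> real j + 1" by linarith+
  then have "real j * h < x + pi" "x + pi \<le> (real j + 1) * h" using assms(1) by (auto simp: field_simps)
  then show ?thesis using assms(2) by (intro that[of j]) (auto simp: block_indices_def block_def)
qed

text \<open>A deterministic statement about the procedure.  By \<open>far\<close>, every maximum above the threshold lies
within \<open>r\<close> of some line, and by \<open>sep\<close> the blocks whose maxima are near \<open>b\<close> do not interact with
those near other lines.  The block containing \<open>b\<close> is among the former.  Maxima near \<open>b\<close> are
within \<open>2 r \<le> h\<close> of each other, so exactly the best ranked one survives, and its value is at least
\<open>V b\<close>.\<close>

lemma procedure_locates:
  fixes V :: "real \<Rightarrow> real"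
  assumes b: "b \<in> L" "L \<subseteq> {-pi<..pi}" and h: "0 < h" "2 * r \<le> h"
    and far: "\<And>v. (\<And>c. c \<in> L \<Longrightarrow> r \<le> torus_dist v c) \<Longrightarrow> V v \<le> \<theta>"
    and top: "\<theta> < V b"
    and sep: "\<And>c. c \<in> L \<Longrightarrow> c \<noteq> b \<Longrightarrow> 2 * r + h \<le> torus_dist b c"
    and maxima: "block_maxima V h loc" and tie: "inj tie"
    and w: "closest_location (remaining_blocks V h loc tie \<theta>) loc b w"
  shows "torus_dist w b < r" "V b \<le> V w"
proof -
  define T where "T = above_threshold V h loc \<theta>"
  define R where "R = remaining_blocks V h loc tie \<theta>"
  define Tb where "Tb = {j \<in> T. torus_dist (loc j) b < r}"
  define worse where "worse j k \<longleftrightarrow> V (loc j) < V (loc k) \<or> V (loc j) = V (loc k) \<and> tie k < tie j" for j k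
  have R: "R = {j \<in> T. \<not> (\<exists>k\<in>T. k \<noteq> j \<and> torus_dist (loc j) (loc k) \<le> h \<and> worse j k)}"
    unfolding R_def remaining_blocks_def T_def worse_def by simp
  have finT: "finite T" unfolding T_def above_threshold_def using finite_block_indices[OF h(1)] by simp
  have near: "\<exists>c\<in>L. torus_dist (loc j) c < r" if "j \<in> T" for j
  proof (rule ccontr)
    assume "\<not> (\<exists>c\<in>L. torus_dist (loc j) c < r)"
    then have "V (loc j) \<le> \<theta>" by (intro far) (auto simp: not_less)
    then show False using that by (simp add: T_def above_threshold_def)
  qed
  have near_b: "j \<in> Tb" if "j \<in> T" "torus_dist (loc j) x \<le> h" "torus_dist x b < r \<or> x = b" for j x
  proof -
    note nr = near[OF that(1)]
    obtain c where c: "c \<in> L" "torus_dist (loc j) c < r" using nr by blast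
    have "c = b"
    proof (rule ccontr)
      assume "c \<noteq> b"
      then have "2 * r + h \<le> torus_dist b c" using c sep by blast
      also have "\<dots> \<le> torus_dist b x + (torus_dist x (loc j) + torus_dist (loc j) c)"
        using torus_dist_triangle[of b c x] torus_dist_triangle[of x c "loc j"] by linarith
      also have "\<dots> < r + (h + r)"
      proof -
        have "0 \<le> torus_dist (loc j) c" "torus_dist b b = 0" by (simp_all add: torus_dist_def Arg_cis)
        then have "torus_dist b x \<le> r"
          using that(3) c(2) torus_dist_commute[of b x] by auto
        then show ?thesis using that(2) c(2) by (simp add: torus_dist_commute[of x "loc j"])
      qed
      finally show False by simp
    qed
    then show ?thesis using c that by (simp add: Tb_def)
  qed
  obtain j0 where j0: "j0 \<in> block_indices h" "b \<in> block h j0" using block_covers[OF h(1), of b] b by blast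
  have V0: "V b \<le> V (loc j0)" and l0: "loc j0 \<in> block h j0" using maxima j0 by (auto simp: block_maxima_def)
  have "j0 \<in> T" using V0 top j0 by (simp add: T_def above_threshold_def)
  moreover have "torus_dist (loc j0) b \<le> h"
  proof -
    have "\<bar>loc j0 - b\<bar> \<le> h" using l0 j0 by (auto simp: block_def algebra_simps)
    then show ?thesis using torus_dist_le_abs[of "loc j0" b] by linarith
  qed
  ultimately have "j0 \<in> Tb" by (rule near_b) simp
  \<comment> \<open>The survivor is the one that \<open>tie\<close> ranks first among the largest maxima near \<open>b\<close>.\<close>
  define A where "A = {j \<in> Tb. \<forall>k\<in>Tb. V (loc k) \<le> V (loc j)}"
  have finTb: "finite Tb" using finT by (simp add: Tb_def)
  have "A \<noteq> {}"
  proof -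
    have "Max ((\<lambda>j. V (loc j)) ` Tb) \<in> (\<lambda>j. V (loc j)) ` Tb"
      using finTb \<open>j0 \<in> Tb\<close> by (intro Max_in) auto
    then obtain j where "j \<in> Tb" "V (loc j) = Max ((\<lambda>j. V (loc j)) ` Tb)" by auto
    then have "j \<in> A" using finTb by (auto simp: A_def)
    then show ?thesis by blast
  qed
  then obtain s where s: "s \<in> A" "\<forall>k\<in>A. tie s \<le> tie k"
    using ex_has_least_nat[of "\<lambda>j. j \<in> A" _ tie] by blast
  have sTb: "s \<in> Tb" and sT: "s \<in> T" and sd: "torus_dist (loc s) b < r" and sV: "\<And>k. k \<in> Tb \<Longrightarrow> V (loc k) \<le> V (loc s)"
    using s(1) by (auto simp: A_def Tb_def)
  have best: "worse k s" if "k \<in> Tb" "k \<noteq> s" for k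
  proof (cases "V (loc k) = V (loc s)")
    case True
    then have "k \<in> A" using that sV by (auto simp: A_def)
    then have "tie s \<le> tie k" using s(2) by blast
    moreover have "tie s \<noteq> tie k" using tie that(2) by (auto dest: injD)
    ultimately show ?thesis using True by (simp add: worse_def)
  next
    case False
    then show ?thesis using sV[OF that(1)] by (simp add: worse_def)
  qed
  have "s \<in> R"
  proof -
    have False if k: "k \<in> T" "k \<noteq> s" "torus_dist (loc s) (loc k) \<le> h" "worse s k" for k
    proof -
      have "k \<in> Tb"
        by (rule near_b[OF k(1), of "loc s"]) (use k(3) sd in \<open>auto simp: torus_dist_commute\<close>)
      from best[OF this k(2)] k(4) show False by (auto simp: worse_def)
    qed
    then show ?thesis unfolding R using sT by blast
  qed
  then obtain j where j: "j \<in> R" "w = loc j" "\<forall>k\<in>R. torus_dist (loc j) b \<le> torus_dist (loc k) b"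
    using w unfolding closest_location_def R_def[symmetric] by blast
  have "torus_dist (loc j) b < r" using j(3) \<open>s \<in> R\<close> sd by force
  then have "j \<in> Tb" using j(1) by (simp add: Tb_def R)
  have "j = s"
  proof (rule ccontr)
    assume "j \<noteq> s"
    have "torus_dist (loc j) (loc s) \<le> torus_dist (loc j) b + torus_dist b (loc s)" by (rule torus_dist_triangle)
    also have "\<dots> \<le> h" using \<open>torus_dist (loc j) b < r\<close> sd h by (simp add: torus_dist_commute[of b])
    finally have "torus_dist (loc j) (loc s) \<le> h" .
    moreover have "\<not> (\<exists>k\<in>T. k \<noteq> j \<and> torus_dist (loc j) (loc k) \<le> h \<and> worse j k)"
      using j(1) unfolding R by simp
    ultimately show False using best[OF \<open>j \<in> Tb\<close> \<open>j \<noteq> s\<close>] sT \<open>j \<noteq> s\<close> by metis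
  qed
  show "torus_dist w b < r" using sd j \<open>j = s\<close> by simp
  show "V b \<le> V w" using V0 sV[OF \<open>j0 \<in> Tb\<close>] j \<open>j = s\<close> by simp
qed

section \<open>Smoothing kernels\<close>

definition kernel_coeff :: "(real \<Rightarrow> real) \<Rightarrow> int \<Rightarrow> complex" where
  "kernel_coeff g j = (LBINT \<mu>:{-pi..pi}. cis (of_int (- j) * \<mu>) * of_real (g \<mu>))"

lemma kernel_coeff_one: "kernel_coeff (\<lambda>_. 1) j = (if j = 0 then 2 * pi else 0)"
  using circle_integral_cis[of "- j"] by (simp add: kernel_coeff_def)

text \<open>Expanding the two discrete Fourier transforms leaves, for each pair of times \<open>k\<close> and \<open>m\<close>, the
Fourier coefficient of \<open>g\<close> with index \<open>k - m\<close>.\<close>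

lemma (in summable_gaussian) smoothed_periodogram:
  assumes g: "continuous_on {-pi..pi} g" and n: "even n"
  shows "(LBINT \<mu>:{-pi..pi}. periodogram X n (\<mu> + w) \<mu> \<omega> * of_real (g \<mu>)) = line_stat (kernel_coeff g) (n div 2) w \<omega>"
proof -
  define N where "N = n div 2"
  define J where "J = {-int N..int N}"
  define d where "d = complex_of_real (2 * pi * (2 * real N + 1))"
  have rn: "real n + 1 = 2 * real N + 1" using n by (auto simp: N_def elim!: evenE)
  define F where "F k m \<mu> = (of_real (X k \<omega> * X m \<omega>) * cis (- (of_int k * w)) / d) * (cis (of_int (- (k - m)) * \<mu>) * complex_of_real (g \<mu>))" for k m \<mu>
  have Fi: "set_integrable lborel {-pi..pi} (F k m)" for k m
    unfolding F_def by (intro continuous_set_integrable continuous_intros g)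
  have pt: "periodogram X n (\<mu> + w) \<mu> \<omega> * of_real (g \<mu>) = (\<Sum>k\<in>J. \<Sum>m\<in>J. F k m \<mu>)" for \<mu>
  proof -
    have "periodogram X n (\<mu> + w) \<mu> \<omega> * of_real (g \<mu>) =
       (\<Sum>k\<in>J. \<Sum>m\<in>J. (complex_of_real (X k \<omega>) * cis (- (of_int k * (\<mu> + w)))) * (complex_of_real (X m \<omega>) * cis (of_int m * \<mu>))) / d * of_real (g \<mu>)"
      unfolding periodogram_def rn dft_def N_def[symmetric] J_def[symmetric] d_def cnj_sum
      by (simp add: sum_product cis_cnj)
    also have "\<dots> = (\<Sum>k\<in>J. \<Sum>m\<in>J. F k m \<mu>)"
      unfolding sum_divide_distrib sum_distrib_right
    proof (intro sum.cong refl)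
      fix k m
      have c: "cis (- (of_int k * (\<mu> + w))) * cis (of_int m * \<mu>) = cis (- (of_int k * w)) * cis (of_int (- (k - m)) * \<mu>)"
        by (simp add: cis_mult algebra_simps)
      have "(complex_of_real (X k \<omega>) * cis (- (of_int k * (\<mu> + w)))) * (complex_of_real (X m \<omega>) * cis (of_int m * \<mu>)) / d * of_real (g \<mu>)
         = (complex_of_real (X k \<omega>) * complex_of_real (X m \<omega>)) * (cis (- (of_int k * (\<mu> + w))) * cis (of_int m * \<mu>)) / d * of_real (g \<mu>)"
        by simp
      also have "\<dots> = F k m \<mu>" unfolding c F_def by simp
      finally show "(complex_of_real (X k \<omega>) * cis (- (of_int k * (\<mu> + w)))) * (complex_of_real (X m \<omega>) * cis (of_int m * \<mu>)) / d * of_real (g \<mu>) = F k m \<mu>" .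
    qed
    finally show ?thesis .
  qed
  have "(LBINT \<mu>:{-pi..pi}. periodogram X n (\<mu> + w) \<mu> \<omega> * of_real (g \<mu>)) = (LBINT \<mu>:{-pi..pi}. \<Sum>k\<in>J. \<Sum>m\<in>J. F k m \<mu>)"
    by (simp only: pt)
  also have "\<dots> = (\<Sum>k\<in>J. \<Sum>m\<in>J. LBINT \<mu>:{-pi..pi}. F k m \<mu>)"
  proof -
    have "set_integrable lborel {-pi..pi} (\<lambda>\<mu>. \<Sum>m\<in>J. F k m \<mu>)" for k
      unfolding F_def by (intro continuous_set_integrable continuous_intros g)
    then show ?thesis
      by (subst set_integral_sum) (auto simp: J_def set_integral_sum[OF _ Fi])
  qed
  also have "\<dots> = (\<Sum>k\<in>J. \<Sum>m\<in>J. (of_real (X k \<omega> * X m \<omega>) * cis (- (of_int k * w)) / d) * kernel_coeff g (k - m))"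
    unfolding F_def kernel_coeff_def by (simp only: set_integral_mult_right)
  also have "\<dots> = line_stat (kernel_coeff g) N w \<omega>"
  proof -
    have d': "complex_of_real (2 * pi) * of_nat (2 * N + 1) = d" by (simp add: d_def)
    have d'': "2 * complex_of_real pi * of_nat (2 * N + 1) = d" by (simp add: d_def)
    show ?thesis
      unfolding line_stat_def J_def[symmetric] sum_divide_distrib
      by (intro sum.cong refl) (simp add: d_def mult_ac add_ac)
  qed
  finally show ?thesis by (simp add: N_def)
qed

lemma kernel_bounds:
  assumes K: "kernel K"
  obtains B where "0 \<le> B" "\<And>x. K x \<le> B"
proof -
  obtain r where r: "\<And>x. K x \<noteq> 0 \<Longrightarrow> norm x \<le> r"
    using K by (auto simp: kernel_def bounded_iff)
  have "compact (K ` cball 0 r)"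
    using K by (intro compact_continuous_image) (auto simp: kernel_def intro: continuous_on_subset)
  from compact_imp_bounded[OF this] obtain B where B: "\<forall>x\<in>cball 0 r. norm (K x) \<le> B"
    unfolding bounded_iff by blast
  have "K x \<le> max B 0" for x
  proof (cases "K x = 0")
    case False
    then have "x \<in> cball 0 r" using r by simp
    then show ?thesis using B by fastforce
  qed simp
  then show ?thesis by (intro that[of "max B 0"]) auto
qed

lemma kernel_integrable: "kernel K \<Longrightarrow> integrable lborel K"
  using not_integrable_integral_eq[of lborel K] by (auto simp: kernel_def)

lemma scaled_kernel_mass:
  assumes K: "kernel K" and h: "0 < h"
  shows "integrable lborel (\<lambda>\<mu>. scaled_kernel K h (\<mu> - \<eta>))"
    and "(LBINT \<mu>. scaled_kernel K h (\<mu> - \<eta>)) = 1"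
proof -
  have eq: "(\<lambda>\<mu>. scaled_kernel K h (\<mu> - \<eta>)) = (\<lambda>\<mu>. K (- \<eta> / h + (1 / h) * \<mu>) / h)"
    by (simp add: scaled_kernel_def diff_divide_distrib fun_eq_iff)
  have "integrable lborel (\<lambda>\<mu>. K (- \<eta> / h + (1 / h) * \<mu>))"
    by (rule lborel_integrable_real_affine[OF kernel_integrable[OF K]]) (use h in auto)
  then show "integrable lborel (\<lambda>\<mu>. scaled_kernel K h (\<mu> - \<eta>))" unfolding eq by simp
  have "(LBINT x. K x) = \<bar>1 / h\<bar> *\<^sub>R (LBINT \<mu>. K (- \<eta> / h + (1 / h) * \<mu>))"
    by (rule lborel_integral_real_affine) (use h in auto)
  then show "(LBINT \<mu>. scaled_kernel K h (\<mu> - \<eta>)) = 1"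
    using h K unfolding eq by (simp add: kernel_def)
qed

text \<open>The bound 1 is the total mass of the kernel.  The sum of squares is bounded by Bessel's inequality and
\<open>\<integral> g\<^sup>2 \<le> (sup g) \<integral> g \<le> B / h\<close>; it is the source of the factor \<open>1 / h\<close> in the variance.\<close>

lemma scaled_kernel_coeff_bounds:
  fixes \<eta> :: real
  assumes K: "kernel K" and B: "0 \<le> B" "\<And>x. K x \<le> B" and h: "0 < h"
  defines "g \<equiv> (\<lambda>\<mu>. scaled_kernel K h (\<mu> - \<eta>))"
  shows "continuous_on {-pi..pi} g"
    and "cmod (kernel_coeff g j) \<le> 1"
    and "finite J \<Longrightarrow> (\<Sum>j\<in>J. (cmod (kernel_coeff g j))\<^sup>2) \<le> 2 * pi * B / h"
proof -
  have cK: "continuous_on UNIV K" and K0: "\<And>x. 0 \<le> K x" using K by (auto simp: kernel_def)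
  show gc: "continuous_on {-pi..pi} g"
    unfolding g_def scaled_kernel_def using h
    by (intro continuous_intros continuous_on_compose2[OF cK]) auto
  have g0: "0 \<le> g x" for x using K0 h by (simp add: g_def scaled_kernel_def)
  have gB: "g x \<le> B / h" for x using B h by (simp add: g_def scaled_kernel_def divide_right_mono)
  have gi: "integrable lborel g" and g1: "(LBINT x. g x) = 1"
    unfolding g_def by (rule scaled_kernel_mass[OF K h])+
  have cj: "kernel_coeff g j = cnj (LBINT \<mu>:{-pi..pi}. cis (of_int j * \<mu>) * of_real (g \<mu>))" for j
  proof -
    have "kernel_coeff g j = (LBINT \<mu>. cnj (indicator {-pi..pi} \<mu> *\<^sub>R (cis (of_int j * \<mu>) * of_real (g \<mu>))))"
      unfolding kernel_coeff_def set_lebesgue_integral_def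
      by (intro Bochner_Integration.integral_cong refl) (simp add: scaleR_conv_of_real cis_cnj)
    then show ?thesis unfolding set_lebesgue_integral_def by (simp only: Bochner_Integration.integral_cnj)
  qed
  have le1: "(LBINT \<mu>:{-pi..pi}. g \<mu>) \<le> 1"
    unfolding g1[symmetric] set_lebesgue_integral_def
    using gi g0 continuous_set_integrable[OF gc] by (intro integral_mono) (auto simp: set_integrable_def split: split_indicator)
  have "cmod (kernel_coeff g j) \<le> (LBINT \<mu>:{-pi..pi}. g \<mu>)"
  proof -
    have "cmod (kernel_coeff g j) \<le> (LBINT \<mu>. cmod (indicator {-pi..pi} \<mu> *\<^sub>R (cis (of_int (- j) * \<mu>) * of_real (g \<mu>))))"
      unfolding kernel_coeff_def set_lebesgue_integral_def by (rule integral_norm_bound)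
    also have "\<dots> = (LBINT \<mu>:{-pi..pi}. g \<mu>)"
      unfolding set_lebesgue_integral_def using g0 by (intro Bochner_Integration.integral_cong refl) (simp add: norm_mult)
    finally show ?thesis .
  qed
  then show "cmod (kernel_coeff g j) \<le> 1" using le1 by linarith
  assume J: "finite J"
  have "(\<Sum>j\<in>J. (cmod (kernel_coeff g j))\<^sup>2) = (\<Sum>j\<in>J. (cmod (LBINT \<mu>:{-pi..pi}. cis (of_int j * \<mu>) * of_real (g \<mu>)))\<^sup>2)"
    by (simp add: cj)
  also have "\<dots> \<le> 2 * pi * (LBINT \<mu>:{-pi..pi}. (cmod (of_real (g \<mu>)))\<^sup>2)"
    by (intro bessel_inequality J continuous_intros gc)
  also have "(LBINT \<mu>:{-pi..pi}. (cmod (of_real (g \<mu>)))\<^sup>2) \<le> (LBINT \<mu>:{-pi..pi}. (B / h) * g \<mu>)"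
  proof (rule set_integral_mono)
    show "set_integrable lborel {-pi..pi} (\<lambda>\<mu>. (cmod (of_real (g \<mu>)))\<^sup>2)" by (intro continuous_set_integrable continuous_intros gc)
    show "set_integrable lborel {-pi..pi} (\<lambda>\<mu>. (B / h) * g \<mu>)" by (intro continuous_set_integrable continuous_intros gc)
    show "(cmod (of_real (g \<mu>)))\<^sup>2 \<le> (B / h) * g \<mu>" for \<mu>
      using mult_right_mono[OF gB[of \<mu>] g0[of \<mu>]] by (simp add: power2_eq_square)
  qed
  also have "\<dots> = (B / h) * (LBINT \<mu>:{-pi..pi}. g \<mu>)" by simp
  also have "\<dots> \<le> (B / h) * 1" using B h by (intro mult_left_mono le1) auto
  finally show "(\<Sum>j\<in>J. (cmod (kernel_coeff g j))\<^sup>2) \<le> 2 * pi * B / h" by simp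
qed

section \<open>Mean square distance of the estimate\<close>

text \<open>The moment bounds control fourth powers, while squares are to be estimated.  The free parameter \<open>T\<close>
replaces an application of the Cauchy--Schwarz inequality to expectations.\<close>

lemma square_le_amgm:
  fixes d H T :: real
  assumes "d ^ 4 \<le> H" "0 < T"
  shows "2 * d\<^sup>2 \<le> T * H + 1 / T"
proof -
  have "0 \<le> (T * d\<^sup>2 - 1)\<^sup>2 / T" using assms by simp
  also have "\<dots> = T * d ^ 4 + 1 / T - 2 * d\<^sup>2"
    using assms by (simp add: power2_eq_square power4_eq_xxxx field_simps)
  also have "\<dots> \<le> T * H + 1 / T - 2 * d\<^sup>2" using assms by simp
  finally show ?thesis by simp
qed

context summable_gaussian
begin

abbreviation delta_coeff :: "int \<Rightarrow> complex" where
  "delta_coeff \<equiv> kernel_coeff (\<lambda>_. 1)"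

lemma delta_coeff_sum_squares: "(\<Sum>m=-int N..int N. (cmod (delta_coeff (k - m)))\<^sup>2) \<le> (2 * pi)\<^sup>2"
proof -
  have "(\<Sum>m=-int N..int N. (cmod (delta_coeff (k - m)))\<^sup>2) = (\<Sum>m\<in>{-int N..int N}. if k = m then (2 * pi)\<^sup>2 else 0)"
    by (intro sum.cong refl) (simp add: kernel_coeff_one norm_mult power_mult_distrib)
  then show ?thesis by simp
qed

text \<open>The probabilistic core.  The hypotheses on \<open>w\<close> and on the means say that the estimate is within
\<open>\<rho> / N\<close> of \<open>b\<close> whenever the noise of \<open>U\<close> is uniformly below \<open>\<epsilon>\<close>, that \<open>|U|\<close> is then at least as
large at \<open>w\<close> as at \<open>b\<close>, that the mean of the statistic is flat to second order at \<open>b\<close> on the scale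
\<open>1 / N\<close>, and that the mean of \<open>U\<close> has a nondegenerate peak there.

Put \<open>x = (N dist(w, b))\<^sup>2\<close>.  On the event of small noise, comparing \<open>|U|\<close> at \<open>b\<close> and at \<open>w\<close> gives
\<open>c x \<le> e1 + e2 + C2 / N\<close> with the noise \<open>e1\<close>, \<open>e2\<close> of \<open>U\<close> at the two points.  Hence \<open>x\<^sup>2\<close> is of
order \<open>1 / N\<close> in expectation, and so is the squared deviation of the mean of the statistic from \<open>\<Phi>\<close>.
The noise of the statistic near \<open>b\<close> has mean square of order \<open>1 / (N h)\<close>.  The complementary event
is contained in \<open>y \<ge> 1\<close> for a variable \<open>y\<close> with expectation of order \<open>1 / N\<close>; there the noise is
bounded by its supremum over the circle, whose fourth moment is of order \<open>N / (N h)\<^sup>2\<close>.\<close>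

lemma mean_square_bound:
  fixes \<rho> \<epsilon> C1 C2 C3 c S0 b :: real
  assumes pos: "0 \<le> \<rho>" "0 < \<epsilon>" "0 \<le> C1" "0 \<le> C2" "0 \<le> C3" "0 < c" "0 \<le> S0"
  shows "\<exists>Q. \<forall>N h \<kappa> w \<Phi>. 1 \<le> N \<and> 0 < h \<and> (\<forall>j. cmod (\<kappa> j) \<le> 1) \<and>
     (\<forall>k. (\<Sum>m=-int N..int N. (cmod (\<kappa> (k - m)))\<^sup>2) \<le> S0 / h) \<and> w \<in> borel_measurable M \<and> cmod \<Phi> \<le> C3 \<and>
     (\<forall>\<omega>\<in>space M. (\<forall>v. cmod (line_stat delta_coeff N v \<omega> - line_stat_mean delta_coeff N v) \<le> \<epsilon>) \<longrightarrow>
        torus_dist (w \<omega>) b < \<rho> / real N \<and> cmod (line_stat delta_coeff N b \<omega>) \<le> cmod (line_stat delta_coeff N (w \<omega>) \<omega>)) \<and>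
     (\<forall>v. torus_dist v b < \<rho> / real N \<longrightarrow>
        cmod (line_stat_mean \<kappa> N v - \<Phi>) \<le> C1 * ((real N * torus_dist v b)\<^sup>2 + 1 / sqrt (real N)) \<and>
        c * (real N * torus_dist v b)\<^sup>2 - C2 / real N \<le> cmod (line_stat_mean delta_coeff N b) - cmod (line_stat_mean delta_coeff N v))
     \<longrightarrow> integrable M (\<lambda>\<omega>. (cmod (line_stat \<kappa> N (w \<omega>) \<omega> - \<Phi>))\<^sup>2) \<and>
         expectation (\<lambda>\<omega>. (cmod (line_stat \<kappa> N (w \<omega>) \<omega> - \<Phi>))\<^sup>2) \<le> Q * (1 / (real N * h) + 1 / real N)"
proof -
  define q where "q = 338 * R ^ 4"
  define K1 where "K1 = exp (4 * \<rho>) * q * S0\<^sup>2 + 1"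
  define K2 where "K2 = exp (4 * \<rho>) * q * ((2 * pi)\<^sup>2)\<^sup>2 + 1"
  define K3 where "K3 = exp (8 * pi) * q * S0\<^sup>2"
  define K4 where "K4 = exp (8 * pi) * q * ((2 * pi)\<^sup>2)\<^sup>2"
  define D where "D = 4 * C1\<^sup>2"
  define Q1 where "Q1 = K1 + K3 + K4 / \<epsilon> ^ 4"
  define Q2 where "Q2 = D * (4 / c\<^sup>2) * K2 + D * (2 * C2\<^sup>2 / c\<^sup>2 + 1) + 2 * (R + C3)\<^sup>2 * (K4 / \<epsilon> ^ 4)"
  define Q where "Q = max Q1 Q2"
  have q0: "0 \<le> q" by (simp add: q_def)
  show ?thesis
  proof (intro exI[of _ Q] allI impI, elim conjE)
    fix N :: nat and h :: real and \<kappa> :: "int \<Rightarrow> complex" and w :: "'a \<Rightarrow> real" and \<Phi> :: complex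
    assume N: "1 \<le> N" and h: "0 < h" and \<kappa>1: "\<forall>j. cmod (\<kappa> j) \<le> 1"
      and \<kappa>2: "\<forall>k. (\<Sum>m=-int N..int N. (cmod (\<kappa> (k - m)))\<^sup>2) \<le> S0 / h"
      and wm: "w \<in> borel_measurable M" and \<Phi>: "cmod \<Phi> \<le> C3"
      and loc: "\<forall>\<omega>\<in>space M. (\<forall>v. cmod (line_stat delta_coeff N v \<omega> - line_stat_mean delta_coeff N v) \<le> \<epsilon>) \<longrightarrow>
        torus_dist (w \<omega>) b < \<rho> / real N \<and> cmod (line_stat delta_coeff N b \<omega>) \<le> cmod (line_stat delta_coeff N (w \<omega>) \<omega>)"
      and means: "\<forall>v. torus_dist v b < \<rho> / real N \<longrightarrow>
        cmod (line_stat_mean \<kappa> N v - \<Phi>) \<le> C1 * ((real N * torus_dist v b)\<^sup>2 + 1 / sqrt (real N)) \<and>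
        c * (real N * torus_dist v b)\<^sup>2 - C2 / real N \<le> cmod (line_stat_mean delta_coeff N b) - cmod (line_stat_mean delta_coeff N v)"
    have N1: "1 \<le> real N" using N by simp
    obtain Hf where Hf: "Hf \<in> borel_measurable M" "\<And>\<omega>. 0 \<le> Hf \<omega>" "integrable M Hf"
      "expectation Hf \<le> exp (4 * \<rho>) * (338 * R ^ 4 * (S0 / h / (2 * real N + 1))\<^sup>2)"
      "\<And>\<omega> v. \<bar>v - b\<bar> \<le> \<rho> / real N \<Longrightarrow> cmod (line_stat \<kappa> N v \<omega> - line_stat_mean \<kappa> N v) ^ 4 \<le> Hf \<omega>"
      using line_stat_local_sup[of \<kappa> N "S0 / h" \<rho> b] \<kappa>2 N pos by blast
    obtain HU where HU: "HU \<in> borel_measurable M" "\<And>\<omega>. 0 \<le> HU \<omega>" "integrable M HU"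
      "expectation HU \<le> exp (4 * \<rho>) * (338 * R ^ 4 * ((2 * pi)\<^sup>2 / (2 * real N + 1))\<^sup>2)"
      "\<And>\<omega> v. \<bar>v - b\<bar> \<le> \<rho> / real N \<Longrightarrow> cmod (line_stat delta_coeff N v \<omega> - line_stat_mean delta_coeff N v) ^ 4 \<le> HU \<omega>"
      using line_stat_local_sup[of delta_coeff N "(2 * pi)\<^sup>2" \<rho> b] delta_coeff_sum_squares N pos by blast
    obtain Gf where Gf: "Gf \<in> borel_measurable M" "\<And>\<omega>. 0 \<le> Gf \<omega>" "integrable M Gf"
      "expectation Gf \<le> real N * (exp (8 * pi) * (338 * R ^ 4 * (S0 / h / (2 * real N + 1))\<^sup>2))"
      "\<And>\<omega> v. cmod (line_stat \<kappa> N v \<omega> - line_stat_mean \<kappa> N v) ^ 4 \<le> Gf \<omega>"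
      using line_stat_global_sup[of \<kappa> N "S0 / h"] \<kappa>2 N by blast
    obtain GU where GU: "GU \<in> borel_measurable M" "\<And>\<omega>. 0 \<le> GU \<omega>" "integrable M GU"
      "expectation GU \<le> real N * (exp (8 * pi) * (338 * R ^ 4 * ((2 * pi)\<^sup>2 / (2 * real N + 1))\<^sup>2))"
      "\<And>\<omega> v. cmod (line_stat delta_coeff N v \<omega> - line_stat_mean delta_coeff N v) ^ 4 \<le> GU \<omega>"
      using line_stat_global_sup[of delta_coeff N "(2 * pi)\<^sup>2"] delta_coeff_sum_squares N by blast
    define y where "y \<omega> = GU \<omega> / \<epsilon> ^ 4" for \<omega>
    define T where "T = real N * h"
    have T: "0 < T" using N1 h by (simp add: T_def)
    \<comment> \<open>The five terms dominate the noise near \<open>b\<close>, the random and the deterministic part of the deviation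
of the mean near \<open>b\<close>, and the noise and the deviation of the mean on the exceptional event.\<close>
    define E where "E \<omega> = (T * Hf \<omega> + 1 / T) + D * ((4 / c\<^sup>2) * (real N * HU \<omega> + 1 / real N)) +
       D * (2 * C2\<^sup>2 / c\<^sup>2 + 1) / real N + (h * Gf \<omega> + y \<omega> / h) + 2 * (R + C3)\<^sup>2 * y \<omega>" for \<omega>
    have nn: "0 \<le> T * Hf \<omega> + 1 / T" "0 \<le> D * ((4 / c\<^sup>2) * (real N * HU \<omega> + 1 / real N))"
      "0 \<le> D * (2 * C2\<^sup>2 / c\<^sup>2 + 1) / real N" "0 \<le> h * Gf \<omega> + y \<omega> / h" "0 \<le> 2 * (R + C3)\<^sup>2 * y \<omega>" for \<omega>
      using T h Hf(2)[of \<omega>] HU(2)[of \<omega>] Gf(2)[of \<omega>] GU(2)[of \<omega>] pos by (auto simp: D_def y_def)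
    have dom: "(cmod (line_stat \<kappa> N (w \<omega>) \<omega> - \<Phi>))\<^sup>2 \<le> E \<omega>" if \<omega>: "\<omega> \<in> space M" for \<omega>
    proof -
      define v where "v = w \<omega>"
      have tri: "(cmod (line_stat \<kappa> N v \<omega> - \<Phi>))\<^sup>2 \<le> 2 * (cmod (line_stat \<kappa> N v \<omega> - line_stat_mean \<kappa> N v))\<^sup>2 + 2 * (cmod (line_stat_mean \<kappa> N v - \<Phi>))\<^sup>2" for v
      proof -
        let ?x = "cmod (line_stat \<kappa> N v \<omega> - line_stat_mean \<kappa> N v)" and ?y = "cmod (line_stat_mean \<kappa> N v - \<Phi>)"
        have "cmod (line_stat \<kappa> N v \<omega> - \<Phi>) \<le> ?x + ?y"
          using norm_triangle_ineq[of "line_stat \<kappa> N v \<omega> - line_stat_mean \<kappa> N v" "line_stat_mean \<kappa> N v - \<Phi>"] by simp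
        then have "(cmod (line_stat \<kappa> N v \<omega> - \<Phi>))\<^sup>2 \<le> (?x + ?y)\<^sup>2" by (intro power_mono) auto
        also have "\<dots> \<le> 2 * ?x\<^sup>2 + 2 * ?y\<^sup>2" using sum_squares_bound[of ?x ?y] by (simp add: power2_sum)
        finally show ?thesis .
      qed
      show ?thesis
      proof (cases "GU \<omega> \<le> \<epsilon> ^ 4")
        case True
        have "cmod (line_stat delta_coeff N v \<omega> - line_stat_mean delta_coeff N v) \<le> \<epsilon>" for v
        proof (rule ccontr)
          assume "\<not> ?thesis"
          then have "\<epsilon> ^ 4 < cmod (line_stat delta_coeff N v \<omega> - line_stat_mean delta_coeff N v) ^ 4" using pos by (intro power_strict_mono) auto
          then show False using True GU(5)[of v \<omega>] by linarith
        qed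
        then have l: "torus_dist v b < \<rho> / real N" "cmod (line_stat delta_coeff N b \<omega>) \<le> cmod (line_stat delta_coeff N v \<omega>)"
          using loc \<omega> by (auto simp: v_def)
        define x where "x = (real N * torus_dist v b)\<^sup>2"
        obtain z :: int where z: "torus_dist v b = \<bar>v - b - 2 * pi * of_int z\<bar>" using torus_dist_representative by blast
        define v' where "v' = v - 2 * pi * of_int z"
        have v': "\<bar>v' - b\<bar> \<le> \<rho> / real N" using l(1) z by (simp add: v'_def algebra_simps)
        have per: "line_stat \<kappa>' N v' \<omega> - line_stat_mean \<kappa>' N v' = line_stat \<kappa>' N v \<omega> - line_stat_mean \<kappa>' N v" for \<kappa>'
          unfolding line_stat_minus_mean v'_def by (simp only: cis_int_periodic)
        define e1 where "e1 = cmod (line_stat delta_coeff N b \<omega> - line_stat_mean delta_coeff N b)"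
        define e2 where "e2 = cmod (line_stat delta_coeff N v \<omega> - line_stat_mean delta_coeff N v)"
        have e1: "e1 ^ 4 \<le> HU \<omega>" unfolding e1_def using pos by (intro HU(5)) simp
        have e2: "e2 ^ 4 \<le> HU \<omega>" unfolding e2_def using HU(5)[OF v', of \<omega>] by (simp only: per)
        have d: "cmod (line_stat \<kappa> N v \<omega> - line_stat_mean \<kappa> N v) ^ 4 \<le> Hf \<omega>" using Hf(5)[OF v', of \<omega>] by (simp only: per)
        have m: "cmod (line_stat_mean \<kappa> N v - \<Phi>) \<le> C1 * (x + 1 / sqrt (real N))"
          "c * x - C2 / real N \<le> cmod (line_stat_mean delta_coeff N b) - cmod (line_stat_mean delta_coeff N v)"
          using means l(1) by (auto simp: x_def)
        have "cmod (line_stat_mean delta_coeff N b) - e1 \<le> cmod (line_stat delta_coeff N b \<omega>)"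
          unfolding e1_def using norm_triangle_ineq2[of "line_stat_mean delta_coeff N b" "line_stat delta_coeff N b \<omega>"] by (simp add: norm_minus_commute)
        moreover have "cmod (line_stat delta_coeff N v \<omega>) \<le> cmod (line_stat_mean delta_coeff N v) + e2"
          unfolding e2_def using norm_triangle_ineq2[of "line_stat delta_coeff N v \<omega>" "line_stat_mean delta_coeff N v"] by simp
        ultimately have "c * x \<le> e1 + e2 + C2 / real N" using m(2) l(2) by linarith
        then have "(c * x)\<^sup>2 \<le> (e1 + e2 + C2 / real N)\<^sup>2"
          using pos by (intro power_mono) (auto simp: x_def)
        also have "\<dots> \<le> 4 * e1\<^sup>2 + 4 * e2\<^sup>2 + 2 * (C2 / real N)\<^sup>2"
          using sum_squares_bound[of "e1 + e2" "C2 / real N"] sum_squares_bound[of e1 e2] by (simp add: power2_sum)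
        also have "\<dots> \<le> 4 * (real N * HU \<omega> + 1 / real N) + 2 * C2\<^sup>2 / real N"
        proof -
          have "(C2 / real N)\<^sup>2 \<le> C2\<^sup>2 / real N"
          proof -
            have "C2\<^sup>2 / (real N)\<^sup>2 \<le> C2\<^sup>2 / real N"
              using N1 by (intro divide_left_mono) (auto simp: power2_eq_square)
            then show ?thesis by (simp add: power_divide)
          qed
          then show ?thesis using square_le_amgm[OF e1, of "real N"] square_le_amgm[OF e2, of "real N"] N1 by simp
        qed
        finally have "c\<^sup>2 * x\<^sup>2 \<le> 4 * (real N * HU \<omega> + 1 / real N) + 2 * C2\<^sup>2 / real N" by (simp add: power_mult_distrib)
        then have "x\<^sup>2 \<le> (4 * (real N * HU \<omega> + 1 / real N) + 2 * C2\<^sup>2 / real N) / c\<^sup>2"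
          using pos by (simp add: pos_le_divide_eq mult.commute)
        also have "\<dots> = (4 / c\<^sup>2) * (real N * HU \<omega> + 1 / real N) + (2 * C2\<^sup>2 / c\<^sup>2) / real N"
          by (simp add: add_divide_distrib)
        finally have x2: "x\<^sup>2 \<le> (4 / c\<^sup>2) * (real N * HU \<omega> + 1 / real N) + (2 * C2\<^sup>2 / c\<^sup>2) / real N" .
        have "(cmod (line_stat_mean \<kappa> N v - \<Phi>))\<^sup>2 \<le> (C1 * (x + 1 / sqrt (real N)))\<^sup>2" by (intro power_mono m) simp
        also have "\<dots> = C1\<^sup>2 * (x + 1 / sqrt (real N))\<^sup>2" by (simp add: power_mult_distrib)
        also have "\<dots> \<le> C1\<^sup>2 * (2 * x\<^sup>2 + 2 * (1 / real N))"
          using sum_squares_bound[of x "1 / sqrt (real N)"] by (intro mult_left_mono) (auto simp: power2_sum power_divide)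
        finally have "2 * (cmod (line_stat_mean \<kappa> N v - \<Phi>))\<^sup>2 \<le> D * (x\<^sup>2 + 1 / real N)" by (simp add: D_def distrib_left)
        also have "\<dots> \<le> D * ((4 / c\<^sup>2) * (real N * HU \<omega> + 1 / real N) + (2 * C2\<^sup>2 / c\<^sup>2) / real N + 1 / real N)"
          using x2 by (intro mult_left_mono) (auto simp: D_def)
        also have "\<dots> = D * ((4 / c\<^sup>2) * (real N * HU \<omega> + 1 / real N)) + D * (2 * C2\<^sup>2 / c\<^sup>2 + 1) / real N"
          by (simp add: distrib_left add_divide_distrib)
        finally show ?thesis
          using tri[of v] square_le_amgm[OF d T] nn(4,5)[of \<omega>] unfolding E_def v_def by linarith
      next
        case False
        then have y1: "1 \<le> y \<omega>" using pos by (simp add: y_def)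
        \<comment> \<open>The weight \<open>h\<close> balances \<open>h E[Gf]\<close> against \<open>E[y] / h\<close>: both are of order \<open>1 / (N h)\<close>.\<close>
        have "2 * (cmod (line_stat \<kappa> N v \<omega> - line_stat_mean \<kappa> N v))\<^sup>2 \<le> h * Gf \<omega> + 1 / h"
          by (intro square_le_amgm Gf h)
        also have "\<dots> \<le> h * Gf \<omega> + y \<omega> / h" using y1 h by (simp add: divide_right_mono)
        finally have 1: "2 * (cmod (line_stat \<kappa> N v \<omega> - line_stat_mean \<kappa> N v))\<^sup>2 \<le> h * Gf \<omega> + y \<omega> / h" .
        have "cmod (line_stat_mean \<kappa> N v - \<Phi>) \<le> R + C3"
          using norm_triangle_ineq4[of "line_stat_mean \<kappa> N v" \<Phi>] line_stat_mean_bounded[of \<kappa> N v] \<kappa>1 \<Phi> by force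
        then have "2 * (cmod (line_stat_mean \<kappa> N v - \<Phi>))\<^sup>2 \<le> 2 * (R + C3)\<^sup>2 * 1" by (simp add: power_mono)
        also have "\<dots> \<le> 2 * (R + C3)\<^sup>2 * y \<omega>" by (intro mult_left_mono y1) simp
        finally show ?thesis using 1 tri[of v] nn(1,2)[of \<omega>] nn(3) unfolding E_def v_def by linarith
      qed
    qed
    have Ei: "integrable M E"
      unfolding E_def[abs_def] y_def[abs_def] using Hf HU Gf GU
      by (intro Bochner_Integration.integrable_add integrable_mult_right integrable_const Bochner_Integration.integrable_divide) auto
    have Am: "(\<lambda>\<omega>. line_stat \<kappa> N (w \<omega>) \<omega>) \<in> borel_measurable M" by (rule line_stat_measurable[OF wm])
    have Ai: "integrable M (\<lambda>\<omega>. (cmod (line_stat \<kappa> N (w \<omega>) \<omega> - \<Phi>))\<^sup>2)"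
    proof (rule Bochner_Integration.integrable_bound[OF Ei])
      show "(\<lambda>\<omega>. (cmod (line_stat \<kappa> N (w \<omega>) \<omega> - \<Phi>))\<^sup>2) \<in> borel_measurable M" using Am by measurable
      show "AE \<omega> in M. norm ((cmod (line_stat \<kappa> N (w \<omega>) \<omega> - \<Phi>))\<^sup>2) \<le> norm (E \<omega>)"
        using dom by (intro AE_I2) fastforce
    qed
    have EE: "expectation E = (T * expectation Hf + 1 / T) + D * ((4 / c\<^sup>2) * (real N * expectation HU + 1 / real N)) +
       D * (2 * C2\<^sup>2 / c\<^sup>2 + 1) / real N + (h * expectation Gf + (expectation GU / \<epsilon> ^ 4) / h) + 2 * (R + C3)\<^sup>2 * (expectation GU / \<epsilon> ^ 4)"
      unfolding E_def y_def using Hf HU Gf GU by (simp add: prob_space)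
    have M2: "(2 * real N + 1)\<^sup>2 \<ge> (real N)\<^sup>2" using N1 by (intro power_mono) auto
    have N2: "(s / (2 * real N + 1))\<^sup>2 \<le> s\<^sup>2 / (real N)\<^sup>2" for s
      unfolding power_divide using M2 N1 by (intro divide_left_mono) auto
    have b1: "T * expectation Hf + 1 / T \<le> K1 * (1 / T)"
    proof -
      have "expectation Hf \<le> exp (4 * \<rho>) * (q * ((S0 / h)\<^sup>2 / (real N)\<^sup>2))"
        using Hf(4) N2[of "S0 / h"] q0 unfolding q_def[symmetric]
        by (rule order_trans[OF _ mult_left_mono[OF mult_left_mono]]) auto
      then have "T * expectation Hf \<le> T * (exp (4 * \<rho>) * (q * ((S0 / h)\<^sup>2 / (real N)\<^sup>2)))" using T by (intro mult_left_mono) auto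
      also have "\<dots> = exp (4 * \<rho>) * q * S0\<^sup>2 * (1 / T)"
        using h N1 by (simp add: T_def power2_eq_square field_simps)
      finally show ?thesis by (simp add: K1_def add_divide_distrib)
    qed
    have b2: "real N * expectation HU + 1 / real N \<le> K2 * (1 / real N)"
    proof -
      have "expectation HU \<le> exp (4 * \<rho>) * (q * (((2 * pi)\<^sup>2)\<^sup>2 / (real N)\<^sup>2))"
        using HU(4) N2[of "(2 * pi)\<^sup>2"] q0 unfolding q_def[symmetric]
        by (rule order_trans[OF _ mult_left_mono[OF mult_left_mono]]) auto
      then have "real N * expectation HU \<le> real N * (exp (4 * \<rho>) * (q * (((2 * pi)\<^sup>2)\<^sup>2 / (real N)\<^sup>2)))" by (intro mult_left_mono) auto
      also have "\<dots> = exp (4 * \<rho>) * q * ((2 * pi)\<^sup>2)\<^sup>2 * (1 / real N)"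
        using N1 by (simp add: power2_eq_square field_simps)
      finally show ?thesis by (simp add: K2_def add_divide_distrib)
    qed
    have b3: "h * expectation Gf \<le> K3 * (1 / T)"
    proof -
      have "expectation Gf \<le> real N * (exp (8 * pi) * (q * ((S0 / h)\<^sup>2 / (real N)\<^sup>2)))"
        using Gf(4) N2[of "S0 / h"] q0 unfolding q_def[symmetric]
        by (rule order_trans[OF _ mult_left_mono[OF mult_left_mono[OF mult_left_mono]]]) auto
      then have "h * expectation Gf \<le> h * (real N * (exp (8 * pi) * (q * ((S0 / h)\<^sup>2 / (real N)\<^sup>2))))" using h by (intro mult_left_mono) auto
      also have "\<dots> = K3 * (1 / T)"
        using h N1 by (simp add: K3_def T_def power2_eq_square field_simps)
      finally show ?thesis .
    qed
    have b4: "expectation GU \<le> K4 * (1 / real N)"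
    proof -
      have "expectation GU \<le> real N * (exp (8 * pi) * (q * (((2 * pi)\<^sup>2)\<^sup>2 / (real N)\<^sup>2)))"
        using GU(4) N2[of "(2 * pi)\<^sup>2"] q0 unfolding q_def[symmetric]
        by (rule order_trans[OF _ mult_left_mono[OF mult_left_mono[OF mult_left_mono]]]) auto
      also have "\<dots> = K4 * (1 / real N)"
        using N1 by (simp add: K4_def power2_eq_square field_simps)
      finally show ?thesis .
    qed
    have b5: "expectation GU / \<epsilon> ^ 4 \<le> (K4 / \<epsilon> ^ 4) * (1 / real N)"
      using divide_right_mono[OF b4, of "\<epsilon> ^ 4"] pos by (simp add: mult.commute)
    have b6: "(expectation GU / \<epsilon> ^ 4) / h \<le> (K4 / \<epsilon> ^ 4) * (1 / T)"
      using divide_right_mono[OF b5, of h] h by (simp add: T_def mult.assoc)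
    have b7: "D * ((4 / c\<^sup>2) * (real N * expectation HU + 1 / real N)) \<le> D * ((4 / c\<^sup>2) * (K2 * (1 / real N)))"
      by (intro mult_left_mono b2) (auto simp: D_def)
    have b8: "2 * (R + C3)\<^sup>2 * (expectation GU / \<epsilon> ^ 4) \<le> 2 * (R + C3)\<^sup>2 * ((K4 / \<epsilon> ^ 4) * (1 / real N))"
      by (intro mult_left_mono b5) auto
    have "expectation (\<lambda>\<omega>. (cmod (line_stat \<kappa> N (w \<omega>) \<omega> - \<Phi>))\<^sup>2) \<le> expectation E"
      by (intro integral_mono_AE Ai Ei AE_I2 dom)
    also have "\<dots> \<le> K1 * (1 / T) + D * ((4 / c\<^sup>2) * (K2 * (1 / real N))) + D * (2 * C2\<^sup>2 / c\<^sup>2 + 1) / real N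
        + (K3 * (1 / T) + (K4 / \<epsilon> ^ 4) * (1 / T)) + 2 * (R + C3)\<^sup>2 * ((K4 / \<epsilon> ^ 4) * (1 / real N))"
      unfolding EE by (intro add_mono b1 b7 b3 b6 b8 order_refl)
    also have "\<dots> = Q1 * (1 / T) + Q2 * (1 / real N)"
      unfolding Q1_def Q2_def by (simp add: distrib_right add_divide_distrib mult.assoc)
    also have "\<dots> \<le> Q * (1 / T) + Q * (1 / real N)"
      using T N1 unfolding Q_def by (intro add_mono mult_right_mono) auto
    finally have fin: "expectation (\<lambda>\<omega>. (cmod (line_stat \<kappa> N (w \<omega>) \<omega> - \<Phi>))\<^sup>2) \<le> Q * (1 / (real N * h) + 1 / real N)"
      by (simp add: T_def distrib_left)
    show "integrable M (\<lambda>\<omega>. (cmod (line_stat \<kappa> N (w \<omega>) \<omega> - \<Phi>))\<^sup>2) \<and>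
         expectation (\<lambda>\<omega>. (cmod (line_stat \<kappa> N (w \<omega>) \<omega> - \<Phi>))\<^sup>2) \<le> Q * (1 / (real N * h) + 1 / real N)"
      using Ai fin by blast
  qed
qed

end

section \<open>Processes carried by finitely many lines\<close>

lemma dirichlet_periodic: "dirichlet N (x - 2 * pi * of_int z) = dirichlet N x"
proof -
  have "cos (of_int k * (x - 2 * pi * of_int z)) = cos (of_int k * x)" for k :: int
    using arg_cong[OF cis_int_periodic[of k x z], of Re] by (simp del: of_int_mult)
  then show ?thesis by (simp add: dirichlet_def)
qed

lemma diff_sum_periodic: "diff_sum d N (x + 2 * pi * of_int z) = diff_sum d N x"
proof -
  have "cis (of_int k * (x + 2 * pi * of_int z)) = cis (of_int k * x)" for k :: int
    using cis_int_periodic[of k "- x" z] by (simp add: algebra_simps)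
  then show ?thesis by (simp add: diff_sum_def)
qed

lemma dirichlet_off_peak:
  assumes "0 < s" "s \<le> torus_dist v c"
  shows "\<bar>dirichlet N (c - v)\<bar> \<le> 1 / (29 / 100 * s)"
proof -
  have "\<bar>dirichlet N (c - v)\<bar> * (29 / 100 * s) \<le> \<bar>dirichlet N (c - v)\<bar> * \<bar>sin ((c - v) / 2)\<bar>"
    using sin_half_ge_torus_dist'[of v c] assms by (intro mult_left_mono) auto
  also have "\<dots> \<le> 1" by (rule dirichlet_decay)
  finally show ?thesis using assms by (simp add: pos_le_divide_eq)
qed

text \<open>\<open>lc b j\<close> stands for the covariance coefficient of the line \<open>b\<close> at lag \<open>j\<close>, and \<open>lc_weighted\<close> is the
trace that the smoothness of the line densities leaves on these coefficients.\<close>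

locale lines_process = summable_gaussian M X R
  for M :: "'a measure" and X :: "int \<Rightarrow> 'a \<Rightarrow> real" and R :: real +
  fixes L :: "real set" and lc :: "real \<Rightarrow> int \<Rightarrow> complex" and C W :: real
  assumes finite_L: "finite L" and L_sub: "L \<subseteq> {-pi<..pi}"
    and covar_lines: "complex_of_real (covar k m) = (\<Sum>b\<in>L. cis (of_int k * b) * lc b (k - m))"
    and lc_sum: "b \<in> L \<Longrightarrow> finite J \<Longrightarrow> (\<Sum>j\<in>J. cmod (lc b j)) \<le> C"
    and lc_weighted: "b \<in> L \<Longrightarrow> (\<Sum>j=-int n..int n. \<bar>of_int j\<bar> * cmod (lc b j)) \<le> W * sqrt (real n + 1)"
begin

lemma C_nonneg: "b \<in> L \<Longrightarrow> 0 \<le> C"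
  using lc_sum[of b "{}"] by simp

lemma lc_zero_le: "b \<in> L \<Longrightarrow> cmod (lc b 0) \<le> C"
  using lc_sum[of b "{0}"] by simp

lemma line_stat_mean_lines:
  "line_stat_mean \<kappa> N w = (\<Sum>b\<in>L. diff_sum (\<lambda>j. lc b j * \<kappa> j) N (b - w)) / of_real (2 * pi * (2 * real N + 1))"
proof -
  define J where "J = {-int N..int N}"
  have "(\<Sum>k\<in>J. \<Sum>m\<in>J. \<kappa> (k - m) * of_real (covar k m) * cis (- (of_int k * w))) =
     (\<Sum>k\<in>J. \<Sum>m\<in>J. \<Sum>b\<in>L. cis (of_int k * (b - w)) * (lc b (k - m) * \<kappa> (k - m)))"
    unfolding covar_lines sum_distrib_left sum_distrib_right
  proof (intro sum.cong refl)
    fix k m b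
    have "cis (of_int k * (b - w)) = cis (of_int k * b) * cis (- (of_int k * w))"
      by (simp add: cis_mult algebra_simps)
    then show "\<kappa> (k - m) * (cis (of_int k * b) * lc b (k - m)) * cis (- (of_int k * w)) =
        cis (of_int k * (b - w)) * (lc b (k - m) * \<kappa> (k - m))" by simp
  qed
  also have "\<dots> = (\<Sum>k\<in>J. \<Sum>b\<in>L. \<Sum>m\<in>J. cis (of_int k * (b - w)) * (lc b (k - m) * \<kappa> (k - m)))"
    by (intro sum.cong refl sum.swap)
  also have "\<dots> = (\<Sum>b\<in>L. diff_sum (\<lambda>j. lc b j * \<kappa> j) N (b - w))"
    unfolding diff_sum_def J_def by (rule sum.swap)
  finally show ?thesis unfolding line_stat_mean_def J_def by simp
qed

lemma lc_kappa_sum: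
  assumes "b \<in> L" "\<And>j. cmod (\<kappa> j) \<le> 1" "finite J"
  shows "(\<Sum>j\<in>J. cmod (lc b j * \<kappa> j)) \<le> C"
proof -
  have "(\<Sum>j\<in>J. cmod (lc b j * \<kappa> j)) \<le> (\<Sum>j\<in>J. cmod (lc b j))"
    unfolding norm_mult by (intro sum_mono mult_right_le_one_le assms) auto
  then show ?thesis using lc_sum[OF assms(1,3)] by linarith
qed

lemma diff_sum_delta:
  "diff_sum (\<lambda>j. lc b j * delta_coeff j) N x = 2 * pi * lc b 0 * of_real (dirichlet N x)"
proof -
  have "diff_sum (\<lambda>j. lc b j * delta_coeff j) N x =
     (\<Sum>k=-int N..int N. \<Sum>m=-int N..int N. if k = m then cis (of_int k * x) * (lc b 0 * (2 * pi)) else 0)"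
    unfolding diff_sum_def by (intro sum.cong refl) (simp add: kernel_coeff_one)
  also have "\<dots> = (\<Sum>k=-int N..int N. cis (of_int k * x) * (lc b 0 * (2 * pi)))"
    by (intro sum.cong refl) simp
  also have "\<dots> = of_real (dirichlet N x) * (lc b 0 * (2 * pi))"
    unfolding sum_distrib_right[symmetric] cis_sum_eq_dirichlet ..
  finally show ?thesis by (simp add: mult_ac)
qed

lemma line_stat_mean_delta:
  "line_stat_mean delta_coeff N w = (\<Sum>b\<in>L. lc b 0 * of_real (dirichlet N (b - w))) / of_real (2 * real N + 1)"
proof -
  have "line_stat_mean delta_coeff N w = (\<Sum>b\<in>L. of_real (2 * pi) * (lc b 0 * of_real (dirichlet N (b - w)))) / (of_real (2 * pi) * of_real (2 * real N + 1))"
    unfolding line_stat_mean_lines diff_sum_delta by (simp add: mult_ac)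
  also have "\<dots> = (\<Sum>b\<in>L. lc b 0 * of_real (dirichlet N (b - w))) / of_real (2 * real N + 1)"
    unfolding sum_distrib_left[symmetric] by (rule mult_divide_mult_cancel_left) simp
  finally show ?thesis .
qed

lemma separation:
  assumes "b \<in> L"
  obtains s where "0 < s" "\<And>c. c \<in> L \<Longrightarrow> c \<noteq> b \<Longrightarrow> s \<le> torus_dist b c"
proof -
  define S where "S = insert 1 (torus_dist b ` (L - {b}))"
  have S: "finite S" "S \<noteq> {}" using finite_L by (auto simp: S_def)
  have "0 < Min S"
  proof -
    have "0 < torus_dist b c" if "c \<in> L" "c \<noteq> b" for c
    proof -
      have "b \<in> {-pi<..pi}" "c \<in> {-pi<..pi}" using L_sub assms that by blast+
      then show ?thesis using that(2) by (intro torus_dist_pos) auto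
    qed
    then show ?thesis using S by (subst Min_gr_iff) (auto simp: S_def)
  qed
  moreover have "Min S \<le> torus_dist b c" if "c \<in> L" "c \<noteq> b" for c
    using S that by (intro Min_le) (auto simp: S_def)
  ultimately show ?thesis by (rule that)
qed

lemma torus_dist_other:
  assumes "s \<le> torus_dist b c" "torus_dist v b \<le> s / 2"
  shows "s / 2 \<le> torus_dist v c"
  using torus_dist_triangle[of b c v] assms by (simp add: torus_dist_commute[of b v])

text \<open>The contribution of the line \<open>b\<close> to the mean of the statistic at \<open>w = b\<close>; the constants around which
the estimates concentrate.\<close>

definition centre :: "real \<Rightarrow> (int \<Rightarrow> complex) \<Rightarrow> nat \<Rightarrow> complex" where
  "centre b \<kappa> N = diff_sum (\<lambda>j. lc b j * \<kappa> j) N 0 / of_real (2 * pi * (2 * real N + 1))"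

lemma normaliser_ge: "2 * real N + 1 \<le> 2 * pi * (2 * real N + 1)"
proof -
  have "1 \<le> 2 * pi" using pi_ge_two by simp
  then have "1 * (2 * real N + 1) \<le> 2 * pi * (2 * real N + 1)" by (intro mult_right_mono) auto
  then show ?thesis by simp
qed

lemma norm_normalised_le:
  assumes "cmod z \<le> (2 * real N + 1) * a"
  shows "cmod (z / of_real (2 * pi * (2 * real N + 1))) \<le> a"
proof -
  have a: "0 \<le> a" using order_trans[OF norm_ge_zero assms] by (simp add: zero_le_mult_iff)
  have "cmod (z / of_real (2 * pi * (2 * real N + 1))) = cmod z / (2 * pi * (2 * real N + 1))"
    unfolding norm_divide norm_of_real by simp
  also have "\<dots> \<le> (2 * real N + 1) * a / (2 * pi * (2 * real N + 1))" by (intro divide_right_mono assms) simp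
  also have "\<dots> \<le> (2 * real N + 1) * a / (2 * real N + 1)"
    using a by (intro divide_left_mono normaliser_ge) auto
  also have "\<dots> = a" by (simp add: add_nonneg_eq_0_iff)
  finally show ?thesis .
qed

lemma centre_bounded:
  assumes "b \<in> L" "\<And>j. cmod (\<kappa> j) \<le> 1"
  shows "cmod (centre b \<kappa> N) \<le> C"
  unfolding centre_def
proof (rule norm_normalised_le)
  have "cmod (diff_sum (\<lambda>j. lc b j * \<kappa> j) N 0) \<le> (\<Sum>k=-int N..int N. C)"
    unfolding diff_sum_def
  proof (intro sum_norm_le)
    fix k
    have "cmod (\<Sum>m=-int N..int N. cis (of_int k * 0) * (lc b (k - m) * \<kappa> (k - m))) \<le> (\<Sum>m=-int N..int N. cmod (lc b (k - m) * \<kappa> (k - m)))"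
      by (intro sum_norm_le) (simp add: norm_mult)
    also have "\<dots> = (\<Sum>j\<in>(\<lambda>m. k - m) ` {-int N..int N}. cmod (lc b j * \<kappa> j))"
      by (subst sum.reindex) (auto simp: inj_on_def)
    also have "\<dots> \<le> C" by (intro lc_kappa_sum assms) simp
    finally show "cmod (\<Sum>m=-int N..int N. cis (of_int k * 0) * (lc b (k - m) * \<kappa> (k - m))) \<le> C" .
  qed
  then show "cmod (diff_sum (\<lambda>j. lc b j * \<kappa> j) N 0) \<le> (2 * real N + 1) * C" by simp
qed

text \<open>The line \<open>b\<close> contributes the increment of \<open>diff_sum\<close> near its peak, where \<open>lc_weighted\<close> makes the
boundary effect of order \<open>sqrt N\<close> before division by \<open>2 N + 1\<close>.  The other lines are at a positive
distance and contribute geometric sums, of order \<open>1 / N\<close>.\<close>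

lemma line_stat_mean_near_line:
  assumes b: "b \<in> L" and s: "0 < s" "\<And>c. c \<in> L \<Longrightarrow> c \<noteq> b \<Longrightarrow> s \<le> torus_dist b c"
    and \<kappa>: "\<And>j. cmod (\<kappa> j) \<le> 1" and N: "1 \<le> N" and v: "torus_dist v b \<le> s / 2"
  shows "cmod (line_stat_mean \<kappa> N v - centre b \<kappa> N) \<le>
    (C / 2 + \<bar>W\<bar> + real (card L) * (C / (29 / 100 * (s / 2)))) * ((real N * torus_dist v b)\<^sup>2 + 1 / sqrt (real N))"
proof -
  define E where "E = C / (29 / 100 * (s / 2))"
  define d where "d c = (\<lambda>j. lc c j * \<kappa> j)" for c
  define x2 where "x2 = (real N * torus_dist v b)\<^sup>2"
  have C0: "0 \<le> C" by (rule C_nonneg[OF b])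
  then have E0: "0 \<le> E" using s by (simp add: E_def)
  have N1: "1 \<le> real N" using N by simp
  obtain z :: int where z: "torus_dist v b = \<bar>v - b - 2 * pi * of_int z\<bar>" using torus_dist_representative by blast
  define x where "x = b - v + 2 * pi * of_int z"
  have x: "\<bar>x\<bar> = torus_dist v b" unfolding z x_def by (simp add: abs_if)
  have per: "diff_sum (d b) N (b - v) = diff_sum (d b) N x" unfolding x_def by (simp only: diff_sum_periodic)
  have near: "cmod (diff_sum (d b) N x - diff_sum (d b) N 0) \<le> (2 * real N + 1) * (C * x2 / 2) + \<bar>W\<bar> * sqrt (2 * real N + 1)"
  proof -
    have "cmod (diff_sum (d b) N x - diff_sum (d b) N 0) \<le>
        (2 * real N + 1) * (C * (real N * x)\<^sup>2 / 2) + (\<Sum>j=-(2*int N)..2*int N. \<bar>of_int j\<bar> * cmod (d b j))"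
      unfolding d_def by (intro diff_sum_near_peak lc_kappa_sum b \<kappa>)
    also have "(real N * x)\<^sup>2 = x2" unfolding x2_def x[symmetric] by (simp add: power_mult_distrib)
    also have "(\<Sum>j=-(2*int N)..2*int N. \<bar>of_int j\<bar> * cmod (d b j)) \<le> (\<Sum>j=-int (2*N)..int (2*N). \<bar>of_int j\<bar> * cmod (lc b j))"
      unfolding d_def norm_mult using \<kappa> by (auto intro!: sum_mono mult_left_mono mult_right_le_one_le)
    also have "\<dots> \<le> W * sqrt (real (2 * N) + 1)" by (rule lc_weighted[OF b])
    also have "\<dots> \<le> \<bar>W\<bar> * sqrt (2 * real N + 1)" by (simp add: mult_right_mono)
    finally show ?thesis by simp
  qed
  have far: "cmod (diff_sum (d c) N (c - v)) \<le> E" if c: "c \<in> L - {b}" for c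
  proof -
    have "s / 2 \<le> torus_dist v c" using c s(2) v by (intro torus_dist_other[of s b]) auto
    then have "cmod (diff_sum (d c) N (c - v)) * (29 / 100 * (s / 2)) \<le> cmod (diff_sum (d c) N (c - v)) * \<bar>sin ((c - v) / 2)\<bar>"
      using sin_half_ge_torus_dist'[of v c] by (intro mult_left_mono) auto
    also have "\<dots> \<le> C" unfolding d_def using c by (intro diff_sum_off_peak lc_kappa_sum \<kappa>) auto
    finally show ?thesis using s by (simp add: E_def pos_le_divide_eq)
  qed
  have "line_stat_mean \<kappa> N v - centre b \<kappa> N =
     ((diff_sum (d b) N x - diff_sum (d b) N 0) + (\<Sum>c\<in>L - {b}. diff_sum (d c) N (c - v))) / of_real (2 * pi * (2 * real N + 1))"
    unfolding line_stat_mean_lines centre_def d_def[symmetric] diff_divide_distrib[symmetric]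
    using sum.remove[OF finite_L b, of "\<lambda>c. diff_sum (d c) N (c - v)"] per by simp
  moreover have "cmod ((diff_sum (d b) N x - diff_sum (d b) N 0) + (\<Sum>c\<in>L - {b}. diff_sum (d c) N (c - v)))
      \<le> (2 * real N + 1) * ((C / 2 + \<bar>W\<bar> + real (card L) * E) * (x2 + 1 / sqrt (real N)))"
  proof -
    have "cmod (\<Sum>c\<in>L - {b}. diff_sum (d c) N (c - v)) \<le> (\<Sum>c\<in>L - {b}. E)" by (intro sum_norm_le far)
    also have "\<dots> \<le> real (card L) * E" using E0 finite_L by (simp add: mult_right_mono card_Diff1_le)
    finally have f: "cmod (\<Sum>c\<in>L - {b}. diff_sum (d c) N (c - v)) \<le> real (card L) * E" .
    define u where "u = 1 / sqrt (real N)"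
    have u0: "0 \<le> u" by (simp add: u_def)
    have u1: "1 \<le> (2 * real N + 1) * u"
    proof -
      have "sqrt (real N) \<le> real N" using N1 by (simp add: real_le_lsqrt power2_eq_square)
      then show ?thesis using N1 by (simp add: u_def field_simps)
    qed
    have u2: "sqrt (2 * real N + 1) \<le> (2 * real N + 1) * u"
    proof -
      have "sqrt (real N) \<le> sqrt (2 * real N + 1)" by simp
      then have "sqrt (2 * real N + 1) * sqrt (real N) \<le> sqrt (2 * real N + 1) * sqrt (2 * real N + 1)" by (intro mult_left_mono) auto
      then have "sqrt (2 * real N + 1) * sqrt (real N) \<le> 2 * real N + 1" by simp
      then show ?thesis using N1 by (simp add: u_def field_simps)
    qed
    have x20: "0 \<le> x2" by (simp add: x2_def)
    have "cmod ((diff_sum (d b) N x - diff_sum (d b) N 0) + (\<Sum>c\<in>L - {b}. diff_sum (d c) N (c - v)))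
       \<le> (2 * real N + 1) * (C * x2 / 2) + \<bar>W\<bar> * sqrt (2 * real N + 1) + real (card L) * E * 1"
      using norm_triangle_ineq[of "diff_sum (d b) N x - diff_sum (d b) N 0" "\<Sum>c\<in>L - {b}. diff_sum (d c) N (c - v)"] near f by linarith
    also have "\<dots> \<le> (2 * real N + 1) * (C * x2 / 2) + \<bar>W\<bar> * ((2 * real N + 1) * u) + real (card L) * E * ((2 * real N + 1) * u)"
      using E0 by (intro add_mono mult_left_mono u1 u2 order_refl) auto
    also have "\<dots> = (2 * real N + 1) * (C / 2 * x2 + \<bar>W\<bar> * u + real (card L) * E * u)"
      by (simp add: algebra_simps)
    also have "\<dots> \<le> (2 * real N + 1) * (C / 2 * (x2 + u) + \<bar>W\<bar> * (x2 + u) + real (card L) * E * (x2 + u))"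
      using C0 E0 u0 x20 by (intro mult_left_mono add_mono) auto
    also have "\<dots> = (2 * real N + 1) * ((C / 2 + \<bar>W\<bar> + real (card L) * E) * (x2 + u))"
      by (simp add: algebra_simps)
    finally show ?thesis by (simp add: u_def)
  qed
  ultimately show ?thesis unfolding E_def[symmetric] x2_def[symmetric] using norm_normalised_le by simp
qed

text \<open>Near the line \<open>b\<close> the mean of \<open>U\<close> is a multiple of the Dirichlet kernel centred at \<open>b\<close>, up to the
tails of the kernels centred at the other lines.\<close>

lemma line_stat_mean_delta_peak:
  assumes b: "b \<in> L" and s: "0 < s" "\<And>c. c \<in> L \<Longrightarrow> c \<noteq> b \<Longrightarrow> s \<le> torus_dist b c"
    and v: "torus_dist v b \<le> s / 2"
  shows "\<bar>cmod (line_stat_mean delta_coeff N v) - cmod (lc b 0) * (\<bar>dirichlet N (b - v)\<bar> / (2 * real N + 1))\<bar>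
     \<le> real (card L) * (C / (29 / 100 * (s / 2))) / (2 * real N + 1)"
proof -
  define E where "E = C / (29 / 100 * (s / 2))"
  have C0: "0 \<le> C" by (rule C_nonneg[OF b])
  then have E0: "0 \<le> E" using s by (simp add: E_def)
  have far: "cmod (lc c 0 * of_real (dirichlet N (c - v))) \<le> E" if c: "c \<in> L - {b}" for c
  proof -
    have "s / 2 \<le> torus_dist v c" using c s(2) v by (intro torus_dist_other[of s b]) auto
    then have "cmod (lc c 0) * \<bar>dirichlet N (c - v)\<bar> \<le> C * (1 / (29 / 100 * (s / 2)))"
      using s c C0 by (intro mult_mono dirichlet_off_peak lc_zero_le) auto
    then show ?thesis by (simp add: norm_mult E_def)
  qed
  define A where "A = lc b 0 * of_real (dirichlet N (b - v))"
  define B where "B = (\<Sum>c\<in>L - {b}. lc c 0 * of_real (dirichlet N (c - v)))"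
  have "cmod B \<le> (\<Sum>c\<in>L - {b}. E)" unfolding B_def by (intro sum_norm_le far)
  also have "\<dots> \<le> real (card L) * E" using E0 finite_L by (simp add: mult_right_mono card_Diff1_le)
  finally have B: "cmod B \<le> real (card L) * E" .
  have "line_stat_mean delta_coeff N v = (A + B) / of_real (2 * real N + 1)"
    unfolding line_stat_mean_delta A_def B_def using sum.remove[OF finite_L b, of "\<lambda>c. lc c 0 * of_real (dirichlet N (c - v))"] by simp
  then have "cmod (line_stat_mean delta_coeff N v) = cmod (A + B) / (2 * real N + 1)"
    by (simp only: norm_divide norm_of_real)
  moreover have "cmod (lc b 0) * (\<bar>dirichlet N (b - v)\<bar> / (2 * real N + 1)) = cmod A / (2 * real N + 1)"
    by (simp add: A_def norm_mult)
  moreover have "\<bar>cmod (A + B) - cmod A\<bar> \<le> cmod B"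
    using norm_triangle_ineq3[of "A + B" A] by simp
  ultimately have "\<bar>cmod (line_stat_mean delta_coeff N v) - cmod (lc b 0) * (\<bar>dirichlet N (b - v)\<bar> / (2 * real N + 1))\<bar> \<le> cmod B / (2 * real N + 1)"
    by (simp add: divide_right_mono flip: diff_divide_distrib)
  also have "\<dots> \<le> real (card L) * E / (2 * real N + 1)" using B by (intro divide_right_mono) auto
  finally show ?thesis by (simp add: E_def)
qed

text \<open>The quadratic decay of \<open>dirichlet_peak\<close> saturates at \<open>1 / 10\<close>.  As \<open>N dist(v, b)\<close> is at most \<open>\<rho>\<close>, the
factor \<open>1 / (10 (\<rho>\<^sup>2 + 1))\<close> keeps a quadratic lower bound on the whole range.\<close>

lemma line_stat_mean_delta_drop:
  assumes b: "b \<in> L" and s: "0 < s" "\<And>c. c \<in> L \<Longrightarrow> c \<noteq> b \<Longrightarrow> s \<le> torus_dist b c"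
    and N: "1 \<le> N" and \<rho>: "0 \<le> \<rho>" and v: "torus_dist v b < \<rho> / real N" "torus_dist v b \<le> s / 2"
  shows "(cmod (lc b 0) * (1 / (10 * (\<rho>\<^sup>2 + 1)))) * (real N * torus_dist v b)\<^sup>2
      - (2 * real (card L) * (C / (29 / 100 * (s / 2)))) / real N
      \<le> cmod (line_stat_mean delta_coeff N b) - cmod (line_stat_mean delta_coeff N v)"
proof -
  define E where "E = real (card L) * (C / (29 / 100 * (s / 2)))"
  define p where "p = 2 * real N + 1"
  define x2 where "x2 = (real N * torus_dist v b)\<^sup>2"
  have C0: "0 \<le> C" by (rule C_nonneg[OF b])
  then have E0: "0 \<le> E" using s by (simp add: E_def)
  have N1: "1 \<le> real N" using N by simp
  have td0: "0 \<le> torus_dist v b" by (simp add: torus_dist_def)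
  have tb: "torus_dist b b \<le> s / 2" using s by (simp add: torus_dist_def Arg_cis)
  have "\<bar>cmod (line_stat_mean delta_coeff N b) - cmod (lc b 0)\<bar> \<le> E / p"
    using line_stat_mean_delta_peak[OF b s tb, of N] by (simp add: dirichlet_zero E_def p_def add_nonneg_eq_0_iff)
  moreover have "\<bar>cmod (line_stat_mean delta_coeff N v) - cmod (lc b 0) * (\<bar>dirichlet N (b - v)\<bar> / p)\<bar> \<le> E / p"
    using line_stat_mean_delta_peak[OF b s v(2), of N] by (simp add: E_def p_def)
  moreover have "cmod (lc b 0) * (\<bar>dirichlet N (b - v)\<bar> / p) \<le> cmod (lc b 0) * (1 - (1 / (10 * (\<rho>\<^sup>2 + 1))) * x2)"
  proof (intro mult_left_mono)
    obtain z :: int where z: "torus_dist v b = \<bar>v - b - 2 * pi * of_int z\<bar>" using torus_dist_representative by blast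
    define x where "x = v - b - 2 * pi * of_int z"
    have x: "\<bar>x\<bar> = torus_dist v b" by (simp add: x_def z)
    have "torus_dist v b \<le> pi" using Arg_bounded[of "cis (v - b)"] by (auto simp: torus_dist_def)
    then have "\<bar>dirichlet N x\<bar> \<le> p * (1 - min (1 / 10) ((real N * x)\<^sup>2 / 9))"
      unfolding p_def using N x by (intro dirichlet_peak) auto
    moreover have "dirichlet N x = dirichlet N (b - v)"
      using dirichlet_periodic[of N "v - b" z] dirichlet_minus[of N "v - b"] by (simp add: x_def)
    moreover have "(real N * x)\<^sup>2 = x2" unfolding x2_def x[symmetric] by (simp add: power_mult_distrib)
    ultimately have "\<bar>dirichlet N (b - v)\<bar> / p \<le> 1 - min (1 / 10) (x2 / 9)"
      by (simp add: p_def pos_divide_le_eq mult.commute)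
    moreover have "(1 / (10 * (\<rho>\<^sup>2 + 1))) * x2 \<le> min (1 / 10) (x2 / 9)"
    proof -
      have "real N * torus_dist v b \<le> \<rho>" using v(1) N1 by (simp add: pos_less_divide_eq mult.commute)
      then have "x2 \<le> \<rho>\<^sup>2" unfolding x2_def using td0 by (intro power_mono) auto
      then have "x2 \<le> \<rho>\<^sup>2 + 1" by simp
      moreover have "0 < \<rho>\<^sup>2 + 1" by (simp add: add_nonneg_pos)
      ultimately have "(1 / (10 * (\<rho>\<^sup>2 + 1))) * x2 \<le> 1 / 10" by (simp add: field_simps)
      moreover have "(1 / (10 * (\<rho>\<^sup>2 + 1))) * x2 \<le> (1 / 9) * x2"
      proof (rule mult_right_mono)
        have "9 \<le> 10 * (\<rho>\<^sup>2 + 1)" by simp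
        then show "1 / (10 * (\<rho>\<^sup>2 + 1)) \<le> 1 / 9" by (intro divide_left_mono mult_pos_pos add_nonneg_pos) auto
      qed (simp add: x2_def)
      ultimately show ?thesis by simp
    qed
    ultimately show "\<bar>dirichlet N (b - v)\<bar> / p \<le> 1 - (1 / (10 * (\<rho>\<^sup>2 + 1))) * x2" by linarith
  qed simp
  moreover have "E / p \<le> E / real N" using E0 N1 by (intro divide_left_mono) (auto simp: p_def)
  moreover have "cmod (lc b 0) * (1 - (1 / (10 * (\<rho>\<^sup>2 + 1))) * x2) = cmod (lc b 0) - (cmod (lc b 0) * (1 / (10 * (\<rho>\<^sup>2 + 1)))) * x2"
    by (simp add: right_diff_distrib)
  moreover have "(2 * real (card L) * (C / (29 / 100 * (s / 2)))) / real N = E / real N + E / real N" by (simp add: E_def mult_ac)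
  ultimately show ?thesis unfolding x2_def[symmetric] by linarith
qed

lemma line_stat_mean_delta_off_peak:
  assumes b: "b \<in> L" and r: "0 < r" and far: "\<And>c. c \<in> L \<Longrightarrow> r \<le> torus_dist v c"
  shows "cmod (line_stat_mean delta_coeff N v) \<le> real (card L) * (C / (29 / 100 * r)) / (2 * real N + 1)"
proof -
  have C0: "0 \<le> C" by (rule C_nonneg[OF b])
  have "cmod (\<Sum>c\<in>L. lc c 0 * of_real (dirichlet N (c - v))) \<le> (\<Sum>c\<in>L. C * (1 / (29 / 100 * r)))"
  proof (intro sum_norm_le)
    fix c assume "c \<in> L"
    then show "cmod (lc c 0 * of_real (dirichlet N (c - v))) \<le> C * (1 / (29 / 100 * r))"
      unfolding norm_mult norm_of_real using r far C0 by (intro mult_mono dirichlet_off_peak lc_zero_le) auto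
  qed
  then have *: "cmod (\<Sum>c\<in>L. lc c 0 * of_real (dirichlet N (c - v))) \<le> real (card L) * (C / (29 / 100 * r))" by simp
  have "cmod (line_stat_mean delta_coeff N v) = cmod (\<Sum>c\<in>L. lc c 0 * of_real (dirichlet N (c - v))) / (2 * real N + 1)"
    unfolding line_stat_mean_delta norm_divide norm_of_real by simp
  also have "\<dots> \<le> real (card L) * (C / (29 / 100 * r)) / (2 * real N + 1)"
    by (rule divide_right_mono[OF *]) simp
  finally show ?thesis .
qed

text \<open>Once the noise is uniformly below \<open>\<epsilon>\<close>, the hypotheses of \<open>procedure_locates\<close> hold for large \<open>n\<close> with
\<open>r = \<rho> / N\<close>.  The choice of \<open>\<rho>\<close> brings the mean of \<open>U\<close> below \<open>\<delta> / 2\<close> at distance at least \<open>r\<close> from all lines,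
and \<open>\<epsilon> \<le> \<delta> / 2\<close> keeps \<open>|U|\<close> below the threshold there.  At \<open>b\<close>, where the mean of \<open>U\<close> is close
to \<open>lc b 0\<close>, four times \<open>\<epsilon>\<close> fits between \<open>|lc b 0|\<close> and \<open>\<delta>\<close>: this pays for the noise, the tails of
the other lines and the term \<open>(ln n / n) powr (1/4)\<close> of the threshold.  The block length \<open>ell n / n\<close>
is at least \<open>2 r\<close> since \<open>ell\<close> tends to infinity, and it tends to 0.\<close>

lemma procedure_locates_eventually:
  assumes b: "b \<in> L" and \<delta>: "0 < \<delta>" "\<delta> < cmod (lc b 0)"
    and ell: "filterlim ell at_top sequentially" "ell \<in> o(\<lambda>n. real n)"
  defines "\<rho> \<equiv> 4 * real (card L) * C / \<delta> + 1" and "\<epsilon> \<equiv> min (\<delta> / 2) ((cmod (lc b 0) - \<delta>) / 4)"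
  shows "\<forall>\<^sub>F n in sequentially. even n \<longrightarrow>
    (\<forall>\<omega> (loc :: nat \<Rightarrow> real) (tie :: nat \<Rightarrow> nat) w. (\<forall>v. cmod (line_stat delta_coeff (n div 2) v \<omega> - line_stat_mean delta_coeff (n div 2) v) \<le> \<epsilon>) \<longrightarrow>
       block_maxima (\<lambda>v. cmod (line_stat delta_coeff (n div 2) v \<omega>)) (ell n / real n) loc \<longrightarrow> inj tie \<longrightarrow>
       closest_location (remaining_blocks (\<lambda>v. cmod (line_stat delta_coeff (n div 2) v \<omega>)) (ell n / real n) loc tie
           (\<delta> + (ln (real n) / real n) powr (1/4))) loc b w \<longrightarrow>
       torus_dist w b < \<rho> / real (n div 2) \<and>
       cmod (line_stat delta_coeff (n div 2) b \<omega>) \<le> cmod (line_stat delta_coeff (n div 2) w \<omega>))"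
proof -
  obtain s where s: "0 < s" "\<And>c. c \<in> L \<Longrightarrow> c \<noteq> b \<Longrightarrow> s \<le> torus_dist b c" using separation[OF b] by blast
  define K where "K = real (card L) * (C / (29 / 100 * (s / 2)))"
  have C0: "0 \<le> C" by (rule C_nonneg[OF b])
  have K0: "0 \<le> K" using C0 s by (simp add: K_def)
  have \<epsilon>0: "0 < \<epsilon>" using \<delta> by (simp add: \<epsilon>_def)
  have \<rho>1: "1 \<le> \<rho>" using C0 \<delta> by (simp add: \<rho>_def)
  have small: "(\<lambda>n. ell n / real n) \<longlonglongrightarrow> 0" using ell(2) by (auto dest: smalloD_tendsto)
  have e1: "\<forall>\<^sub>F n in sequentially. ell n / real n < s / 2"
    using order_tendstoD(2)[OF small, of "s / 2"] s by simp
  have e2: "\<forall>\<^sub>F n in sequentially. 4 * \<rho> \<le> ell n" using ell(1) by (simp add: filterlim_at_top)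
  have e3: "\<forall>\<^sub>F n in sequentially. 4 * \<rho> / real n < s / 2"
    by (rule order_tendstoD(2)[where y = 0]) (use s in \<open>real_asymp, simp\<close>)
  have e4: "\<forall>\<^sub>F n in sequentially. K / real n < \<epsilon>"
    by (rule order_tendstoD(2)[where y = 0]) (use \<epsilon>0 in \<open>real_asymp, simp\<close>)
  have e5: "\<forall>\<^sub>F n in sequentially. (ln (real n) / real n) powr (1/4) < \<epsilon>"
    by (rule order_tendstoD(2)[where y = 0]) (use \<epsilon>0 in \<open>real_asymp, simp\<close>)
  have e6: "\<forall>\<^sub>F n in sequentially. 2 \<le> n" by (rule eventually_ge_at_top)
  show ?thesis
    using e1 e2 e3 e4 e5 e6
  proof eventually_elim
    case (elim n)
    show ?case
    proof (intro impI allI)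
      fix \<omega> and loc :: "nat \<Rightarrow> real" and tie :: "nat \<Rightarrow> nat" and w :: real
      assume n: "even n"
      define N where "N = n div 2"
      define V where "V v = cmod (line_stat delta_coeff N v \<omega>)" for v
      define h where "h = ell n / real n"
      define r where "r = \<rho> / real N"
      define \<theta> where "\<theta> = \<delta> + (ln (real n) / real n) powr (1/4)"
      assume sup: "\<forall>v. cmod (line_stat delta_coeff (n div 2) v \<omega> - line_stat_mean delta_coeff (n div 2) v) \<le> \<epsilon>"
      assume maxima: "block_maxima (\<lambda>v. cmod (line_stat delta_coeff (n div 2) v \<omega>)) (ell n / real n) loc"
      assume tie: "inj tie"
      assume w: "closest_location (remaining_blocks (\<lambda>v. cmod (line_stat delta_coeff (n div 2) v \<omega>)) (ell n / real n) loc tie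
           (\<delta> + (ln (real n) / real n) powr (1/4))) loc b w"
      have nN: "real n = 2 * real N" using n by (auto simp: N_def elim!: evenE)
      have N1: "1 \<le> real N" using elim(6) nN by simp
      have r0: "0 < r" using \<rho>1 N1 by (simp add: r_def)
      have r2: "2 * r = 4 * \<rho> / real n" by (simp add: r_def nN)
      have r2h: "2 * r \<le> h" unfolding r2 h_def using elim(2) by (intro divide_right_mono) auto
      have h0: "0 < h" using r2h r0 by linarith
      have V_up: "V v \<le> cmod (line_stat_mean delta_coeff N v) + \<epsilon>" and V_low: "cmod (line_stat_mean delta_coeff N v) - \<epsilon> \<le> V v" for v
        using sup norm_triangle_ineq3[of "line_stat delta_coeff N v \<omega>" "line_stat_mean delta_coeff N v"]
        unfolding V_def N_def[symmetric] by (smt (verit))+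
      have far: "V v \<le> \<theta>" if "\<And>c. c \<in> L \<Longrightarrow> r \<le> torus_dist v c" for v
      proof -
        have "cmod (line_stat_mean delta_coeff N v) \<le> real (card L) * (C / (29 / 100 * r)) / (2 * real N + 1)"
          by (rule line_stat_mean_delta_off_peak[OF b r0 that])
        also have "\<dots> \<le> real (card L) * (C / (29 / 100 * r)) / (2 * real N)"
          using C0 r0 N1 by (intro divide_left_mono) auto
        also have "\<dots> = (50 / 29) * (real (card L) * C / \<rho>)" using N1 \<rho>1 by (simp add: r_def field_simps)
        also have "\<dots> \<le> 2 * (real (card L) * C / \<rho>)" using C0 \<rho>1 by (intro mult_right_mono) auto
        also have "\<dots> \<le> \<delta> / 2"
        proof -
          have "4 * real (card L) * C \<le> \<delta> * \<rho>" using \<delta> by (simp add: \<rho>_def distrib_left)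
          then show ?thesis using \<rho>1 by (simp add: field_simps)
        qed
        finally have "V v \<le> \<delta>" using V_up[of v] unfolding \<epsilon>_def by linarith
        also have "\<dots> \<le> \<theta>" by (simp add: \<theta>_def)
        finally show ?thesis .
      qed
      have top: "\<theta> < V b"
      proof -
        have tb: "torus_dist b b \<le> s / 2" using s by (simp add: torus_dist_def Arg_cis)
        have "\<bar>cmod (line_stat_mean delta_coeff N b) - cmod (lc b 0)\<bar> \<le> K / (2 * real N + 1)"
          using line_stat_mean_delta_peak[OF b s tb, of N] by (simp add: dirichlet_zero K_def add_nonneg_eq_0_iff)
        also have "\<dots> \<le> K / real n" unfolding nN using K0 N1 by (intro divide_left_mono) auto
        also have "\<dots> < \<epsilon>" by (rule elim)
        finally have "cmod (lc b 0) - 2 * \<epsilon> < V b" using V_low[of b] by linarith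
        moreover have "\<theta> < \<delta> + \<epsilon>" using elim(5) by (simp add: \<theta>_def)
        moreover have "4 * \<epsilon> \<le> cmod (lc b 0) - \<delta>" by (simp add: \<epsilon>_def min_def)
        ultimately show ?thesis using \<epsilon>0 by linarith
      qed
      have sep: "2 * r + h \<le> torus_dist b c" if "c \<in> L" "c \<noteq> b" for c
        using s(2)[OF that] elim(1,3) unfolding r2 h_def by linarith
      have "torus_dist w b < r" "V b \<le> V w"
        using procedure_locates[where V = V and r = r and \<theta> = \<theta> and h = h and loc = loc and tie = tie and w = w,
            OF b L_sub h0 r2h far top sep] maxima tie w
        unfolding V_def[abs_def] h_def \<theta>_def N_def by auto
      then show "torus_dist w b < \<rho> / real (n div 2) \<and>
         cmod (line_stat delta_coeff (n div 2) b \<omega>) \<le> cmod (line_stat delta_coeff (n div 2) w \<omega>)"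
        by (simp add: r_def V_def N_def)
    qed
  qed
qed

lemma U_stat_eq: "even n \<Longrightarrow> U_stat X n v \<omega> = line_stat delta_coeff (n div 2) v \<omega>"
  using smoothed_periodogram[of "\<lambda>_. 1" n v \<omega>] by (simp add: U_stat_def add.commute)

text \<open>The hypotheses of \<open>mean_square_bound\<close> hold for large even \<open>n\<close>, and \<open>1 / N\<close> is at most
\<open>2 bw 0 / (n bw n)\<close>.\<close>

lemma estimate_mean_square:
  assumes b: "b \<in> L" and \<delta>: "0 < \<delta>" "\<delta> < cmod (lc b 0)"
    and ell: "filterlim ell at_top sequentially" "ell \<in> o(\<lambda>n. real n)"
    and K: "kernel K" and bw: "\<And>n. 0 < bw n" "decseq bw"
    and wm: "\<And>n. w n \<in> borel_measurable M"
    and proc: "\<And>n \<omega>. even n \<Longrightarrow> 0 < n \<Longrightarrow> \<omega> \<in> space M \<Longrightarrow>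
       \<exists>loc tie. block_maxima (\<lambda>v. cmod (U_stat X n v \<omega>)) (ell n / real n) loc \<and> inj tie \<and>
         closest_location (remaining_blocks (\<lambda>v. cmod (U_stat X n v \<omega>)) (ell n / real n) loc tie
           (\<delta> + (ln (real n) / real n) powr (1/4))) loc b (w n \<omega>)"
  shows "\<exists>Q \<Phi>. 0 \<le> Q \<and> (\<forall>\<^sub>F n in sequentially. even n \<longrightarrow>
      (\<lambda>\<omega>. fhat X K bw n (w n \<omega>) \<eta> \<omega>) \<in> borel_measurable M \<and>
      integrable M (\<lambda>\<omega>. (cmod (fhat X K bw n (w n \<omega>) \<eta> \<omega> - \<Phi> n))\<^sup>2) \<and>
      expectation (\<lambda>\<omega>. (cmod (fhat X K bw n (w n \<omega>) \<eta> \<omega> - \<Phi> n))\<^sup>2) \<le> Q / (real n * bw n))"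
proof -
  obtain s where s: "0 < s" "\<And>c. c \<in> L \<Longrightarrow> c \<noteq> b \<Longrightarrow> s \<le> torus_dist b c" using separation[OF b] by blast
  obtain B where B: "0 \<le> B" "\<And>x. K x \<le> B" using kernel_bounds[OF K] by blast
  define \<rho> where "\<rho> = 4 * real (card L) * C / \<delta> + 1"
  define \<epsilon> where "\<epsilon> = min (\<delta> / 2) ((cmod (lc b 0) - \<delta>) / 4)"
  define C1 where "C1 = C / 2 + \<bar>W\<bar> + real (card L) * (C / (29 / 100 * (s / 2)))"
  define C2 where "C2 = 2 * real (card L) * (C / (29 / 100 * (s / 2)))"
  define c where "c = cmod (lc b 0) * (1 / (10 * (\<rho>\<^sup>2 + 1)))"
  define \<kappa> where "\<kappa> n = kernel_coeff (\<lambda>\<mu>. scaled_kernel K (bw n) (\<mu> - \<eta>))" for n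
  define \<Phi> where "\<Phi> n = centre b (\<kappa> n) (n div 2)" for n
  have C0: "0 \<le> C" by (rule C_nonneg[OF b])
  have \<rho>0: "0 \<le> \<rho>" using C0 \<delta> by (simp add: \<rho>_def)
  have pos: "0 < \<epsilon>" "0 \<le> C1" "0 \<le> C2" "0 < c" "0 \<le> 2 * pi * B"
    using C0 \<delta> s B by (auto simp: \<epsilon>_def C1_def C2_def c_def intro!: mult_pos_pos divide_pos_pos add_nonneg_pos)
  obtain Q where Q: "\<And>N h \<kappa> w \<Phi>. 1 \<le> N \<and> 0 < h \<and> (\<forall>j. cmod (\<kappa> j) \<le> 1) \<and>
     (\<forall>k. (\<Sum>m=-int N..int N. (cmod (\<kappa> (k - m)))\<^sup>2) \<le> 2 * pi * B / h) \<and> w \<in> borel_measurable M \<and> cmod \<Phi> \<le> C \<and>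
     (\<forall>\<omega>\<in>space M. (\<forall>v. cmod (line_stat delta_coeff N v \<omega> - line_stat_mean delta_coeff N v) \<le> \<epsilon>) \<longrightarrow>
        torus_dist (w \<omega>) b < \<rho> / real N \<and> cmod (line_stat delta_coeff N b \<omega>) \<le> cmod (line_stat delta_coeff N (w \<omega>) \<omega>)) \<and>
     (\<forall>v. torus_dist v b < \<rho> / real N \<longrightarrow>
        cmod (line_stat_mean \<kappa> N v - \<Phi>) \<le> C1 * ((real N * torus_dist v b)\<^sup>2 + 1 / sqrt (real N)) \<and>
        c * (real N * torus_dist v b)\<^sup>2 - C2 / real N \<le> cmod (line_stat_mean delta_coeff N b) - cmod (line_stat_mean delta_coeff N v))
     \<Longrightarrow> integrable M (\<lambda>\<omega>. (cmod (line_stat \<kappa> N (w \<omega>) \<omega> - \<Phi>))\<^sup>2) \<and>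
         expectation (\<lambda>\<omega>. (cmod (line_stat \<kappa> N (w \<omega>) \<omega> - \<Phi>))\<^sup>2) \<le> Q * (1 / (real N * h) + 1 / real N)"
    using mean_square_bound[OF \<rho>0 pos(1,2,3) C0 pos(4,5), of b] by blast
  define Q' where "Q' = 2 * \<bar>Q\<bar> * (1 + bw 0)"
  have e1: "\<forall>\<^sub>F n in sequentially. 2 * \<rho> / real n < s / 2"
    by (rule order_tendstoD(2)[where y = 0]) (use s in \<open>real_asymp, simp\<close>)
  have e2: "\<forall>\<^sub>F n in sequentially. 2 \<le> n" by (rule eventually_ge_at_top)
  note e3 = procedure_locates_eventually[OF b \<delta> ell, folded \<rho>_def \<epsilon>_def]
  have "\<forall>\<^sub>F n in sequentially. even n \<longrightarrow>
      (\<lambda>\<omega>. fhat X K bw n (w n \<omega>) \<eta> \<omega>) \<in> borel_measurable M \<and>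
      integrable M (\<lambda>\<omega>. (cmod (fhat X K bw n (w n \<omega>) \<eta> \<omega> - \<Phi> n))\<^sup>2) \<and>
      expectation (\<lambda>\<omega>. (cmod (fhat X K bw n (w n \<omega>) \<eta> \<omega> - \<Phi> n))\<^sup>2) \<le> Q' / (real n * bw n)"
    using e1 e2 e3
  proof eventually_elim
    case (elim n)
    show ?case
    proof
      assume n: "even n"
      define N where "N = n div 2"
      have nN: "real n = 2 * real N" using n by (auto simp: N_def elim!: evenE)
      have N1: "1 \<le> real N" using elim(2) nN by simp
      note kb = scaled_kernel_coeff_bounds[OF K B bw(1)[of n], where \<eta> = \<eta>, folded \<kappa>_def]
      have fh: "fhat X K bw n v \<eta> \<omega> = line_stat (\<kappa> n) N v \<omega>" for v \<omega>
        unfolding fhat_def \<kappa>_def N_def by (rule smoothed_periodogram[OF kb(1) n])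
      have \<kappa>1: "cmod (\<kappa> n j) \<le> 1" for j by (rule kb(2))
      have \<kappa>2: "(\<Sum>m=-int N..int N. (cmod (\<kappa> n (k - m)))\<^sup>2) \<le> 2 * pi * B / bw n" for k
      proof -
        have "(\<Sum>m=-int N..int N. (cmod (\<kappa> n (k - m)))\<^sup>2) = (\<Sum>j\<in>(\<lambda>m. k - m) ` {-int N..int N}. (cmod (\<kappa> n j))\<^sup>2)"
          by (subst sum.reindex) (auto simp: inj_on_def)
        also have "\<dots> \<le> 2 * pi * B / bw n" by (rule kb(3)) simp
        finally show ?thesis .
      qed
      have loc: "torus_dist (w n \<omega>) b < \<rho> / real N \<and> cmod (line_stat delta_coeff N b \<omega>) \<le> cmod (line_stat delta_coeff N (w n \<omega>) \<omega>)"
        if "\<omega> \<in> space M" "\<forall>v. cmod (line_stat delta_coeff N v \<omega> - line_stat_mean delta_coeff N v) \<le> \<epsilon>" for \<omega>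
      proof -
        have "0 < n" using elim(2) by simp
        from proc[OF n this that(1)] obtain loc tie where
          "block_maxima (\<lambda>v. cmod (line_stat delta_coeff (n div 2) v \<omega>)) (ell n / real n) loc" "inj tie"
          "closest_location (remaining_blocks (\<lambda>v. cmod (line_stat delta_coeff (n div 2) v \<omega>)) (ell n / real n) loc tie
           (\<delta> + (ln (real n) / real n) powr (1/4))) loc b (w n \<omega>)"
          unfolding U_stat_eq[OF n] by blast
        then show ?thesis using elim(3) n that(2) unfolding N_def by blast
      qed
      have near: "torus_dist v b \<le> s / 2" if "torus_dist v b < \<rho> / real N" for v
      proof -
        have "\<rho> / real N = 2 * \<rho> / real n" using N1 by (simp add: nN)
        then show ?thesis using that elim(1) by linarith
      qed
      have means: "cmod (line_stat_mean (\<kappa> n) N v - \<Phi> n) \<le> C1 * ((real N * torus_dist v b)\<^sup>2 + 1 / sqrt (real N)) \<and>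
        c * (real N * torus_dist v b)\<^sup>2 - C2 / real N \<le> cmod (line_stat_mean delta_coeff N b) - cmod (line_stat_mean delta_coeff N v)"
        if v: "torus_dist v b < \<rho> / real N" for v
      proof
        have N: "1 \<le> N" using N1 by simp
        show "cmod (line_stat_mean (\<kappa> n) N v - \<Phi> n) \<le> C1 * ((real N * torus_dist v b)\<^sup>2 + 1 / sqrt (real N))"
          unfolding C1_def \<Phi>_def N_def[symmetric] by (rule line_stat_mean_near_line[OF b s \<kappa>1 N near[OF v]])
        show "c * (real N * torus_dist v b)\<^sup>2 - C2 / real N \<le> cmod (line_stat_mean delta_coeff N b) - cmod (line_stat_mean delta_coeff N v)"
          unfolding c_def C2_def by (rule line_stat_mean_delta_drop[OF b s N \<rho>0 v near[OF v]])
      qed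
      have \<Phi>C: "cmod (\<Phi> n) \<le> C" unfolding \<Phi>_def by (rule centre_bounded[OF b \<kappa>1])
      have *: "integrable M (\<lambda>\<omega>. (cmod (line_stat (\<kappa> n) N (w n \<omega>) \<omega> - \<Phi> n))\<^sup>2) \<and>
         expectation (\<lambda>\<omega>. (cmod (line_stat (\<kappa> n) N (w n \<omega>) \<omega> - \<Phi> n))\<^sup>2) \<le> Q * (1 / (real N * bw n) + 1 / real N)"
      proof (rule Q, intro conjI ballI allI)
        show "1 \<le> N" using N1 by simp
      qed (use bw(1)[of n] \<kappa>1 \<kappa>2 wm \<Phi>C loc means in blast)+
      have "Q * (1 / (real N * bw n) + 1 / real N) \<le> \<bar>Q\<bar> * (1 / (real N * bw n) + 1 / real N)"
        using N1 bw(1)[of n] by (intro mult_right_mono) auto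
      also have "\<dots> = 2 * \<bar>Q\<bar> * (1 + bw n) / (real n * bw n)"
        using N1 bw(1)[of n] by (simp add: nN field_simps)
      also have "\<dots> \<le> 2 * \<bar>Q\<bar> * (1 + bw 0) / (real n * bw n)"
        using bw(1)[of n] decseqD[OF bw(2), of 0 n] by (intro divide_right_mono mult_left_mono) auto
      finally have "Q * (1 / (real N * bw n) + 1 / real N) \<le> Q' / (real n * bw n)" by (simp add: Q'_def)
      then show "(\<lambda>\<omega>. fhat X K bw n (w n \<omega>) \<eta> \<omega>) \<in> borel_measurable M \<and>
        integrable M (\<lambda>\<omega>. (cmod (fhat X K bw n (w n \<omega>) \<eta> \<omega> - \<Phi> n))\<^sup>2) \<and>
        expectation (\<lambda>\<omega>. (cmod (fhat X K bw n (w n \<omega>) \<eta> \<omega> - \<Phi> n))\<^sup>2) \<le> Q' / (real n * bw n)"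
        unfolding fh using * line_stat_measurable[OF wm[of n]] by force
    qed
  qed
  moreover have "0 \<le> Q'" using bw(1)[of 0] by (simp add: Q'_def)
  ultimately show ?thesis by blast
qed

end

section \<open>The covariance of two estimates\<close>

text \<open>The covariance is unchanged when constants are subtracted, and it is the difference of two terms
that the Cauchy--Schwarz inequality bounds.\<close>

lemma (in prob_space) complex_cov_le:
  assumes [measurable]: "A \<in> borel_measurable M" "B \<in> borel_measurable M"
    and A2: "integrable M (\<lambda>\<omega>. (cmod (A \<omega> - a))\<^sup>2)" and B2: "integrable M (\<lambda>\<omega>. (cmod (B \<omega> - b))\<^sup>2)"
  shows "cmod (complex_cov M A B) \<le>
    2 * (sqrt (expectation (\<lambda>\<omega>. (cmod (A \<omega> - a))\<^sup>2)) * sqrt (expectation (\<lambda>\<omega>. (cmod (B \<omega> - b))\<^sup>2)))"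
proof -
  define P where "P \<omega> = A \<omega> - a" for \<omega>
  define S where "S \<omega> = cnj (B \<omega> - b)" for \<omega>
  have Pm[measurable]: "P \<in> borel_measurable M" unfolding P_def[abs_def] by measurable
  have Sm[measurable]: "S \<in> borel_measurable M" unfolding S_def[abs_def] by measurable
  have P2: "integrable M (\<lambda>\<omega>. (cmod (P \<omega>))\<^sup>2)" using A2 by (simp add: P_def)
  have S2: "integrable M (\<lambda>\<omega>. (cmod (S \<omega>))\<^sup>2)" using B2 unfolding S_def complex_mod_cnj .
  have one: "integrable M (\<lambda>\<omega>. (cmod (1::complex))\<^sup>2)" by simp
  have Pi: "integrable M P" using integral_cauchy_schwarz(1)[OF Pm _ P2 one] by simp
  have Si: "integrable M S" using integral_cauchy_schwarz(1)[OF Sm _ S2 one] by simp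
  have PSi: "integrable M (\<lambda>\<omega>. P \<omega> * S \<omega>)" by (rule integral_cauchy_schwarz(1)[OF Pm Sm P2 S2])
  have P1: "cmod (integral\<^sup>L M P) \<le> sqrt (expectation (\<lambda>\<omega>. (cmod (P \<omega>))\<^sup>2))"
    using integral_cauchy_schwarz(2)[OF Pm _ P2 one] by (simp add: prob_space)
  have S1: "cmod (integral\<^sup>L M S) \<le> sqrt (expectation (\<lambda>\<omega>. (cmod (S \<omega>))\<^sup>2))"
    using integral_cauchy_schwarz(2)[OF Sm _ S2 one] by (simp add: prob_space)
  have PS: "cmod (expectation (\<lambda>\<omega>. P \<omega> * S \<omega>)) \<le> sqrt (expectation (\<lambda>\<omega>. (cmod (P \<omega>))\<^sup>2)) * sqrt (expectation (\<lambda>\<omega>. (cmod (S \<omega>))\<^sup>2))"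
    by (rule integral_cauchy_schwarz(2)[OF Pm Sm P2 S2])
  have EA: "integral\<^sup>L M A = integral\<^sup>L M P + a"
  proof -
    have "integral\<^sup>L M A = (LINT \<omega>|M. P \<omega> + a)" by (simp add: P_def)
    then show ?thesis using Pi by (simp add: prob_space)
  qed
  have EB: "cnj (integral\<^sup>L M B) = integral\<^sup>L M S + cnj b"
  proof -
    have "cnj (integral\<^sup>L M B) = (LINT \<omega>|M. cnj (B \<omega>))" by (rule Bochner_Integration.integral_cnj[symmetric])
    also have "\<dots> = (LINT \<omega>|M. S \<omega> + cnj b)" by (simp add: S_def)
    finally show ?thesis using Si by (simp add: prob_space)
  qed
  have EAB: "(LINT \<omega>|M. A \<omega> * cnj (B \<omega>)) = (LINT \<omega>|M. P \<omega> * S \<omega>) + a * integral\<^sup>L M S + (integral\<^sup>L M P + a) * cnj b"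
  proof -
    have "(LINT \<omega>|M. A \<omega> * cnj (B \<omega>)) = (LINT \<omega>|M. (P \<omega> * S \<omega> + a * S \<omega>) + (P \<omega> + a) * cnj b)"
      by (intro Bochner_Integration.integral_cong refl) (simp add: P_def S_def algebra_simps)
    also have "\<dots> = (LINT \<omega>|M. P \<omega> * S \<omega>) + a * integral\<^sup>L M S + (integral\<^sup>L M P + a) * cnj b"
      using PSi Si Pi by (simp add: prob_space)
    finally show ?thesis .
  qed
  have "complex_cov M A B = (LINT \<omega>|M. P \<omega> * S \<omega>) - integral\<^sup>L M P * integral\<^sup>L M S"
    unfolding complex_cov_def EA EB EAB by (simp add: algebra_simps)
  then have "cmod (complex_cov M A B) \<le> cmod (LINT \<omega>|M. P \<omega> * S \<omega>) + cmod (integral\<^sup>L M P) * cmod (integral\<^sup>L M S)"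
    by (metis norm_mult norm_triangle_ineq4)
  also have "\<dots> \<le> sqrt (expectation (\<lambda>\<omega>. (cmod (P \<omega>))\<^sup>2)) * sqrt (expectation (\<lambda>\<omega>. (cmod (S \<omega>))\<^sup>2))
     + sqrt (expectation (\<lambda>\<omega>. (cmod (P \<omega>))\<^sup>2)) * sqrt (expectation (\<lambda>\<omega>. (cmod (S \<omega>))\<^sup>2))"
    by (intro add_mono PS mult_mono P1 S1) auto
  also have "\<dots> = 2 * (sqrt (expectation (\<lambda>\<omega>. (cmod (A \<omega> - a))\<^sup>2)) * sqrt (expectation (\<lambda>\<omega>. (cmod (B \<omega> - b))\<^sup>2)))"
    unfolding P_def S_def complex_mod_cnj by simp
  finally show ?thesis .
qed

text \<open>The covariance formula of the harmonizable process makes the absolute row sums at most the number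
of lines times the sum of the dominating function.\<close>

lemma lines_process_of_assumptions:
  assumes M: "prob_space M" and A1: "assumption1 M X L f" and A2: "assumption2 L f"
  obtains R C W where "lines_process M X R L (line_coeff f) C W"
proof -
  interpret prob_space M by (rule M)
  have H: "harmonizable_on_lines M X L f" and G: "gaussian_process M X" and Lf: "finite L"
    and mean: "\<And>k. (LINT \<omega>|M. X k \<omega>) = 0"
    and per: "\<And>b x. b \<in> L \<Longrightarrow> f b (x + 2 * pi) = f b x"
    and C1: "\<And>b. b \<in> L \<Longrightarrow> f b C1_differentiable_on UNIV"
    using A1 by (auto simp: assumption1_def)
  interpret centred_gaussian M X by unfold_locales (rule G mean)+
  obtain c :: "int \<Rightarrow> real" where c: "\<And>j. 0 \<le> c j" "\<And>b j. b \<in> L \<Longrightarrow> cmod (line_coeff f b j) \<le> c j" "c summable_on UNIV"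
    using A2 by (auto simp: assumption2_def)
  define C where "C = infsum c UNIV"
  have cov: "complex_of_real (covar k m) = (\<Sum>b\<in>L. cis (of_int k * b) * line_coeff f b (k - m))" for k m
    unfolding covar_def by (rule harmonizable_covariance[OF H Lf])
  have lc: "(\<Sum>j\<in>J. cmod (line_coeff f b j)) \<le> C" if "b \<in> L" "finite J" for b J
  proof -
    have "(\<Sum>j\<in>J. cmod (line_coeff f b j)) \<le> sum c J" using c that by (intro sum_mono) auto
    also have "\<dots> \<le> C" unfolding C_def using c that by (intro finite_sum_le_infsum) auto
    finally show ?thesis .
  qed
  have row: "(\<Sum>j\<in>J. \<bar>covar i j\<bar>) \<le> real (card L) * C" if J: "finite J" for i J
  proof -
    have "(\<Sum>j\<in>J. \<bar>covar i j\<bar>) \<le> (\<Sum>j\<in>J. \<Sum>b\<in>L. cmod (line_coeff f b (i - j)))"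
    proof (intro sum_mono)
      fix j
      have "\<bar>covar i j\<bar> = cmod (\<Sum>b\<in>L. cis (of_int i * b) * line_coeff f b (i - j))"
        unfolding cov[symmetric] by simp
      also have "\<dots> \<le> (\<Sum>b\<in>L. cmod (line_coeff f b (i - j)))" by (intro sum_norm_le) (simp add: norm_mult)
      finally show "\<bar>covar i j\<bar> \<le> (\<Sum>b\<in>L. cmod (line_coeff f b (i - j)))" .
    qed
    also have "\<dots> = (\<Sum>b\<in>L. \<Sum>j\<in>J. cmod (line_coeff f b (i - j)))" by (rule sum.swap)
    also have "\<dots> \<le> (\<Sum>b\<in>L. C)"
    proof (intro sum_mono)
      fix b assume b: "b \<in> L"
      have "(\<Sum>j\<in>J. cmod (line_coeff f b (i - j))) = (\<Sum>j\<in>(\<lambda>j. i - j) ` J. cmod (line_coeff f b j))"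
        by (subst sum.reindex) (auto simp: inj_on_def)
      also have "\<dots> \<le> C" using J by (intro lc b) simp
      finally show "(\<Sum>j\<in>J. cmod (line_coeff f b (i - j))) \<le> C" .
    qed
    finally show ?thesis by simp
  qed
  have "\<exists>W. 0 \<le> W \<and> (\<forall>n::nat. (\<Sum>j=-int n..int n. \<bar>of_int j\<bar> * cmod (line_coeff f b j)) \<le> W * sqrt (real n + 1))" if b: "b \<in> L" for b
  proof -
    obtain W where "0 \<le> W" "\<And>n::nat. (\<Sum>j=-int n..int n. \<bar>of_int j\<bar> * cmod (LBINT \<mu>:{-pi..pi}. cis (of_int j * \<mu>) * f b \<mu>)) \<le> W * sqrt (real n + 1)"
      using weighted_fourier_coefficients_sum[OF per[OF b] C1[OF b]] by blast
    then show ?thesis unfolding line_coeff_def by blast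
  qed
  then have "\<forall>b\<in>L. \<exists>W. 0 \<le> W \<and> (\<forall>n::nat. (\<Sum>j=-int n..int n. \<bar>of_int j\<bar> * cmod (line_coeff f b j)) \<le> W * sqrt (real n + 1))"
    by blast
  from bchoice[OF this] obtain W where W: "\<And>b. b \<in> L \<Longrightarrow> 0 \<le> W b"
    "\<And>b n. b \<in> L \<Longrightarrow> (\<Sum>j=-int n..int n. \<bar>of_int j\<bar> * cmod (line_coeff f b j)) \<le> W b * sqrt (real n + 1)"
    by blast
  have Wsum: "(\<Sum>j=-int n..int n. \<bar>of_int j\<bar> * cmod (line_coeff f b j)) \<le> sum W L * sqrt (real n + 1)" if b: "b \<in> L" for b n
  proof -
    have "W b \<le> sum W L" using W b Lf by (intro member_le_sum) auto
    then have "W b * sqrt (real n + 1) \<le> sum W L * sqrt (real n + 1)" by (intro mult_right_mono) auto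
    then show ?thesis using W(2)[OF b, of n] by linarith
  qed
  have "lines_process M X (real (card L) * C) L (line_coeff f) C (sum W L)"
    by unfold_locales (use row Lf H cov lc Wsum in \<open>auto simp: harmonizable_on_lines_def\<close>)
  then show ?thesis by (rule that)
qed

theorem theorem6:
  fixes M :: "'a measure" and X :: "int \<Rightarrow> 'a \<Rightarrow> real"
    and L :: "real set" and f :: "real \<Rightarrow> real \<Rightarrow> complex"
    and K :: "real \<Rightarrow> real" and bw ell :: "nat \<Rightarrow> real" and \<delta> :: real
    and w :: "real \<Rightarrow> nat \<Rightarrow> 'a \<Rightarrow> real" and b b' \<eta> \<eta>' :: real
  assumes "prob_space M"
    and "assumption1 M X L f" and "assumption2 L f" and "assumption3 L f"
    and "kernel K"
    and "\<forall>n. 0 < bw n" and "decseq bw" and "bw \<longlonglongrightarrow> 0"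
    and "filterlim (\<lambda>n. real n * bw n) at_top sequentially"
    and "0 < \<delta>"
    and "\<forall>n. even n \<and> 0 < n \<longrightarrow> 0 < ell n"
    and "filterlim ell at_top sequentially" and "ell \<in> o(\<lambda>n. real n)"
    and "procedure_estimates M X L f \<delta> ell w"
    and "b \<in> L" and "cmod (LBINT \<mu>:{-pi..pi}. f b \<mu>) > \<delta>"
    and "b' \<in> L" and "cmod (LBINT \<mu>:{-pi..pi}. f b' \<mu>) > \<delta>"
  shows "\<exists>g g' :: nat \<Rightarrow> complex.
    g \<in> O[even_at_top](\<lambda>n. of_real (1 / (real n * bw n))) \<and>
    g' \<in> O[even_at_top](\<lambda>n. of_real (ln (real n) / real n)) \<and>
    (\<forall>n. even n \<and> 0 < n \<longrightarrow>
       complex_cov M (\<lambda>\<omega>. fhat X K bw n (w b n \<omega>) \<eta> \<omega>)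
                     (\<lambda>\<omega>. fhat X K bw n (w b' n \<omega>) \<eta>' \<omega>) = g n + g' n)"
proof -
  obtain R C W where "lines_process M X R L (line_coeff f) C W"
    using lines_process_of_assumptions assms(1-3) by blast
  then interpret lines_process M X R L "line_coeff f" C W .
  have lc0: "line_coeff f c 0 = (LBINT \<mu>:{-pi..pi}. f c \<mu>)" for c by (simp add: line_coeff_def)
  define cv where "cv n = complex_cov M (\<lambda>\<omega>. fhat X K bw n (w b n \<omega>) \<eta> \<omega>)
                     (\<lambda>\<omega>. fhat X K bw n (w b' n \<omega>) \<eta>' \<omega>)" for n
  have bw: "\<And>n. 0 < bw n" "decseq bw" using assms by auto
  have est: "\<exists>Q \<Phi>. 0 \<le> Q \<and> (\<forall>\<^sub>F n in sequentially. even n \<longrightarrow>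
      (\<lambda>\<omega>. fhat X K bw n (w c n \<omega>) \<zeta> \<omega>) \<in> borel_measurable M \<and>
      integrable M (\<lambda>\<omega>. (cmod (fhat X K bw n (w c n \<omega>) \<zeta> \<omega> - \<Phi> n))\<^sup>2) \<and>
      expectation (\<lambda>\<omega>. (cmod (fhat X K bw n (w c n \<omega>) \<zeta> \<omega> - \<Phi> n))\<^sup>2) \<le> Q / (real n * bw n))"
    if c: "c \<in> L" "\<delta> < cmod (LBINT \<mu>:{-pi..pi}. f c \<mu>)" for c \<zeta>
  proof (rule estimate_mean_square[OF c(1) assms(10) _ assms(12,13,5) bw])
    show "\<delta> < cmod (line_coeff f c 0)" using c by (simp add: lc0)
    show "w c n \<in> borel_measurable M" for n using assms(14) c by (auto simp: procedure_estimates_def)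
    fix n :: nat and \<omega> assume "even n" "0 < n" "\<omega> \<in> space M"
    then have "\<exists>loc tie. block_maxima (\<lambda>v. cmod (U_stat X n v \<omega>)) (ell n / real n) loc \<and> inj tie \<and>
              (\<forall>b\<in>L. cmod (LBINT \<mu>:{-pi..pi}. f b \<mu>) > \<delta> \<longrightarrow>
                 closest_location (remaining_blocks (\<lambda>v. cmod (U_stat X n v \<omega>)) (ell n / real n) loc tie
                   (\<delta> + (ln (real n) / real n) powr (1/4))) loc b (w b n \<omega>))"
      using assms(14) unfolding procedure_estimates_def Let_def by blast
    then show "\<exists>loc tie. block_maxima (\<lambda>v. cmod (U_stat X n v \<omega>)) (ell n / real n) loc \<and> inj tie \<and>
         closest_location (remaining_blocks (\<lambda>v. cmod (U_stat X n v \<omega>)) (ell n / real n) loc tie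
           (\<delta> + (ln (real n) / real n) powr (1/4))) loc c (w c n \<omega>)"
      using c by blast
  qed
  obtain Q1 \<Phi>1 where Q1: "0 \<le> Q1" "\<forall>\<^sub>F n in sequentially. even n \<longrightarrow>
      (\<lambda>\<omega>. fhat X K bw n (w b n \<omega>) \<eta> \<omega>) \<in> borel_measurable M \<and>
      integrable M (\<lambda>\<omega>. (cmod (fhat X K bw n (w b n \<omega>) \<eta> \<omega> - \<Phi>1 n))\<^sup>2) \<and>
      expectation (\<lambda>\<omega>. (cmod (fhat X K bw n (w b n \<omega>) \<eta> \<omega> - \<Phi>1 n))\<^sup>2) \<le> Q1 / (real n * bw n)"
    using est[OF assms(15,16)] by blast
  obtain Q2 \<Phi>2 where Q2: "0 \<le> Q2" "\<forall>\<^sub>F n in sequentially. even n \<longrightarrow>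
      (\<lambda>\<omega>. fhat X K bw n (w b' n \<omega>) \<eta>' \<omega>) \<in> borel_measurable M \<and>
      integrable M (\<lambda>\<omega>. (cmod (fhat X K bw n (w b' n \<omega>) \<eta>' \<omega> - \<Phi>2 n))\<^sup>2) \<and>
      expectation (\<lambda>\<omega>. (cmod (fhat X K bw n (w b' n \<omega>) \<eta>' \<omega> - \<Phi>2 n))\<^sup>2) \<le> Q2 / (real n * bw n)"
    using est[OF assms(17,18)] by blast
  have "\<forall>\<^sub>F n in sequentially. even n \<longrightarrow> cmod (cv n) \<le> (2 * (sqrt Q1 * sqrt Q2)) * cmod (of_real (1 / (real n * bw n)))"
    using Q1(2) Q2(2)
  proof eventually_elim
    case (elim n)
    show ?case
    proof
      assume "even n"
      then have a: "(\<lambda>\<omega>. fhat X K bw n (w b n \<omega>) \<eta> \<omega>) \<in> borel_measurable M"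
        "integrable M (\<lambda>\<omega>. (cmod (fhat X K bw n (w b n \<omega>) \<eta> \<omega> - \<Phi>1 n))\<^sup>2)"
        "expectation (\<lambda>\<omega>. (cmod (fhat X K bw n (w b n \<omega>) \<eta> \<omega> - \<Phi>1 n))\<^sup>2) \<le> Q1 / (real n * bw n)"
        and b: "(\<lambda>\<omega>. fhat X K bw n (w b' n \<omega>) \<eta>' \<omega>) \<in> borel_measurable M"
        "integrable M (\<lambda>\<omega>. (cmod (fhat X K bw n (w b' n \<omega>) \<eta>' \<omega> - \<Phi>2 n))\<^sup>2)"
        "expectation (\<lambda>\<omega>. (cmod (fhat X K bw n (w b' n \<omega>) \<eta>' \<omega> - \<Phi>2 n))\<^sup>2) \<le> Q2 / (real n * bw n)"
        using elim by blast+
      define T where "T = real n * bw n"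
      have T: "0 \<le> T" using bw(1)[of n] by (simp add: T_def)
      have "cmod (cv n) \<le> 2 * (sqrt (Q1 / T) * sqrt (Q2 / T))"
        unfolding cv_def T_def using a(3) b(3) Q1(1) Q2(1) T[unfolded T_def]
        by (intro order_trans[OF complex_cov_le[OF a(1) b(1) a(2) b(2)]] mult_left_mono mult_mono) auto
      also have "\<dots> = (2 * (sqrt Q1 * sqrt Q2)) * (1 / T)"
        using T by (simp add: real_sqrt_divide)
      also have "1 / T = cmod (of_real (1 / (real n * bw n)))"
        unfolding norm_of_real T_def[symmetric] using T by simp
      finally show "cmod (cv n) \<le> (2 * (sqrt Q1 * sqrt Q2)) * cmod (of_real (1 / (real n * bw n)))" .
    qed
  qed
  then have "\<forall>\<^sub>F n in even_at_top. norm (cv n) \<le> (2 * (sqrt Q1 * sqrt Q2)) * norm (complex_of_real (1 / (real n * bw n)))"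
    by (simp add: even_at_top_def eventually_inf_principal)
  then have "cv \<in> O[even_at_top](\<lambda>n. of_real (1 / (real n * bw n)))" by (rule bigoI)
  \<comment> \<open>Since the mean squares are already of order \<open>1 / (n b_n)\<close>, the whole covariance goes into the first term.\<close>
  moreover have "(\<lambda>_. 0) \<in> O[even_at_top](\<lambda>n. complex_of_real (ln (real n) / real n))" by simp
  ultimately show ?thesis
    by (intro exI[of _ cv] exI[of _ "\<lambda>_. 0"]) (simp add: cv_def)
qed

end
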